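(* If $\mathcal{I}_1$ and $\mathcal{I}_2$ are small ideals in $L(L_1)$ that have distinct closures, then the ideals $\mathcal{I}_1^{\dagger}$ and $\mathcal{I}_2^{\dagger}$ in $L(L_\infty)$ also have distinct closures.
   Context: $L_1:=L_1(0,1)$ and $L_\infty:=L_\infty(0,1)=L_1^*$ with Lebesgue measure, over real or complex scalars. For a Banach space $X$, $L(X)$ is the Banach algebra of bounded linear operators on $X$; "ideal" always means two-sided ideal, and closures are taken in the operator norm. An operator $T:X\to Y$ is strictly singular if there is no infinite dimensional Banach space $Z$ and operator $S:Z\to X$ such that $TS$ is an isomorphism onto its image. An ideal in $L(X)$ is called small if it is contained in the ideal of strictly singular operators on $X$. For a subset $A\subset L(X)$, $A^{\#}:=\{S^*\in L(X^* ): S\in A\}$, and $A^{\dagger}:=L(X^* )\cdot A^{\#}\cdot L(X^* )=\{E S^* F : E,F\in L(X^* ),\ S\in A\}$, the set of all operators in $L(X^* )$ that factor through some operator in $A^{\#}$. If $\mathcal{I}$ is an ideal in $L(X)$ and $X\oplus X$ is isomorphic to $X$ (as is the case for $X=L_1$), then $\mathcal{I}^{\dagger}$ is an ideal in $L(X^* )$. *)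

theory Defs
  imports "HOL-Probability.Probability" "HOL-Algebra.Ideal" "HOL-Algebra.Module"
begin

text \<open>Scalars: everything is written once, for a complete normed field over the reals, and is used
  for \<^typ>\<open>real\<close> and \<^typ>\<open>complex\<close>.\<close>

class scalar = real_normed_field + banach + second_countable_topology

instance real :: scalar ..
instance complex :: scalar ..

section \<open>The Banach spaces \<open>L\<^sub>1(0,1)\<close> and \<open>L\<^sub>\<infinity>(0,1)\<close>\<close>

abbreviation leb01 :: "real measure"
  where "leb01 \<equiv> lebesgue_on {0<..<1}"

lemma emeasure_leb01: "emeasure leb01 {0<..<1} = 1"
  by (simp add: emeasure_restrict_space)

quotient_type (overloaded) 'k L1 = "real \<Rightarrow> 'k::scalar" /
  partial: "\<lambda>f g. integrable leb01 f \<and> integrable leb01 g \<and> (AE x in leb01. f x = g x)"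
proof (rule part_equivpI)
  show "\<exists>f::real \<Rightarrow> 'k. integrable leb01 f \<and> integrable leb01 f \<and> (AE x in leb01. f x = f x)"
    by (rule exI[of _ "\<lambda>x. 0"]) simp
  show "symp (\<lambda>f g::real \<Rightarrow> 'k. integrable leb01 f \<and> integrable leb01 g \<and> (AE x in leb01. f x = g x))"
    by (auto intro!: sympI elim: eventually_mono)
  show "transp (\<lambda>f g::real \<Rightarrow> 'k. integrable leb01 f \<and> integrable leb01 g \<and> (AE x in leb01. f x = g x))"
    by (auto intro!: transpI elim: eventually_elim2)
qed

instantiation L1 :: (scalar) real_normed_vector
begin

lift_definition zero_L1 :: "'a L1" is "\<lambda>x. 0" by simp
lift_definition plus_L1 :: "'a L1 \<Rightarrow> 'a L1 \<Rightarrow> 'a L1" is "\<lambda>f g x. f x + g x"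
  by (auto elim!: eventually_elim2)
lift_definition minus_L1 :: "'a L1 \<Rightarrow> 'a L1 \<Rightarrow> 'a L1" is "\<lambda>f g x. f x - g x"
  by (auto elim!: eventually_elim2)
lift_definition uminus_L1 :: "'a L1 \<Rightarrow> 'a L1" is "\<lambda>f x. - f x"
  by (auto elim!: eventually_mono)
lift_definition scaleR_L1 :: "real \<Rightarrow> 'a L1 \<Rightarrow> 'a L1" is "\<lambda>r f x. r *\<^sub>R f x"
  by (auto elim!: eventually_mono)
lift_definition norm_L1 :: "'a L1 \<Rightarrow> real" is "\<lambda>f. \<integral>x. norm (f x) \<partial>leb01"
  by (rule integral_cong_AE) (auto elim!: eventually_mono)
definition dist_L1 :: "'a L1 \<Rightarrow> 'a L1 \<Rightarrow> real" where "dist_L1 f g = norm (f - g)"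
definition sgn_L1 :: "'a L1 \<Rightarrow> 'a L1" where "sgn_L1 f = inverse (norm f) *\<^sub>R f"
definition uniformity_L1 :: "('a L1 \<times> 'a L1) filter"
  where "uniformity_L1 = (INF e\<in>{0<..}. principal {(x, y). dist x y < e})"
definition open_L1 :: "'a L1 set \<Rightarrow> bool"
  where "open_L1 U = (\<forall>x\<in>U. eventually (\<lambda>(x', y). x' = x \<longrightarrow> y \<in> U) uniformity)"

instance
proof
  fix f g h :: "'a L1" and a b :: real
  show "f + g + h = f + (g + h)" by transfer (auto simp: add.assoc)
  show "f + g = g + f" by transfer (auto simp: add.commute)
  show "0 + f = f" by transfer simp
  show "- f + f = 0" by transfer simp
  show "f - g = f + - g" by transfer simp
  show "a *\<^sub>R (f + g) = a *\<^sub>R f + a *\<^sub>R g" by transfer (simp add: scaleR_add_right)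
  show "(a + b) *\<^sub>R f = a *\<^sub>R f + b *\<^sub>R f" by transfer (simp add: scaleR_add_left)
  show "a *\<^sub>R b *\<^sub>R f = (a * b) *\<^sub>R f" by transfer simp
  show "1 *\<^sub>R f = f" by transfer simp
  show "dist f g = norm (f - g)" by (rule dist_L1_def)
  show "sgn f = inverse (norm f) *\<^sub>R f" by (rule sgn_L1_def)
  show "uniformity = (INF e\<in>{0<..}. principal {(x, y :: 'a L1). dist x y < e})"
    by (rule uniformity_L1_def)
  show "open U = (\<forall>x\<in>U. eventually (\<lambda>(x', y). x' = x \<longrightarrow> y \<in> U) uniformity)" for U :: "'a L1 set"
    by (rule open_L1_def)
  show "norm f = 0 \<longleftrightarrow> f = 0"
    by transfer (subst integral_nonneg_eq_0_iff_AE, auto)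
  show "norm (f + g) \<le> norm f + norm g"
  proof transfer
    fix f g :: "real \<Rightarrow> 'a"
    assume "integrable leb01 f \<and> integrable leb01 f \<and> (AE x in leb01. f x = f x)"
      and "integrable leb01 g \<and> integrable leb01 g \<and> (AE x in leb01. g x = g x)"
    then have int: "integrable leb01 (\<lambda>x. norm (f x))" "integrable leb01 (\<lambda>x. norm (g x))"
      and "integrable leb01 (\<lambda>x. f x + g x)" by auto
    then have "(\<integral>x. norm (f x + g x) \<partial>leb01) \<le> (\<integral>x. norm (f x) + norm (g x) \<partial>leb01)"
      by (intro Bochner_Integration.integral_mono norm_triangle_ineq
          Bochner_Integration.integrable_add[OF int] integrable_norm)
    then show "(\<integral>x. norm (f x + g x) \<partial>leb01) \<le> (\<integral>x. norm (f x) \<partial>leb01) + (\<integral>x. norm (g x) \<partial>leb01)"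
      by (simp only: Bochner_Integration.integral_add[OF int])
  qed
  show "norm (a *\<^sub>R f) = \<bar>a\<bar> * norm f" by transfer simp
qed

end

lift_definition scale_L1 :: "'k \<Rightarrow> 'k::scalar L1 \<Rightarrow> 'k L1" is "\<lambda>c f x. c * f x"
  by (auto elim!: eventually_mono)

definition ess_norm :: "(real \<Rightarrow> 'k::scalar) \<Rightarrow> ereal"
  where "ess_norm f = esssup leb01 (\<lambda>x. ereal (norm (f x)))"

definition ess_bounded :: "(real \<Rightarrow> 'k::scalar) \<Rightarrow> bool"
  where "ess_bounded f \<longleftrightarrow> f \<in> borel_measurable leb01 \<and> ess_norm f < \<infinity>"

lemma ess_bounded_measurable: "ess_bounded f \<Longrightarrow> f \<in> borel_measurable leb01"
  by (simp add: ess_bounded_def)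

lemma ess_norm_nonneg:
  assumes "f \<in> borel_measurable leb01"
  shows "0 \<le> ess_norm f"
proof -
  have "esssup leb01 (\<lambda>x. 0::ereal) = 0"
    by (rule esssup_const) (simp add: emeasure_leb01)
  moreover have "esssup leb01 (\<lambda>x. 0::ereal) \<le> ess_norm f"
    unfolding ess_norm_def by (rule esssup_mono) auto
  ultimately show ?thesis by simp
qed

lemma ess_norm_real:
  assumes "ess_bounded f"
  shows "ess_norm f = ereal (real_of_ereal (ess_norm f))"
  using assms ess_norm_nonneg[of f] by (cases "ess_norm f") (auto simp: ess_bounded_def)

lemma ess_norm_AE:
  assumes "ess_bounded f"
  shows "AE x in leb01. norm (f x) \<le> real_of_ereal (ess_norm f)"
proof -
  have "AE x in leb01. ereal (norm (f x)) \<le> ess_norm f"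
    unfolding ess_norm_def by (rule esssup_AE)
  then show ?thesis
    by (subst (asm) ess_norm_real[OF assms]) simp
qed

lemma ess_norm_le:
  assumes "f \<in> borel_measurable leb01" "AE x in leb01. norm (f x) \<le> c"
  shows "ess_bounded f" "real_of_ereal (ess_norm f) \<le> c"
proof -
  have le: "ess_norm f \<le> ereal c"
    unfolding ess_norm_def using assms by (intro esssup_I) auto
  then show "ess_bounded f"
    using assms by (auto simp: ess_bounded_def intro: le_less_trans)
  then show "real_of_ereal (ess_norm f) \<le> c"
    using le by (subst (asm) ess_norm_real) auto
qed

lemma ess_norm_cong:
  assumes "f \<in> borel_measurable leb01" "g \<in> borel_measurable leb01" "AE x in leb01. f x = g x"
  shows "ess_norm f = ess_norm g"
  unfolding ess_norm_def using assms by (intro esssup_AE_cong) (auto elim!: eventually_mono)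

lemma ess_bounded_zero: "ess_bounded (\<lambda>x. 0)"
  by (rule ess_norm_le(1)[where c = 0]) auto

lemma ess_bounded_add:
  assumes f: "ess_bounded f" and g: "ess_bounded g"
  shows "ess_bounded (\<lambda>x. f x + g x)"
    and "real_of_ereal (ess_norm (\<lambda>x. f x + g x))
      \<le> real_of_ereal (ess_norm f) + real_of_ereal (ess_norm g)"
proof -
  have *: "AE x in leb01. norm (f x + g x) \<le> real_of_ereal (ess_norm f) + real_of_ereal (ess_norm g)"
    using ess_norm_AE[OF f] ess_norm_AE[OF g] by eventually_elim (rule norm_triangle_mono)
  have **: "(\<lambda>x. f x + g x) \<in> borel_measurable leb01"
    using f g by (intro borel_measurable_add ess_bounded_measurable)
  show "ess_bounded (\<lambda>x. f x + g x)"
    and "real_of_ereal (ess_norm (\<lambda>x. f x + g x))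
      \<le> real_of_ereal (ess_norm f) + real_of_ereal (ess_norm g)"
    using ess_norm_le[OF ** *] by auto
qed

lemma ess_bounded_cmult:
  assumes f: "ess_bounded f"
  shows "ess_bounded (\<lambda>x. c * f x)"
    and "real_of_ereal (ess_norm (\<lambda>x. c * f x)) \<le> norm c * real_of_ereal (ess_norm f)"
proof -
  have *: "AE x in leb01. norm (c * f x) \<le> norm c * real_of_ereal (ess_norm f)"
    using ess_norm_AE[OF f] by eventually_elim (simp add: norm_mult mult_left_mono)
  have **: "(\<lambda>x. c * f x) \<in> borel_measurable leb01"
    using ess_bounded_measurable[OF f] by simp
  show "ess_bounded (\<lambda>x. c * f x)"
    and "real_of_ereal (ess_norm (\<lambda>x. c * f x)) \<le> norm c * real_of_ereal (ess_norm f)"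
    using ess_norm_le[OF ** *] by auto
qed

quotient_type (overloaded) 'k Linf = "real \<Rightarrow> 'k::scalar" /
  partial: "\<lambda>f g. ess_bounded f \<and> ess_bounded g \<and> (AE x in leb01. f x = g x)"
proof (rule part_equivpI)
  show "\<exists>f::real \<Rightarrow> 'k. ess_bounded f \<and> ess_bounded f \<and> (AE x in leb01. f x = f x)"
    by (rule exI[of _ "\<lambda>x. 0"]) (simp add: ess_bounded_zero)
  show "symp (\<lambda>f g::real \<Rightarrow> 'k. ess_bounded f \<and> ess_bounded g \<and> (AE x in leb01. f x = g x))"
    by (auto intro!: sympI elim: eventually_mono)
  show "transp (\<lambda>f g::real \<Rightarrow> 'k. ess_bounded f \<and> ess_bounded g \<and> (AE x in leb01. f x = g x))"
    by (auto intro!: transpI elim: eventually_elim2)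
qed

lift_definition scale_Linf :: "'k \<Rightarrow> 'k::scalar Linf \<Rightarrow> 'k Linf" is "\<lambda>c f x. c * f x"
  by (auto elim!: eventually_mono simp: ess_bounded_cmult)

instantiation Linf :: (scalar) real_normed_vector
begin

lift_definition zero_Linf :: "'a Linf" is "\<lambda>x. 0" by (simp add: ess_bounded_zero)
lift_definition plus_Linf :: "'a Linf \<Rightarrow> 'a Linf \<Rightarrow> 'a Linf" is "\<lambda>f g x. f x + g x"
  by (auto elim!: eventually_elim2 simp: ess_bounded_add)
definition uminus_Linf :: "'a Linf \<Rightarrow> 'a Linf" where "uminus_Linf f = scale_Linf (- 1) f"
definition minus_Linf :: "'a Linf \<Rightarrow> 'a Linf \<Rightarrow> 'a Linf" where "minus_Linf f g = f + (- g)"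
definition scaleR_Linf :: "real \<Rightarrow> 'a Linf \<Rightarrow> 'a Linf"
  where "scaleR_Linf r f = scale_Linf (of_real r) f"
lift_definition norm_Linf :: "'a Linf \<Rightarrow> real" is "\<lambda>f. real_of_ereal (ess_norm f)"
  by (auto intro!: arg_cong[where f = real_of_ereal] ess_norm_cong dest: ess_bounded_measurable)
definition dist_Linf :: "'a Linf \<Rightarrow> 'a Linf \<Rightarrow> real" where "dist_Linf f g = norm (f - g)"
definition sgn_Linf :: "'a Linf \<Rightarrow> 'a Linf" where "sgn_Linf f = inverse (norm f) *\<^sub>R f"
definition uniformity_Linf :: "('a Linf \<times> 'a Linf) filter"
  where "uniformity_Linf = (INF e\<in>{0<..}. principal {(x, y). dist x y < e})"
definition open_Linf :: "'a Linf set \<Rightarrow> bool"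
  where "open_Linf U = (\<forall>x\<in>U. eventually (\<lambda>(x', y). x' = x \<longrightarrow> y \<in> U) uniformity)"

instance
proof
  fix f g h :: "'a Linf" and a b :: real
  have le: "norm (scale_Linf c k) \<le> norm c * norm k" for c and k :: "'a Linf"
    by transfer (simp add: ess_bounded_cmult)
  have assoc: "scale_Linf c (scale_Linf d k) = scale_Linf (c * d) k" for c d and k :: "'a Linf"
    by transfer (auto simp: ess_bounded_cmult mult.assoc)
  have one: "scale_Linf 1 k = k" for k :: "'a Linf"
    by transfer simp
  have zero: "scale_Linf 0 k = 0" for k :: "'a Linf"
    by transfer (simp add: ess_bounded_zero)
  show "f + g + h = f + (g + h)" by transfer (simp add: add.assoc ess_bounded_add)
  show "f + g = g + f" by transfer (simp add: add.commute ess_bounded_add)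
  show "0 + f = f" by transfer simp
  show "- f + f = 0" unfolding uminus_Linf_def by transfer (simp add: ess_bounded_zero)
  show "f - g = f + - g" by (rule minus_Linf_def)
  show "a *\<^sub>R (f + g) = a *\<^sub>R f + a *\<^sub>R g"
    unfolding scaleR_Linf_def by transfer (simp add: distrib_left ess_bounded_add ess_bounded_cmult)
  show "(a + b) *\<^sub>R f = a *\<^sub>R f + b *\<^sub>R f"
    unfolding scaleR_Linf_def by transfer (simp add: distrib_right ess_bounded_add ess_bounded_cmult)
  show "a *\<^sub>R b *\<^sub>R f = (a * b) *\<^sub>R f"
    by (simp add: scaleR_Linf_def assoc)
  show "1 *\<^sub>R f = f" by (simp add: scaleR_Linf_def one)
  show "dist f g = norm (f - g)" by (rule dist_Linf_def)
  show "sgn f = inverse (norm f) *\<^sub>R f" by (rule sgn_Linf_def)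
  show "uniformity = (INF e\<in>{0<..}. principal {(x, y :: 'a Linf). dist x y < e})"
    by (rule uniformity_Linf_def)
  show "open U = (\<forall>x\<in>U. eventually (\<lambda>(x', y). x' = x \<longrightarrow> y \<in> U) uniformity)" for U :: "'a Linf set"
    by (rule open_Linf_def)
  have nn: "0 \<le> norm k" for k :: "'a Linf"
    by transfer (auto intro: real_of_ereal_pos ess_norm_nonneg dest: ess_bounded_measurable)
  have z0: "norm (0 :: 'a Linf) = 0"
    using le[of 0 0] nn[of 0] by (simp add: zero)
  show "norm f = 0 \<longleftrightarrow> f = 0"
  proof
    assume "norm f = 0"
    then show "f = 0"
    proof transfer
      fix f :: "real \<Rightarrow> 'a"
      assume f: "ess_bounded f \<and> ess_bounded f \<and> (AE x in leb01. f x = f x)"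
        and "real_of_ereal (ess_norm f) = 0"
      then have "AE x in leb01. f x = 0"
        using ess_norm_AE[of f] by simp
      with f show "ess_bounded f \<and> ess_bounded (\<lambda>x. 0::'a) \<and> (AE x in leb01. f x = 0)"
        by (simp add: ess_bounded_zero)
    qed
  qed (simp add: z0)
  show "norm (f + g) \<le> norm f + norm g"
    by transfer (simp add: ess_bounded_add)
  show "norm (a *\<^sub>R f) = \<bar>a\<bar> * norm f"
  proof (cases "a = 0")
    case True
    then show ?thesis by (simp add: scaleR_Linf_def zero z0)
  next
    case False
    have "norm (scale_Linf (of_real (inverse a)) (scale_Linf (of_real a) f))
        \<le> \<bar>inverse a\<bar> * norm (scale_Linf (of_real a) f)"
      using le[of "of_real (inverse a)" "scale_Linf (of_real a) f"]
      by (simp only: norm_of_real)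
    moreover have "scale_Linf (of_real (inverse a)) (scale_Linf (of_real a) f) = f"
      using False by (simp add: assoc one flip: of_real_mult del: of_real_inverse)
    ultimately have "\<bar>a\<bar> * norm f \<le> \<bar>a\<bar> * (\<bar>inverse a\<bar> * norm (scale_Linf (of_real a) f))"
      by (intro mult_left_mono) auto
    then have "\<bar>a\<bar> * norm f \<le> norm (scale_Linf (of_real a) f)"
      using False by (simp add: mult.assoc[symmetric] flip: abs_mult)
    moreover have "norm (scale_Linf (of_real a) f) \<le> \<bar>a\<bar> * norm f"
      using le[of "of_real a" f] by simp
    ultimately show ?thesis by (simp add: scaleR_Linf_def)
  qed
qed

end

section \<open>Operators, adjoints and the ideal \<open>\<I>\<^sup>\<dagger>\<close>\<close>

text \<open>\<^typ>\<open>'a \<Rightarrow>\<^sub>L 'b\<close> only asks for linearity over the reals.  The set below is \<open>L(X)\<close>, where the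
  argument is the multiplication of vectors of \<open>X\<close> by scalars; it is closed in \<^typ>\<open>'a \<Rightarrow>\<^sub>L 'a\<close>, so
  that \<^const>\<open>closure\<close> in \<^typ>\<open>'a \<Rightarrow>\<^sub>L 'a\<close> of a subset of \<open>L(X)\<close> is its closure in \<open>L(X)\<close>.\<close>

definition operators :: "('k::scalar \<Rightarrow> 'a \<Rightarrow> 'a) \<Rightarrow> ('a::real_normed_vector \<Rightarrow>\<^sub>L 'a) set"
  where "operators sc = {T. \<forall>c x. blinfun_apply T (sc c x) = sc c (blinfun_apply T x)}"

lemma closed_operators:
  assumes "\<And>c. bounded_linear (sc c)"
  shows "closed (operators sc)"
  unfolding operators_def
  by (intro closed_Collect_all closed_Collect_eq continuous_intros
      bounded_linear.continuous_on[OF assms])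

lemma bounded_linear_scale_L1: "bounded_linear (scale_L1 c)"
proof (rule bounded_linear_intro)
  show "scale_L1 c (f + g) = scale_L1 c f + scale_L1 c g" for f g
    by transfer (simp add: distrib_left)
  show "scale_L1 c (r *\<^sub>R f) = r *\<^sub>R scale_L1 c f" for r f
    by transfer simp
  show "norm (scale_L1 c f) \<le> norm f * norm c" for f
    by transfer (simp add: norm_mult mult.commute)
qed

lemma bounded_linear_scale_Linf: "bounded_linear (scale_Linf c)"
proof (rule bounded_linear_intro)
  show "scale_Linf c (f + g) = scale_Linf c f + scale_Linf c g" for f g
    by transfer (simp add: distrib_left ess_bounded_add ess_bounded_cmult)
  show "scale_Linf c (r *\<^sub>R f) = r *\<^sub>R scale_Linf c f" for r f
    unfolding scaleR_Linf_def by transfer (simp add: ess_bounded_cmult mult.left_commute)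
  show "norm (scale_Linf c f) \<le> norm f * norm c" for f
    by transfer (use ess_bounded_cmult(2) in \<open>simp add: mult.commute\<close>)
qed

lemma closed_operators_L1: "closed (operators scale_L1)"
  by (rule closed_operators, rule bounded_linear_scale_L1)

lemma closed_operators_Linf: "closed (operators scale_Linf)"
  by (rule closed_operators, rule bounded_linear_scale_Linf)

definition operator_ring :: "('k::scalar \<Rightarrow> 'a \<Rightarrow> 'a) \<Rightarrow> ('a::real_normed_vector \<Rightarrow>\<^sub>L 'a) ring"
  where "operator_ring sc =
    \<lparr>carrier = operators sc, monoid.mult = (o\<^sub>L), one = id_blinfun, ring.zero = 0, add = (+)\<rparr>"

text \<open>Identifying \<open>g \<in> L\<^sub>\<infinity>\<close> with the functional \<open>f \<mapsto> \<integral> f g\<close> on \<open>L\<^sub>1\<close> (no complex conjugation, so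
  that the identification is linear), \<open>R = S\<^sup>*\<close> means \<open>\<langle>S f, g\<rangle> = \<langle>f, R g\<rangle>\<close> for all \<open>f\<close> and \<open>g\<close>.\<close>

lift_definition pairing :: "'k::scalar L1 \<Rightarrow> 'k Linf \<Rightarrow> 'k" is "\<lambda>f g. \<integral>x. f x * g x \<partial>leb01"
  by (rule integral_cong_AE) (auto elim!: eventually_elim2 dest: ess_bounded_measurable)

definition is_adjoint :: "('k::scalar L1 \<Rightarrow>\<^sub>L 'k L1) \<Rightarrow> ('k Linf \<Rightarrow>\<^sub>L 'k Linf) \<Rightarrow> bool"
  where "is_adjoint S R \<longleftrightarrow>
    (\<forall>f g. pairing (blinfun_apply S f) g = pairing f (blinfun_apply R g))"

definition sharp :: "('k::scalar L1 \<Rightarrow>\<^sub>L 'k L1) set \<Rightarrow> ('k Linf \<Rightarrow>\<^sub>L 'k Linf) set"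
  where "sharp A = {R \<in> operators scale_Linf. \<exists>S\<in>A. is_adjoint S R}"

definition dagger :: "('k::scalar L1 \<Rightarrow>\<^sub>L 'k L1) set \<Rightarrow> ('k Linf \<Rightarrow>\<^sub>L 'k Linf) set"
  where "dagger A = {E o\<^sub>L R o\<^sub>L F | E R F.
    E \<in> operators scale_Linf \<and> F \<in> operators scale_Linf \<and> R \<in> sharp A}"

section \<open>Strictly singular operators and small ideals\<close>

definition scalar_ring :: "'k::scalar ring"
  where "scalar_ring =
    \<lparr>carrier = UNIV, monoid.mult = (*), one = 1, ring.zero = 0, add = (+)\<rparr>"

definition banach_space :: "('k::scalar, 'z) module \<Rightarrow> ('z \<Rightarrow> real) \<Rightarrow> bool"
  where "banach_space Z \<nu> \<longleftrightarrow>
    module scalar_ring Z \<and>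
    (\<forall>z\<in>carrier Z. \<nu> z = 0 \<longleftrightarrow> z = \<zero>\<^bsub>Z\<^esub>) \<and>
    (\<forall>z\<in>carrier Z. \<forall>c. \<nu> (c \<odot>\<^bsub>Z\<^esub> z) = norm c * \<nu> z) \<and>
    (\<forall>y\<in>carrier Z. \<forall>z\<in>carrier Z. \<nu> (y \<oplus>\<^bsub>Z\<^esub> z) \<le> \<nu> y + \<nu> z) \<and>
    (\<forall>\<sigma>. range \<sigma> \<subseteq> carrier Z \<and>
        (\<forall>e>0. \<exists>N. \<forall>m\<ge>N. \<forall>n\<ge>N. \<nu> (\<sigma> m \<ominus>\<^bsub>Z\<^esub> \<sigma> n) < e) \<longrightarrow>
      (\<exists>z\<in>carrier Z. (\<lambda>n. \<nu> (\<sigma> n \<ominus>\<^bsub>Z\<^esub> z)) \<longlonglongrightarrow> 0))"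

definition infinite_dimensional :: "('k::scalar, 'z) module \<Rightarrow> bool"
  where "infinite_dimensional Z \<longleftrightarrow>
    \<not> (\<exists>B. finite B \<and> B \<subseteq> carrier Z \<and>
      (\<forall>z\<in>carrier Z. \<exists>c. z = (\<Oplus>\<^bsub>Z\<^esub>b\<in>B. c b \<odot>\<^bsub>Z\<^esub> b)))"

definition bounded_operator ::
    "('k::scalar, 'z) module \<Rightarrow> ('z \<Rightarrow> real) \<Rightarrow> ('k \<Rightarrow> 'a \<Rightarrow> 'a) \<Rightarrow> ('z \<Rightarrow> 'a::real_normed_vector) \<Rightarrow> bool"
  where "bounded_operator Z \<nu> sc S \<longleftrightarrow>
    (\<forall>y\<in>carrier Z. \<forall>z\<in>carrier Z. S (y \<oplus>\<^bsub>Z\<^esub> z) = S y + S z) \<and>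
    (\<forall>c. \<forall>z\<in>carrier Z. S (c \<odot>\<^bsub>Z\<^esub> z) = sc c (S z)) \<and>
    (\<exists>K. \<forall>z\<in>carrier Z. norm (S z) \<le> K * \<nu> z)"

text \<open>Quantifying over all Banach spaces \<open>Z\<close> means quantifying over a structure whose carrier consists
  of elements of some type.  The type underlying \<open>X\<close> is taken here; this loses nothing, since \<open>S\<close> is
  injective whenever \<open>T S\<close> is an isomorphism onto its image, so that \<open>Z\<close> can be transported to a
  structure on a subset of \<open>X\<close>: see \<open>strictly_singularD\<close> below, where \<open>Z\<close> lives on an arbitrary type.\<close>

definition strictly_singular ::
    "('k::scalar \<Rightarrow> 'a \<Rightarrow> 'a) \<Rightarrow> ('a::real_normed_vector \<Rightarrow>\<^sub>L 'b::real_normed_vector) \<Rightarrow> bool"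
  where "strictly_singular sc T \<longleftrightarrow>
    \<not> (\<exists>(Z :: ('k, 'a) module) \<nu> S.
        banach_space Z \<nu> \<and> infinite_dimensional Z \<and> bounded_operator Z \<nu> sc S \<and>
        (\<exists>K. \<forall>z\<in>carrier Z. \<nu> z \<le> K * norm (blinfun_apply T (S z))))"

definition small_ideal :: "('k::scalar L1 \<Rightarrow>\<^sub>L 'k L1) set \<Rightarrow> bool"
  where "small_ideal I \<longleftrightarrow>
    ideal I (operator_ring scale_L1) \<and>
    I \<subseteq> {T \<in> operators scale_L1. strictly_singular scale_L1 T}"

lemma ring_operator_ring:
  assumes add: "\<And>c x y. sc c (x + y) = sc c x + sc c y"
  shows "ring (operator_ring sc)"
proof -
  interpret additive "sc c" for c by standard (rule add)
  have *: "carrier (operator_ring sc) = operators sc" "a \<otimes>\<^bsub>operator_ring sc\<^esub> b = a o\<^sub>L b"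
    "a \<oplus>\<^bsub>operator_ring sc\<^esub> b = a + b" "\<zero>\<^bsub>operator_ring sc\<^esub> = 0" "\<one>\<^bsub>operator_ring sc\<^esub> = id_blinfun"
    for a b by (simp_all add: operator_ring_def)
  show ?thesis
  proof (intro ringI abelian_groupI monoidI, unfold *)
    fix a assume "a \<in> operators sc"
    then show "\<exists>b\<in>operators sc. b + a = 0"
      by (intro bexI[of _ "- a"]) (auto simp: operators_def minus blinfun.minus_left)
  qed (auto simp: operators_def add zero blinfun.add_left blinfun.add_right blinfun.zero_left intro!: blinfun_eqI)
qed

lemma ring_operator_ring_L1: "ring (operator_ring scale_L1)"
  by (intro ring_operator_ring bounded_linear_scale_L1[THEN bounded_linear.linear, THEN linear_add])

lemma ring_operator_ring_Linf: "ring (operator_ring scale_Linf)"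
  by (intro ring_operator_ring bounded_linear_scale_Linf[THEN bounded_linear.linear, THEN linear_add])

lemma strictly_singularD:
  fixes Z :: "('k::scalar, 'z) module" and T :: "'a::real_normed_vector \<Rightarrow>\<^sub>L 'b::real_normed_vector"
  assumes T: "strictly_singular sc T" and Z: "banach_space Z \<nu>" and inf: "infinite_dimensional Z"
    and S: "bounded_operator Z \<nu> sc S"
  shows "\<not> (\<exists>K. \<forall>z\<in>carrier Z. \<nu> z \<le> K * norm (blinfun_apply T (S z)))"
proof
  assume "\<exists>K. \<forall>z\<in>carrier Z. \<nu> z \<le> K * norm (blinfun_apply T (S z))"
  then obtain K where K: "\<And>z. z \<in> carrier Z \<Longrightarrow> \<nu> z \<le> K * norm (blinfun_apply T (S z))" by blast
  interpret Z: module scalar_ring Z using Z by (simp add: banach_space_def)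
  have R [simp]: "carrier scalar_ring = UNIV" "a \<oplus>\<^bsub>scalar_ring\<^esub> b = a + b"
    "a \<otimes>\<^bsub>scalar_ring\<^esub> b = a * b" "\<one>\<^bsub>scalar_ring\<^esub> = 1" "\<zero>\<^bsub>scalar_ring\<^esub> = 0" for a b :: 'k
    by (simp_all add: scalar_ring_def)
  have nu0: "\<nu> z = 0 \<longleftrightarrow> z = \<zero>\<^bsub>Z\<^esub>" if "z \<in> carrier Z" for z
    using Z that by (simp add: banach_space_def)
  have nu_smult: "\<nu> (c \<odot>\<^bsub>Z\<^esub> z) = norm c * \<nu> z" if "z \<in> carrier Z" for z c
    using Z that by (simp add: banach_space_def)
  have nu_add: "\<nu> (y \<oplus>\<^bsub>Z\<^esub> z) \<le> \<nu> y + \<nu> z" if "y \<in> carrier Z" "z \<in> carrier Z" for y z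
    using Z that by (simp add: banach_space_def)
  have S_add: "S (y \<oplus>\<^bsub>Z\<^esub> z) = S y + S z" if "y \<in> carrier Z" "z \<in> carrier Z" for y z
    using S that by (simp add: bounded_operator_def)
  have S_smult: "S (c \<odot>\<^bsub>Z\<^esub> z) = sc c (S z)" if "z \<in> carrier Z" for z c
    using S that by (simp add: bounded_operator_def)
  have smult_closed: "c \<odot>\<^bsub>Z\<^esub> z \<in> carrier Z" if "z \<in> carrier Z" for c z
    using that by simp
  have S_zero: "S \<zero>\<^bsub>Z\<^esub> = 0"
    using S_add[of "\<zero>\<^bsub>Z\<^esub>" "\<zero>\<^bsub>Z\<^esub>"] by simp
  have S_minus: "S (\<ominus>\<^bsub>Z\<^esub> z) = - S z" if "z \<in> carrier Z" for z
    using S_add[of "\<ominus>\<^bsub>Z\<^esub> z" z] that by (simp add: Z.M.l_neg S_zero eq_neg_iff_add_eq_0)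
  have S_diff: "S (y \<ominus>\<^bsub>Z\<^esub> z) = S y - S z" if "y \<in> carrier Z" "z \<in> carrier Z" for y z
    using that by (simp add: a_minus_def S_add S_minus)
  have nu_nonneg: "0 \<le> \<nu> z" if "z \<in> carrier Z" for z
  proof -
    have "\<nu> (z \<oplus>\<^bsub>Z\<^esub> ((-1) \<odot>\<^bsub>Z\<^esub> z)) \<le> \<nu> z + \<nu> z"
      using nu_add[of z "(-1) \<odot>\<^bsub>Z\<^esub> z"] nu_smult[of z "-1"] that by simp
    moreover have "z \<oplus>\<^bsub>Z\<^esub> ((-1) \<odot>\<^bsub>Z\<^esub> z) = \<zero>\<^bsub>Z\<^esub>"
      using Z.smult_l_distr[of 1 "-1" z] Z.smult_one[of z] Z.smult_l_null[of z] that by simp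
    ultimately show ?thesis using nu0[of "\<zero>\<^bsub>Z\<^esub>"] by simp
  qed
  have inj: "inj_on S (carrier Z)"
  proof (rule inj_onI)
    fix y z assume yz: "y \<in> carrier Z" "z \<in> carrier Z" "S y = S z"
    then have "\<nu> (y \<ominus>\<^bsub>Z\<^esub> z) \<le> 0"
      using K[of "y \<ominus>\<^bsub>Z\<^esub> z"] by (simp add: S_diff)
    then have "y \<ominus>\<^bsub>Z\<^esub> z = \<zero>\<^bsub>Z\<^esub>"
      using nu0[of "y \<ominus>\<^bsub>Z\<^esub> z"] nu_nonneg[of "y \<ominus>\<^bsub>Z\<^esub> z"] yz by simp
    moreover have "y = (y \<ominus>\<^bsub>Z\<^esub> z) \<oplus>\<^bsub>Z\<^esub> z"
      using yz by (simp add: a_minus_def Z.M.a_assoc Z.M.l_neg)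
    ultimately show "y = z" using yz by simp
  qed
  define G where "G = the_inv_into (carrier Z) S"
  have G: "G (S z) = z" if "z \<in> carrier Z" for z
    unfolding G_def using inj that by (rule the_inv_into_f_f)
  define W :: "('k, 'a) module" where
    "W = \<lparr>carrier = S ` carrier Z, monoid.mult = (\<lambda>x y. 0), one = 0, ring.zero = 0, add = (+), smult = sc\<rparr>"
  have W [simp]: "carrier W = S ` carrier Z" "\<zero>\<^bsub>W\<^esub> = 0" "x \<oplus>\<^bsub>W\<^esub> y = x + y" "c \<odot>\<^bsub>W\<^esub> x = sc c x" for x y c
    by (simp_all add: W_def)
  have modW: "module scalar_ring W"
  proof (rule moduleI)
    show "cring (scalar_ring :: 'k ring)" by (rule Z.R.is_cring)
    show "abelian_group W"
    proof (rule abelian_groupI)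
      fix x assume "x \<in> carrier W"
      then obtain z where z: "z \<in> carrier Z" "x = S z" by auto
      then show "\<exists>y\<in>carrier W. y \<oplus>\<^bsub>W\<^esub> x = \<zero>\<^bsub>W\<^esub>"
        by (intro bexI[of _ "S (\<ominus>\<^bsub>Z\<^esub> z)"]) (simp add: S_minus, simp)
    next
      show "\<zero>\<^bsub>W\<^esub> \<in> carrier W" using S_zero by (auto intro!: image_eqI[of _ _ "\<zero>\<^bsub>Z\<^esub>"])
    qed (auto simp: S_add[symmetric])
  qed (auto simp: S_add[symmetric] S_smult[symmetric] Z.smult_l_distr[simplified]
        Z.smult_r_distr[simplified] Z.smult_assoc1[simplified] Z.smult_one[simplified])
  interpret W: module scalar_ring W by (rule modW)
  have W_minus: "\<ominus>\<^bsub>W\<^esub> S z = S (\<ominus>\<^bsub>Z\<^esub> z)" if "z \<in> carrier Z" for z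
    using that by (intro W.M.minus_equality) (simp add: S_minus, simp, simp)
  have W_diff: "S y \<ominus>\<^bsub>W\<^esub> S z = S (y \<ominus>\<^bsub>Z\<^esub> z)" if "y \<in> carrier Z" "z \<in> carrier Z" for y z
    using that by (simp add: a_minus_def W_minus S_add)
  have "banach_space W (\<nu> \<circ> G)"
    unfolding banach_space_def
  proof (intro conjI modW ballI allI impI)
    fix x assume "x \<in> carrier W"
    then obtain z where z: "z \<in> carrier Z" "x = S z" by auto
    show "(\<nu> \<circ> G) x = 0 \<longleftrightarrow> x = \<zero>\<^bsub>W\<^esub>"
      using z inj S_zero by (auto simp: G nu0 inj_on_eq_iff[OF inj, of z "\<zero>\<^bsub>Z\<^esub>", symmetric])
    show "(\<nu> \<circ> G) (c \<odot>\<^bsub>W\<^esub> x) = norm c * (\<nu> \<circ> G) x" for c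
      using z by (simp add: S_smult[symmetric] G nu_smult smult_closed)
    fix y assume "y \<in> carrier W"
    then obtain z' where z': "z' \<in> carrier Z" "y = S z'" by auto
    show "(\<nu> \<circ> G) (x \<oplus>\<^bsub>W\<^esub> y) \<le> (\<nu> \<circ> G) x + (\<nu> \<circ> G) y"
      using z z' by (simp add: S_add[symmetric] G nu_add)
  next
    fix \<sigma> :: "nat \<Rightarrow> 'a" assume \<sigma>: "range \<sigma> \<subseteq> carrier W \<and>
      (\<forall>e>0. \<exists>N. \<forall>m\<ge>N. \<forall>n\<ge>N. (\<nu> \<circ> G) (\<sigma> m \<ominus>\<^bsub>W\<^esub> \<sigma> n) < e)"
    then have "\<sigma> n \<in> S ` carrier Z" for n by auto
    then have "\<forall>n. \<exists>z\<in>carrier Z. \<sigma> n = S z" by blast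
    then obtain \<tau> where \<tau>: "\<And>n. \<tau> n \<in> carrier Z" "\<And>n. \<sigma> n = S (\<tau> n)" by metis
    have "\<forall>e>0. \<exists>N. \<forall>m\<ge>N. \<forall>n\<ge>N. \<nu> (\<tau> m \<ominus>\<^bsub>Z\<^esub> \<tau> n) < e"
      using \<sigma> by (simp add: \<tau> W_diff G)
    moreover have "range \<tau> \<subseteq> carrier Z" using \<tau>(1) by auto
    ultimately obtain z where z: "z \<in> carrier Z" "(\<lambda>n. \<nu> (\<tau> n \<ominus>\<^bsub>Z\<^esub> z)) \<longlonglongrightarrow> 0"
      using Z unfolding banach_space_def by blast
    then show "\<exists>x\<in>carrier W. (\<lambda>n. (\<nu> \<circ> G) (\<sigma> n \<ominus>\<^bsub>W\<^esub> x)) \<longlonglongrightarrow> 0"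
      by (intro bexI[of _ "S z"]) (auto simp: \<tau> W_diff G)
  qed
  moreover have "infinite_dimensional W"
    unfolding infinite_dimensional_def
  proof (rule notI, elim exE conjE)
    fix B assume B: "finite B" "B \<subseteq> carrier W"
      "\<forall>x\<in>carrier W. \<exists>c. x = (\<Oplus>\<^bsub>W\<^esub>b\<in>B. c b \<odot>\<^bsub>W\<^esub> b)"
    then obtain C where C: "C \<subseteq> carrier Z" "finite C" "B = S ` C"
      by (auto dest: finite_subset_image)
    have sum: "S (\<Oplus>\<^bsub>Z\<^esub>b\<in>D. d b \<odot>\<^bsub>Z\<^esub> b) = (\<Oplus>\<^bsub>W\<^esub>b\<in>S ` D. d (G b) \<odot>\<^bsub>W\<^esub> b)"
      if "finite D" "D \<subseteq> carrier Z" for D d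
      using that
    proof (induction D rule: finite_induct)
      case empty
      then show ?case by (simp add: S_zero)
    next
      case (insert z D)
      have "S z \<notin> S ` D" using insert inj by (auto simp: inj_on_def)
      moreover have "(\<lambda>b. d (G b) \<odot>\<^bsub>W\<^esub> b) \<in> S ` insert z D \<rightarrow> carrier W"
        using insert.prems by (auto simp: G S_smult[symmetric] smult_closed)
      moreover have "(\<lambda>b. d b \<odot>\<^bsub>Z\<^esub> b) \<in> insert z D \<rightarrow> carrier Z"
        using insert.prems by (auto simp: smult_closed)
      ultimately show ?case
        using insert by (auto simp: Z.M.finsum_insert W.M.finsum_insert S_add S_smult smult_closed G
            simp del: W(4) simp: W(4)[of "d z"] Z.M.finsum_closed)
    qed
    have "\<forall>z\<in>carrier Z. \<exists>d. z = (\<Oplus>\<^bsub>Z\<^esub>b\<in>C. d b \<odot>\<^bsub>Z\<^esub> b)"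
    proof
      fix z assume z: "z \<in> carrier Z"
      with B(3) obtain c where c: "S z = (\<Oplus>\<^bsub>W\<^esub>b\<in>S ` C. c b \<odot>\<^bsub>W\<^esub> b)" by (auto simp: C)
      also have "\<dots> = (\<Oplus>\<^bsub>W\<^esub>b\<in>S ` C. (c \<circ> S) (G b) \<odot>\<^bsub>W\<^esub> b)"
        using C(1) by (intro W.M.finsum_cong') (auto simp: G subset_iff S_smult[symmetric] smult_closed)
      also have "\<dots> = S (\<Oplus>\<^bsub>Z\<^esub>b\<in>C. (c \<circ> S) b \<odot>\<^bsub>Z\<^esub> b)"
        using C by (intro sum[symmetric])
      finally have "z = (\<Oplus>\<^bsub>Z\<^esub>b\<in>C. (c \<circ> S) b \<odot>\<^bsub>Z\<^esub> b)"
        using z C(1) by (intro inj_onD[OF inj]) (auto intro!: Z.M.finsum_closed smult_closed)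
      then show "\<exists>d. z = (\<Oplus>\<^bsub>Z\<^esub>b\<in>C. d b \<odot>\<^bsub>Z\<^esub> b)" by blast
    qed
    with inf C show False unfolding infinite_dimensional_def by blast
  qed
  moreover have "bounded_operator W (\<nu> \<circ> G) sc (\<lambda>x. x)"
    using S by (auto simp: bounded_operator_def G)
  moreover have "\<forall>x\<in>carrier W. (\<nu> \<circ> G) x \<le> K * norm (blinfun_apply T x)"
    using K by (auto simp: G)
  ultimately show False
    using T unfolding strictly_singular_def by blast
qed

end

theory Submission
  imports Defs
begin

text \<open>Write \<open>Q\<close> for the adjoint of an operator \<open>S \<in> I\<^sub>1\<close>.  If the closures of \<open>dagger I\<^sub>1\<close> and
  \<open>dagger I\<^sub>2\<close> agree, then \<open>Q\<close> is as close as desired to an operator \<open>E R F\<close> on \<open>L\<^sub>\<infinity>\<close>, where \<open>R\<close> is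
  the adjoint of some \<open>T \<in> I\<^sub>2\<close>.  The operators \<open>E\<close> and \<open>F\<close> need not be adjoints; nevertheless \<open>S\<close> is
  close to \<open>C T B\<close> for suitable operators \<open>B\<close> and \<open>C\<close> on \<open>L\<^sub>1\<close> (\<open>predual_factorization\<close>), and \<open>C T B\<close>
  lies in \<open>I\<^sub>2\<close>.  Hence \<open>I\<^sub>1 \<subseteq> closure I\<^sub>2\<close>, and the theorem follows by symmetry.

  Taking adjoints once more, \<open>S\<close> is close to \<open>F\<^sup>* T\<^sup>*\<^sup>* E\<^sup>*\<close> restricted to \<open>L\<^sub>1\<close>, an operator with values
  in the bidual of \<open>L\<^sub>1\<close>.  Two properties of \<open>L\<^sub>1\<close> bring it back to \<open>L\<^sub>1\<close>.

  The first one produces \<open>C\<close>: there is a contractive projection of the bidual onto \<open>L\<^sub>1\<close>.  A bounded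
  functional on \<open>L\<^sub>\<infinity>\<close> is a finitely additive measure, and off sets of arbitrarily small measure it is
  given by a density in \<open>L\<^sub>1\<close> (\<open>ac_part_exists\<close>, the Yosida--Hewitt decomposition).  The density is unique,
  depends linearly on the functional and has at most its norm, and a functional that comes from \<open>L\<^sub>1\<close> is
  its own density.  Then \<open>C y\<close> is the density of \<open>g \<mapsto> pairing y (F g)\<close>.

  The second one produces \<open>B\<close>: operators in a small ideal are weakly compact.  If the image of the unit
  ball under \<open>T\<close> were not equi-integrable, infinitely many images would carry almost disjoint bumps of
  nearly extremal mass, would therefore be equivalent to the unit vectors of \<open>l\<^sub>1\<close>, and \<open>T\<close> would not be
  strictly singular (\<open>strictly_singular_equi_integrable\<close>).  For an equi-integrable image, every
  element of the bidual is mapped by \<open>T\<^sup>*\<^sup>*\<close> into \<open>L\<^sub>1\<close> and close to some \<open>T x\<close> (\<open>bidual_element_approx\<close>).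
  Moreover \<open>S\<close>, for which the image of the unit ball is equi-integrable too, has almost constant averages
  on each piece of a countable partition \<open>D\<close> of the interval (\<open>oscillation_partition\<close>; this is the
  Dunford--Pettis representation of weakly compact operators on \<open>L\<^sub>1\<close>).  So \<open>B\<close> need only send the normalised indicator of \<open>D n\<close> to one
  element \<open>x n\<close>, chosen so that \<open>T (x n)\<close> approximates what \<open>T\<^sup>*\<^sup>* E\<^sup>*\<close> makes of this indicator.

  Both approximation results rest on the smooth, strictly convex function \<open>energy f = \<integral> sqrt (1 + |f|\<^sup>2)\<close>
  on \<open>L\<^sub>1\<close>, whose derivatives lie in the unit ball of \<open>L\<^sub>\<infinity>\<close>.  On equi-integrable sets its convexity and
  smoothness are uniform, and nearly extremal points of the energy replace the Hahn--Banach theorem.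

  The real and the complex case are treated at once: the scalar field is any field of sort
  \<open>{scalar, euclidean_space}\<close>, and \<open>re x = 1 \<bullet> x\<close> plays the role of the real part.\<close>

section \<open>Exhaustion by disjoint sets\<close>

text \<open>Greedy choice: each step splits off a set with \<open>P\<close> that has at least half of the largest measure
  still available.  The measures of the chosen sets are summable, so what is available tends to \<open>0\<close>.\<close>

lemma (in finite_measure) exhaustion:
  fixes P :: "'a set \<Rightarrow> bool"
  shows "\<exists>D :: nat \<Rightarrow> 'a set. (\<forall>n. D n \<in> sets M \<and> (D n = {} \<or> P (D n))) \<and> disjoint_family D \<and>
    (\<forall>E\<in>sets M. P E \<longrightarrow> E \<inter> (\<Union>n. D n) = {} \<longrightarrow> measure M E = 0)"
proof -
  define Q where "Q U E \<longleftrightarrow> E \<in> sets M \<and> E \<inter> U = {} \<and> (E = {} \<or> P E)" for U E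
  define s where "s U = Sup (measure M ` Collect (Q U))" for U
  have bdd: "bdd_above (measure M ` Collect (Q U))" for U
    by (auto intro!: bdd_aboveI[of _ "measure M (space M)"] bounded_measure)
  have s_upper: "measure M E \<le> s U" if "Q U E" for U E
    unfolding s_def using that by (intro cSup_upper bdd) auto
  have Q_empty: "Q U {}" for U by (simp add: Q_def)
  have "\<exists>E. Q U E \<and> s U \<le> 2 * measure M E" for U
  proof (cases "s U > 0")
    case True
    then have "s U / 2 < s U" by simp
    then have "\<exists>y\<in>measure M ` Collect (Q U). s U / 2 < y"
      unfolding s_def using Q_empty[of U] by (subst less_cSup_iff[OF _ bdd, symmetric]) auto
    then obtain E where "Q U E" "s U / 2 < measure M E" by auto
    then show ?thesis by (intro exI[of _ E]) auto
  next
    case False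
    then show ?thesis using Q_empty[of U] by (intro exI[of _ "{}"]) auto
  qed
  then obtain pick where pick: "\<And>U. Q U (pick U)" "\<And>U. s U \<le> 2 * measure M (pick U)" by metis
  define U where "U = rec_nat {} (\<lambda>n V. V \<union> pick V)"
  define D where "D n = pick (U n)" for n
  have U_Suc: "U (Suc n) = U n \<union> D n" for n by (simp add: U_def D_def)
  have sub: "D n \<subseteq> U m" if "n < m" for n m
    using that
  proof (induction m)
    case (Suc m)
    then show ?case using U_Suc[of m] by (cases "n = m") auto
  qed simp
  have U_eq: "U m \<subseteq> (\<Union>n. D n)" for m
    by (induction m) (auto simp: U_Suc, simp add: U_def)
  have meas: "D n \<in> sets M" for n using pick(1)[of "U n"] by (simp add: D_def Q_def)
  have "disjoint_family D"
    unfolding disjoint_family_on_def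
  proof (intro ballI impI)
    have *: "D m \<inter> D n = {}" if "n < m" for m n
      using pick(1)[of "U m"] sub[OF that] by (auto simp: D_def Q_def)
    fix m n :: nat assume "m \<noteq> n"
    then show "D m \<inter> D n = {}" using *[of m n] *[of n m] by (cases "m < n") (auto simp: Int_commute)
  qed
  moreover have "measure M E = 0" if E: "E \<in> sets M" "P E" "E \<inter> (\<Union>n. D n) = {}" for E
  proof -
    have "(\<lambda>n. measure M (D n)) sums measure M (\<Union>n. D n)"
      using \<open>disjoint_family D\<close> meas by (intro finite_measure_UNION) auto
    then have "(\<lambda>n. 2 * measure M (D n)) \<longlonglongrightarrow> 2 * 0"
      by (intro tendsto_mult_left summable_LIMSEQ_zero) (rule sums_summable)
    moreover have "measure M E \<le> 2 * measure M (D n)" for n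
    proof -
      have "Q (U n) E" using E U_eq[of n] by (auto simp: Q_def)
      then show ?thesis using s_upper[of "U n" E] pick(2)[of "U n"] by (simp add: D_def)
    qed
    ultimately have "measure M E \<le> 0"
      by (intro LIMSEQ_le_const[where X = "\<lambda>n. 2 * measure M (D n)"]) auto
    then show ?thesis by (simp add: measure_le_0_iff)
  qed
  moreover have "D n = {} \<or> P (D n)" for n
    using pick(1)[of "U n"] by (simp add: D_def Q_def)
  ultimately show ?thesis using meas by blast
qed

section \<open>Restriction, pairing and indicators\<close>

interpretation leb01: prob_space leb01
  by (rule prob_spaceI) (simp add: emeasure_leb01)

abbreviation mu :: "real set \<Rightarrow> real" where "mu \<equiv> measure leb01"

lemma abs_L1_cases:
  obtains f where "integrable leb01 f" "F = abs_L1 f"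
  using L1.abs_induct[of "\<lambda>F. \<exists>f. integrable leb01 f \<and> F = abs_L1 f" F] by auto

lemma abs_Linf_cases:
  obtains f where "ess_bounded f" "F = abs_Linf f"
  using Linf.abs_induct[of "\<lambda>F. \<exists>f. ess_bounded f \<and> F = abs_Linf f" F] by auto

lemma integrable_mult_ess_bounded:
  assumes f: "integrable leb01 f" and g: "ess_bounded g"
  shows "integrable leb01 (\<lambda>x. f x * g x)"
proof (rule Bochner_Integration.integrable_bound)
  show "integrable leb01 (\<lambda>x. real_of_ereal (ess_norm g) * norm (f x))" using f by simp
  show "(\<lambda>x. f x * g x) \<in> borel_measurable leb01"
    using f ess_bounded_measurable[OF g] by (intro borel_measurable_times) auto
  show "AE x in leb01. norm (f x * g x) \<le> norm (real_of_ereal (ess_norm g) * norm (f x))"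
    using ess_norm_AE[OF g]
  proof eventually_elim
    case (elim x)
    then have "norm (f x) * norm (g x) \<le> norm (f x) * real_of_ereal (ess_norm g)"
      by (intro mult_left_mono) auto
    also have "\<dots> \<le> \<bar>real_of_ereal (ess_norm g) * norm (f x)\<bar>" by (simp add: mult.commute)
    finally show ?case by (simp add: norm_mult)
  qed
qed

lemma integrable_ess_bounded: "ess_bounded g \<Longrightarrow> integrable leb01 g"
  using integrable_mult_ess_bounded[of "\<lambda>_. 1" g] by simp

text \<open>Restriction of a function to \<open>A\<close>.  The value \<open>0\<close> for non-measurable \<open>A\<close> keeps restriction a total
  contraction on \<open>L\<^sub>1\<close> and \<open>L\<^sub>\<infinity>\<close>.\<close>
definition cutf :: "real set \<Rightarrow> (real \<Rightarrow> 'k::scalar) \<Rightarrow> real \<Rightarrow> 'k"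
  where "cutf A f x = (if A \<in> sets leb01 then indicator A x *\<^sub>R f x else 0)"

lemma cutf_eq: "A \<in> sets leb01 \<Longrightarrow> cutf A f = (\<lambda>x. indicator A x *\<^sub>R f x)"
  by (simp add: cutf_def fun_eq_iff)

lemma cutf_not: "A \<notin> sets leb01 \<Longrightarrow> cutf A f = (\<lambda>x. 0)"
  by (simp add: cutf_def fun_eq_iff)

lemma cutf_linear:
  "cutf A (\<lambda>x. f x + g x) = (\<lambda>x. cutf A f x + cutf A g x)"
  "cutf A (\<lambda>x. c * f x) = (\<lambda>x. c * cutf A f x)"
  "cutf A (\<lambda>x. r *\<^sub>R f x) = (\<lambda>x. r *\<^sub>R cutf A f x)"
  by (auto simp: cutf_def fun_eq_iff scaleR_add_right)

lemma norm_cutf_le: "norm (cutf A f x) \<le> norm (f x)"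
  by (auto simp: cutf_def indicator_def)

lemma integrable_cutf:
  fixes f :: "real \<Rightarrow> 'k::scalar"
  shows "integrable leb01 f \<Longrightarrow> integrable leb01 (cutf A f)"
  by (cases "A \<in> sets leb01") (auto simp: cutf_eq cutf_not intro: integrable_mult_indicator)

lemma ess_bounded_cutf:
  assumes g: "ess_bounded g"
  shows "ess_bounded (cutf A g)"
proof (rule ess_norm_le(1))
  show "cutf A g \<in> borel_measurable leb01"
    using ess_bounded_measurable[OF g]
    by (cases "A \<in> sets leb01") (auto simp: cutf_eq cutf_not intro!: borel_measurable_scaleR)
  show "AE x in leb01. norm (cutf A g x) \<le> real_of_ereal (ess_norm g)"
    using ess_norm_AE[OF g] by eventually_elim (meson norm_cutf_le order_trans)
qed

lemma cutf_AE: "(AE x in leb01. f x = g x) \<Longrightarrow> AE x in leb01. cutf A f x = cutf A g x"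
  by (auto elim!: eventually_mono simp: cutf_def)

lift_definition cut_L1 :: "real set \<Rightarrow> 'k::scalar L1 \<Rightarrow> 'k L1" is cutf
  using integrable_cutf cutf_AE by blast

lift_definition cut_Linf :: "real set \<Rightarrow> 'k::scalar Linf \<Rightarrow> 'k Linf" is cutf
  using ess_bounded_cutf cutf_AE by blast

lift_definition one_Linf :: "'k::scalar Linf" is "\<lambda>x. 1"
  using ess_norm_le(1)[of "\<lambda>x. 1::'k" 1] by auto

lift_definition embed :: "'k::scalar Linf \<Rightarrow> 'k L1" is "\<lambda>g x. g x"
  by (auto intro: integrable_ess_bounded)

definition chi_Linf :: "real set \<Rightarrow> 'k::scalar Linf" where "chi_Linf A = cut_Linf A one_Linf"
definition chi_L1 :: "real set \<Rightarrow> 'k::scalar L1" where "chi_L1 A = embed (chi_Linf A)"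

lemma sets_leb01_top [simp, intro]: "{0<..<1} \<in> sets leb01"
  using sets.top[of leb01] by simp

lemma cutf_space: "x \<in> space leb01 \<Longrightarrow> cutf {0<..<1} f x = f x"
  by (simp add: cutf_def)

lemma cutf_cutf: "A \<in> sets leb01 \<Longrightarrow> B \<in> sets leb01 \<Longrightarrow> cutf A (cutf B f) = cutf (A \<inter> B) f"
  by (auto simp: cutf_def indicator_def fun_eq_iff)

lemma cutf_Un: "A \<in> sets leb01 \<Longrightarrow> B \<in> sets leb01 \<Longrightarrow> A \<inter> B = {} \<Longrightarrow> cutf (A \<union> B) f = (\<lambda>x. cutf A f x + cutf B f x)"
  by (auto simp: cutf_def indicator_def fun_eq_iff)

lemma cutf_null:
  assumes "A \<in> sets leb01" "mu A = 0"
  shows "AE x in leb01. cutf A f x = 0"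
proof -
  from assms have "AE x in leb01. x \<notin> A"
    by (intro AE_not_in) (auto simp: null_sets_def leb01.emeasure_eq_measure)
  then show ?thesis by eventually_elim (simp add: cutf_def)
qed

lemma cut_add: "cut_L1 A (f + g) = cut_L1 A f + cut_L1 A g"
  by transfer (simp add: cutf_linear integrable_cutf)

lemma cut_scale: "cut_L1 A (scale_L1 c f) = scale_L1 c (cut_L1 A f)"
  by transfer (simp add: cutf_linear integrable_cutf)

lemma cut_scaleR: "cut_L1 A (r *\<^sub>R f) = r *\<^sub>R cut_L1 A f"
  by transfer (simp add: cutf_linear integrable_cutf)

lemma norm_cutf_mono:
  "A \<in> sets leb01 \<Longrightarrow> B \<in> sets leb01 \<Longrightarrow> A \<subseteq> B \<Longrightarrow> norm (cutf A f x) \<le> norm (cutf B f x)"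
  by (auto simp: cutf_def indicator_def)

lemma norm_cut_mono:
  "A \<in> sets leb01 \<Longrightarrow> B \<in> sets leb01 \<Longrightarrow> A \<subseteq> B \<Longrightarrow> norm (cut_L1 A f) \<le> norm (cut_L1 B f)"
  by transfer (intro integral_mono integrable_norm integrable_cutf norm_cutf_mono; simp)

lemma cut_space [simp]: "cut_L1 {0<..<1} f = f"
  by transfer (auto intro: integrable_cutf AE_I2 cutf_space)

lemma norm_cut_le: "norm (cut_L1 A f) \<le> norm f"
  by transfer (intro integral_mono integrable_norm integrable_cutf norm_cutf_le; simp)

lemma bounded_linear_cut: "bounded_linear (cut_L1 A)"
  by (rule bounded_linear_intro[where K = 1]) (simp_all add: cut_add cut_scaleR norm_cut_le)

lemma cut_cut: "A \<in> sets leb01 \<Longrightarrow> B \<in> sets leb01 \<Longrightarrow> cut_L1 A (cut_L1 B f) = cut_L1 (A \<inter> B) f"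
  by transfer (simp add: cutf_cutf integrable_cutf)

lemma cut_empty [simp]: "cut_L1 {} f = 0"
  by transfer (simp add: cutf_def integrable_cutf)

lemma cut_Un:
  "A \<in> sets leb01 \<Longrightarrow> B \<in> sets leb01 \<Longrightarrow> A \<inter> B = {} \<Longrightarrow> cut_L1 (A \<union> B) f = cut_L1 A f + cut_L1 B f"
  by transfer (simp add: cutf_Un integrable_cutf)

lemma cut_null: "A \<in> sets leb01 \<Longrightarrow> mu A = 0 \<Longrightarrow> cut_L1 A f = 0"
  by transfer (simp add: cutf_null integrable_cutf)

lemma norm_cut_add:
  assumes "A \<in> sets leb01" "B \<in> sets leb01" "A \<inter> B = {}"
  shows "norm (cut_L1 A f + cut_L1 B g) = norm (cut_L1 A f) + norm (cut_L1 B g)"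
  using assms
proof transfer
  fix A B :: "real set" and f g :: "real \<Rightarrow> 'a"
  assume *: "A \<in> sets leb01" "B \<in> sets leb01" "A \<inter> B = {}"
    "integrable leb01 f \<and> integrable leb01 f \<and> (AE x in leb01. f x = f x)"
    "integrable leb01 g \<and> integrable leb01 g \<and> (AE x in leb01. g x = g x)"
  have "(\<integral>x. norm (cutf A f x + cutf B g x) \<partial>leb01) = (\<integral>x. norm (cutf A f x) + norm (cutf B g x) \<partial>leb01)"
    using *(3) by (intro Bochner_Integration.integral_cong) (auto simp: cutf_def indicator_def)
  then show "(\<integral>x. norm (cutf A f x + cutf B g x) \<partial>leb01) = (\<integral>x. norm (cutf A f x) \<partial>leb01) + (\<integral>x. norm (cutf B g x) \<partial>leb01)"
    using * by (simp add: integrable_cutf)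
qed

lemma norm_cut_Un:
  "A \<in> sets leb01 \<Longrightarrow> B \<in> sets leb01 \<Longrightarrow> A \<inter> B = {} \<Longrightarrow> norm (cut_L1 (A \<union> B) f) = norm (cut_L1 A f) + norm (cut_L1 B f)"
  by (simp add: cut_Un norm_cut_add)

text \<open>Absolute continuity of the integral: the part of \<open>|f|\<close> above a high level \<open>n\<close> has small integral, and
  the rest contributes at most \<open>n\<close> times the measure of \<open>A\<close>.\<close>
lemma cut_small:
  fixes f :: "'k::scalar L1"
  assumes "e > 0"
  shows "\<exists>d>0. \<forall>A\<in>sets leb01. mu A < d \<longrightarrow> norm (cut_L1 A f) < e"
  using assms
proof (transfer fixing: e)
  fix f :: "real \<Rightarrow> 'k"
  assume "integrable leb01 f \<and> integrable leb01 f \<and> (AE x in leb01. f x = f x)"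
  then have f: "integrable leb01 f" by simp
  then have [measurable]: "f \<in> borel_measurable leb01" by simp
  let ?T = "\<lambda>n x. indicator {x. real n < norm (f x)} x *\<^sub>R norm (f x)"
  have "(\<lambda>n. \<integral>x. ?T n x \<partial>leb01) \<longlonglongrightarrow> (\<integral>x. 0 \<partial>leb01)"
  proof (rule integral_dominated_convergence[where w = "\<lambda>x. norm (f x)"])
    show "AE x in leb01. (\<lambda>n. ?T n x) \<longlonglongrightarrow> 0"
    proof (rule AE_I2)
      fix x
      obtain N where "norm (f x) < real N" using reals_Archimedean2 by blast
      then have "\<forall>n\<ge>N. ?T n x = 0" by (auto simp: indicator_def)
      then show "(\<lambda>n. ?T n x) \<longlonglongrightarrow> 0"
        by (intro tendsto_eventually) (auto simp: eventually_sequentially)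
    qed
    show "?T n \<in> borel_measurable leb01" for n by measurable
  qed (use f in \<open>auto simp: indicator_def\<close>)
  then have "eventually (\<lambda>n. (\<integral>x. ?T n x \<partial>leb01) < e / 2) sequentially"
    using assms by (intro order_tendstoD) auto
  then obtain n where n: "(\<integral>x. ?T n x \<partial>leb01) < e / 2" by (auto simp: eventually_sequentially)
  have T: "integrable leb01 (?T n)"
    by (rule Bochner_Integration.integrable_bound[OF integrable_norm[OF f]]) (auto simp: indicator_def)
  show "\<exists>d>0. \<forall>A\<in>sets leb01. mu A < d \<longrightarrow>
      (\<integral>x. norm (cutf A f x) \<partial>leb01) < e"
  proof (intro exI[of _ "e / (2 * (real n + 1))"] conjI ballI impI)
    fix A assume A: "A \<in> sets leb01" "mu A < e / (2 * (real n + 1))"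
    have [simp]: "A \<inter> {0<..<1} = A" using sets.sets_into_space[OF A(1)] by auto
    have int: "integrable leb01 (\<lambda>x. real n * indicator A x)"
      using A by (intro integrable_mult_right) (auto simp: integrable_indicator_iff leb01.emeasure_eq_measure)
    have "(\<integral>x. norm (cutf A f x) \<partial>leb01) \<le> (\<integral>x. real n * indicator A x + ?T n x \<partial>leb01)"
      using A T f int
      by (intro integral_mono integrable_norm integrable_cutf Bochner_Integration.integrable_add) (auto simp: cutf_def indicator_def)
    also have "\<dots> = real n * mu A + (\<integral>x. ?T n x \<partial>leb01)"
      using A int T by (subst Bochner_Integration.integral_add) auto
    also have "real n * mu A \<le> (real n + 1) * mu A" by (simp add: mult_right_mono)
    also have "(real n + 1) * mu A < e / 2" using A(2) by (simp add: field_simps)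
    finally show "(\<integral>x. norm (cutf A f x) \<partial>leb01) < e"
      using n A by simp
  qed (use assms in simp)
qed

lemma scale_L1_simps:
  "scale_L1 c (f + g) = scale_L1 c f + scale_L1 c g"
  "scale_L1 (c + d) f = scale_L1 c f + scale_L1 d f"
  "scale_L1 c (scale_L1 d f) = scale_L1 (c * d) f"
  "scale_L1 1 f = f"
  by (transfer; simp add: distrib_left distrib_right mult.assoc)+

lemma scale_Linf_simps:
  "scale_Linf c (f + g) = scale_Linf c f + scale_Linf c g"
  "scale_Linf (c + d) f = scale_Linf c f + scale_Linf d f"
  "scale_Linf c (scale_Linf d f) = scale_Linf (c * d) f"
  "scale_Linf 1 f = f"
  by (transfer; simp add: distrib_left distrib_right mult.assoc ess_bounded_add ess_bounded_cmult)+

interpretation L1: vector_space "scale_L1 :: 'k::scalar \<Rightarrow> _"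
  by standard (simp_all add: scale_L1_simps)

interpretation Linf: vector_space "scale_Linf :: 'k::scalar \<Rightarrow> _"
  by standard (simp_all add: scale_Linf_simps)

lemma norm_scale_L1: "norm (scale_L1 c f) = norm c * norm f"
  by transfer (simp add: norm_mult)

lemma norm_scale_Linf_le: "norm (scale_Linf c f) \<le> norm c * norm f"
  by transfer (simp add: ess_bounded_cmult)

lemma scale_L1_of_real: "scale_L1 (of_real r) f = r *\<^sub>R f"
  by transfer (simp add: scaleR_conv_of_real)

lemma scale_Linf_of_real: "scale_Linf (of_real r) f = r *\<^sub>R f"
  by (simp add: scaleR_Linf_def)

lemma pairing_add_left: "pairing (f + f') g = pairing f g + pairing f' g"
  by transfer (simp add: distrib_right integrable_mult_ess_bounded)

lemma pairing_add_right: "pairing f (g + g') = pairing f g + pairing f g'"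
  by transfer (simp add: distrib_left integrable_mult_ess_bounded)

lemma pairing_scale_left: "pairing (scale_L1 c f) g = c * pairing f g"
  by transfer (simp add: mult.assoc integrable_mult_ess_bounded)

lemma pairing_scale_right: "pairing f (scale_Linf c g) = c * pairing f g"
  by transfer (simp add: mult.left_commute integrable_mult_ess_bounded)

lemma norm_pairing: "norm (pairing f g) \<le> norm f * norm g"
proof transfer
  fix f g :: "real \<Rightarrow> 'a"
  assume *: "integrable leb01 f \<and> integrable leb01 f \<and> (AE x in leb01. f x = f x)"
    "ess_bounded g \<and> ess_bounded g \<and> (AE x in leb01. g x = g x)"
  have "norm (\<integral>x. f x * g x \<partial>leb01) \<le> (\<integral>x. norm (f x * g x) \<partial>leb01)" by simp
  also have "\<dots> \<le> (\<integral>x. norm (f x) * real_of_ereal (ess_norm g) \<partial>leb01)"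
  proof (rule integral_mono_AE)
    show "AE x in leb01. norm (f x * g x) \<le> norm (f x) * real_of_ereal (ess_norm g)"
      using ess_norm_AE[of g] *(2) by (auto elim!: eventually_mono simp: norm_mult mult_left_mono)
    show "integrable leb01 (\<lambda>x. norm (f x * g x))"
      using * by (intro integrable_norm integrable_mult_ess_bounded) auto
  qed (use * in simp)
  finally show "norm (\<integral>x. f x * g x \<partial>leb01) \<le> (\<integral>x. norm (f x) \<partial>leb01) * real_of_ereal (ess_norm g)"
    by simp
qed

lemma pairing_cut: "pairing (cut_L1 A f) g = pairing f (cut_Linf A g)"
  by transfer (auto intro!: Bochner_Integration.integral_cong simp: cutf_def)

lemma pairing_scaleR_left: "pairing (r *\<^sub>R f) g = r *\<^sub>R pairing f g"
  using pairing_scale_left[of "of_real r" f g] by (simp add: scale_L1_of_real scaleR_conv_of_real)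

lemma pairing_scaleR_right: "pairing f (r *\<^sub>R g) = r *\<^sub>R pairing f g"
  using pairing_scale_right[of f "of_real r" g] by (simp add: scale_Linf_of_real scaleR_conv_of_real)

interpretation pairing: bounded_bilinear "pairing :: 'k::scalar L1 \<Rightarrow> 'k Linf \<Rightarrow> 'k"
  by (standard; (simp add: pairing_add_left pairing_add_right pairing_scaleR_left pairing_scaleR_right)?)
    (intro exI[of _ 1], simp add: norm_pairing)

text \<open>Elements of \<open>L\<^sub>\<infinity>\<close> that are built pointwise from \<open>f\<close> replace complex conjugation: for a scalar \<open>w\<close>,
  the product of \<open>w\<close> with \<open>\<phi> |w| / w\<close> is the real number \<open>\<phi> |w|\<close> (or \<open>0\<close>, if \<open>w = 0\<close>).\<close>
lemma ess_bounded_normalized: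
  fixes f :: "real \<Rightarrow> 'k::scalar"
  assumes "f \<in> borel_measurable leb01" and "\<phi> \<in> borel_measurable borel" and "\<And>t. 0 \<le> t \<Longrightarrow> \<bar>\<phi> t * inverse t\<bar> \<le> c"
  shows "ess_bounded (\<lambda>x. of_real (\<phi> (norm (f x))) * inverse (f x))"
    "real_of_ereal (ess_norm (\<lambda>x. of_real (\<phi> (norm (f x))) * inverse (f x))) \<le> c"
proof -
  have m: "(\<lambda>x. of_real (\<phi> (norm (f x))) * inverse (f x)) \<in> borel_measurable leb01"
  proof (intro borel_measurable_times)
    have "(\<lambda>x. \<phi> (norm (f x))) \<in> borel_measurable leb01"
      using assms(1,2) by measurable
    then have "(\<lambda>x. \<phi> (norm (f x)) *\<^sub>R (1::'k)) \<in> borel_measurable leb01"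
      by (intro borel_measurable_scaleR) auto
    then show "(\<lambda>x. of_real (\<phi> (norm (f x))) :: 'k) \<in> borel_measurable leb01"
      by (simp add: scaleR_conv_of_real)
    show "(\<lambda>x. inverse (f x)) \<in> borel_measurable leb01"
      using assms(1) by (intro borel_measurable_inverse)
  qed
  have "AE x in leb01. norm (of_real (\<phi> (norm (f x))) * inverse (f x)) \<le> c"
    using assms(3)[OF norm_ge_zero] by (intro AE_I2) (simp add: norm_mult norm_inverse abs_mult)
  from ess_norm_le[OF m this]
  show "ess_bounded (\<lambda>x. of_real (\<phi> (norm (f x))) * inverse (f x))"
    "real_of_ereal (ess_norm (\<lambda>x. of_real (\<phi> (norm (f x))) * inverse (f x))) \<le> c" by auto
qed

lemma self_times_inverse_le: "t * inverse t \<le> (1::real)"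
  by (cases "t = 0") auto

lift_definition phase :: "'k::scalar L1 \<Rightarrow> 'k Linf" is "\<lambda>f x. of_real (norm (f x)) * inverse (f x)"
proof -
  fix f g :: "real \<Rightarrow> 'k" assume "integrable leb01 f \<and> integrable leb01 g \<and> (AE x in leb01. f x = g x)"
  then show "ess_bounded (\<lambda>x. of_real (norm (f x)) * inverse (f x)) \<and>
       ess_bounded (\<lambda>x. of_real (norm (g x)) * inverse (g x)) \<and>
       (AE x in leb01. of_real (norm (f x)) * inverse (f x) = of_real (norm (g x)) * inverse (g x))"
    using ess_bounded_normalized(1)[of f "\<lambda>t. t" 1] ess_bounded_normalized(1)[of g "\<lambda>t. t" 1]
    by (auto simp: self_times_inverse_le elim!: eventually_mono)
qed

lemma norm_phase: "norm (phase f) \<le> 1"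
proof transfer
  fix f :: "real \<Rightarrow> 'a" assume "integrable leb01 f \<and> integrable leb01 f \<and> (AE x in leb01. f x = f x)"
  then show "real_of_ereal (ess_norm (\<lambda>x. of_real (norm (f x)) * inverse (f x))) \<le> 1"
    by (intro ess_bounded_normalized(2)[where \<phi> = "\<lambda>t. t"]) (auto simp: self_times_inverse_le)
qed

lemma pairing_phase: "pairing f (phase f) = of_real (norm f)"
proof transfer
  fix f :: "real \<Rightarrow> 'a" assume f: "integrable leb01 f \<and> integrable leb01 f \<and> (AE x in leb01. f x = f x)"
  have "(\<integral>x. f x * (of_real (norm (f x)) * inverse (f x)) \<partial>leb01) = (\<integral>x. norm (f x) *\<^sub>R (1::'a) \<partial>leb01)"
  proof (intro Bochner_Integration.integral_cong refl)
    show "f x * (of_real (norm (f x)) * inverse (f x)) = norm (f x) *\<^sub>R 1" for x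
      by (cases "f x = 0") (auto simp: scaleR_conv_of_real)
  qed
  also have "\<dots> = (\<integral>x. norm (f x) \<partial>leb01) *\<^sub>R (1::'a)"
    using f by (intro integral_scaleR_left) auto
  finally show "(\<integral>x. f x * (of_real (norm (f x)) * inverse (f x)) \<partial>leb01) = of_real (\<integral>x. norm (f x) \<partial>leb01)"
    by (simp add: scaleR_conv_of_real)
qed

lemma norm_L1_le_pairing:
  assumes "\<And>g. norm g \<le> 1 \<Longrightarrow> norm (pairing f g) \<le> c"
  shows "norm f \<le> c"
  using assms[OF norm_phase[of f]] by (simp add: pairing_phase)

text \<open>The test function is the phase of \<open>g\<close> on the set where \<open>|g| > c\<close>; if this set had positive measure,
  the pairing would exceed \<open>c\<close> times its measure.\<close>
lemma norm_Linf_le_pairing: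
  fixes g :: "'k::scalar Linf"
  assumes c: "0 \<le> c" and "\<And>f. norm (pairing f g) \<le> c * norm f"
  shows "norm g \<le> c"
  using assms(2)
proof (transfer fixing: c)
  fix g :: "real \<Rightarrow> 'k"
  assume g: "ess_bounded g \<and> ess_bounded g \<and> (AE x in leb01. g x = g x)"
    and le: "\<And>f. integrable leb01 f \<and> integrable leb01 f \<and> (AE x in leb01. f x = f x)
      \<Longrightarrow> norm (\<integral>x. f x * g x \<partial>leb01) \<le> c * (\<integral>x. norm (f x) \<partial>leb01)"
  have [measurable]: "g \<in> borel_measurable leb01" using g ess_bounded_measurable by blast
  have ing: "integrable leb01 g" using g integrable_ess_bounded by blast
  have "AE x in leb01. norm (g x) \<le> c"
  proof -
    define A where "A = {x\<in>space leb01. c < norm (g x)}"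
    have A: "A \<in> sets leb01" unfolding A_def by measurable
    define f where "f = cutf A (\<lambda>x. of_real (norm (g x)) * inverse (g x))"
    have f: "integrable leb01 f"
      unfolding f_def
      using ess_bounded_normalized(1)[of g "\<lambda>t. t" 1] by (intro integrable_cutf integrable_ess_bounded) (auto simp: self_times_inverse_le)
    have iA: "integrable leb01 (indicator A :: real \<Rightarrow> real)"
      using A by (intro integrable_real_indicator) (auto simp: leb01.emeasure_eq_measure)
    have fg: "f x * g x = norm (cutf A g x) *\<^sub>R 1" for x
      using A by (cases "g x = 0") (auto simp: f_def cutf_def indicator_def scaleR_conv_of_real field_simps)
    have "(\<integral>x. f x * g x \<partial>leb01) = of_real (\<integral>x. norm (cutf A g x) \<partial>leb01)"
      using ing by (simp add: fg integrable_cutf scaleR_conv_of_real del: of_real_eq_iff)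
    then have "(\<integral>x. norm (cutf A g x) \<partial>leb01) \<le> c * (\<integral>x. norm (f x) \<partial>leb01)"
      using le[of f] f by simp
    also have "c * (\<integral>x. norm (f x) \<partial>leb01) \<le> c * (\<integral>x. indicator A x \<partial>leb01)"
    proof (intro mult_left_mono integral_mono integrable_norm f c iA)
      show "norm (f x) \<le> indicator A x" for x
        using A self_times_inverse_le[of "norm (g x)"] by (auto simp: f_def cutf_def indicator_def norm_mult norm_inverse)
    qed
    finally have "(\<integral>x. norm (cutf A g x) - c * indicator A x \<partial>leb01) \<le> 0"
      using iA ing by (subst Bochner_Integration.integral_diff) (auto intro!: integrable_cutf integrable_mult_right)
    moreover have nn: "0 \<le> norm (cutf A g x) - c * indicator A x" for x
      using A by (auto simp: cutf_def indicator_def A_def)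
    moreover have int: "integrable leb01 (\<lambda>x. norm (cutf A g x) - c * indicator A x)"
      using iA ing by (intro Bochner_Integration.integrable_diff integrable_norm integrable_cutf integrable_mult_right)
    ultimately have "(\<integral>x. norm (cutf A g x) - c * indicator A x \<partial>leb01) = 0"
      by (intro antisym Bochner_Integration.integral_nonneg) auto
    then have "AE x in leb01. norm (cutf A g x) - c * indicator A x = 0"
      using integral_nonneg_eq_0_iff_AE[OF int] nn by auto
    then show ?thesis
      using AE_space
    proof eventually_elim
      case (elim x)
      then show ?case using A by (cases "x \<in> A") (auto simp: A_def cutf_def)
    qed
  qed
  then show "real_of_ereal (ess_norm g) \<le> c"
    by (intro ess_norm_le) auto
qed


lemma cut_Linf_add: "cut_Linf A (f + g) = cut_Linf A f + cut_Linf A g"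
  by transfer (simp add: cutf_linear ess_bounded_cutf ess_bounded_add)

lemma cut_Linf_scale: "cut_Linf A (scale_Linf c f) = scale_Linf c (cut_Linf A f)"
  by transfer (simp add: cutf_linear ess_bounded_cutf ess_bounded_cmult)

lemma norm_cut_Linf_le: "norm (cut_Linf A g) \<le> norm g"
proof (rule norm_Linf_le_pairing)
  fix f
  have "norm (pairing f (cut_Linf A g)) \<le> norm (cut_L1 A f) * norm g"
    using norm_pairing[of "cut_L1 A f" g] by (simp add: pairing_cut)
  also have "\<dots> \<le> norm f * norm g" by (intro mult_right_mono norm_cut_le) auto
  finally show "norm (pairing f (cut_Linf A g)) \<le> norm g * norm f" by (simp add: mult.commute)
qed simp

lemma Linf_eqI: "(\<And>f. pairing f g = pairing f g') \<Longrightarrow> g = g'"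
  using norm_Linf_le_pairing[of 0 "g - g'"] by (simp add: pairing.diff_right)

lemma cut_Linf_cut_Linf: "A \<in> sets leb01 \<Longrightarrow> B \<in> sets leb01 \<Longrightarrow> cut_Linf A (cut_Linf B f) = cut_Linf (A \<inter> B) f"
  by transfer (simp add: cutf_cutf ess_bounded_cutf)

lemma cut_Linf_Un:
  "A \<in> sets leb01 \<Longrightarrow> B \<in> sets leb01 \<Longrightarrow> A \<inter> B = {} \<Longrightarrow> cut_Linf (A \<union> B) f = cut_Linf A f + cut_Linf B f"
  by transfer (simp add: cutf_Un ess_bounded_cutf ess_bounded_add)

lemma cut_Linf_empty [simp]: "cut_Linf {} f = 0"
  by transfer (simp add: cutf_def ess_bounded_cutf ess_bounded_zero)

lemma cut_Linf_space [simp]: "cut_Linf {0<..<1} f = f"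
  by (rule Linf_eqI) (simp flip: pairing_cut)

lemma norm_cut_Linf_add_le:
  assumes AB: "A \<in> sets leb01" "B \<in> sets leb01" "A \<inter> B = {}" and g: "norm g \<le> c" "norm h \<le> c"
  shows "norm (cut_Linf A g + cut_Linf B h) \<le> c"
proof (rule norm_Linf_le_pairing)
  show "0 \<le> c" using g(1) norm_ge_zero order_trans by blast
  fix f
  have "norm (pairing f (cut_Linf A g + cut_Linf B h)) \<le> norm (pairing (cut_L1 A f) g) + norm (pairing (cut_L1 B f) h)"
    by (simp add: pairing_add_right norm_triangle_ineq flip: pairing_cut)
  also have "\<dots> \<le> norm (cut_L1 A f) * c + norm (cut_L1 B f) * c"
    using g by (intro add_mono order_trans[OF norm_pairing] mult_left_mono) auto
  also have "\<dots> = c * norm (cut_L1 (A \<union> B) f)"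
    using AB by (simp add: norm_cut_Un algebra_simps)
  also have "\<dots> \<le> c * norm f" using \<open>0 \<le> c\<close> by (intro mult_left_mono norm_cut_le)
  finally show "norm (pairing f (cut_Linf A g + cut_Linf B h)) \<le> c * norm f" .
qed

lemma norm_cut_Linf_sum_le:
  assumes "finite I" "\<And>i. i \<in> I \<Longrightarrow> A i \<in> sets leb01" "disjoint_family_on A I" "\<And>i. i \<in> I \<Longrightarrow> norm (g i) \<le> c" "0 \<le> c"
  shows "norm (\<Sum>i\<in>I. cut_Linf (A i) (g i)) \<le> c"
proof -
  have "(\<Sum>i\<in>I. cut_Linf (A i) (g i)) = cut_Linf (\<Union>i\<in>I. A i) (\<Sum>i\<in>I. cut_Linf (A i) (g i)) \<and> norm (\<Sum>i\<in>I. cut_Linf (A i) (g i)) \<le> c"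
    using assms(1-4)
  proof (induction I)
    case empty
    then show ?case using assms(5) by simp
  next
    case (insert i I)
    let ?U = "\<Union>i\<in>I. A i" and ?s = "\<Sum>i\<in>I. cut_Linf (A i) (g i)"
    have U: "?U \<in> sets leb01" "A i \<in> sets leb01" using insert by auto
    have disj: "A i \<inter> ?U = {}" using insert by (auto simp: disjoint_family_on_def)
    have IH: "?s = cut_Linf ?U ?s" "norm ?s \<le> c"
      using insert by (auto simp: disjoint_family_on_def)
    have "norm (cut_Linf (A i) (g i) + cut_Linf ?U ?s) \<le> c"
      using insert.prems IH(2) U disj by (intro norm_cut_Linf_add_le) auto
    moreover have "cut_Linf (A i \<union> ?U) (cut_Linf (A i) (g i) + cut_Linf ?U ?s) = cut_Linf (A i) (g i) + cut_Linf ?U ?s"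
      using U disj by (simp add: cut_Linf_add cut_Linf_cut_Linf Int_Un_distrib2 Int_commute)
    ultimately show ?case using insert.hyps IH(1) by simp
  qed
  then show ?thesis by simp
qed

lemma norm_cut_sum:
  assumes "finite I" "\<And>i. i \<in> I \<Longrightarrow> A i \<in> sets leb01" "disjoint_family_on A I"
  shows "norm (\<Sum>i\<in>I. cut_L1 (A i) (f i)) = (\<Sum>i\<in>I. norm (cut_L1 (A i) (f i)))"
proof -
  have "(\<Sum>i\<in>I. cut_L1 (A i) (f i)) = cut_L1 (\<Union>i\<in>I. A i) (\<Sum>i\<in>I. cut_L1 (A i) (f i)) \<and> norm (\<Sum>i\<in>I. cut_L1 (A i) (f i)) = (\<Sum>i\<in>I. norm (cut_L1 (A i) (f i)))"
    using assms
  proof (induction I)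
    case (insert i I)
    let ?U = "\<Union>i\<in>I. A i" and ?s = "\<Sum>i\<in>I. cut_L1 (A i) (f i)"
    have U: "?U \<in> sets leb01" "A i \<in> sets leb01" using insert by auto
    have disj: "A i \<inter> ?U = {}" using insert by (auto simp: disjoint_family_on_def)
    have IH: "?s = cut_L1 ?U ?s" "norm ?s = (\<Sum>i\<in>I. norm (cut_L1 (A i) (f i)))"
      using insert by (auto simp: disjoint_family_on_def)
    have "norm (cut_L1 (A i) (f i) + cut_L1 ?U ?s) = norm (cut_L1 (A i) (f i)) + norm (cut_L1 ?U ?s)"
      using U disj by (intro norm_cut_add) auto
    moreover have "cut_L1 (A i \<union> ?U) (cut_L1 (A i) (f i) + cut_L1 ?U ?s) = cut_L1 (A i) (f i) + cut_L1 ?U ?s"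
      using U disj by (simp add: cut_add cut_cut Int_Un_distrib2 Int_commute)
    ultimately show ?case using insert.hyps IH by simp
  qed simp
  then show ?thesis by simp
qed

lemma cut_UN:
  assumes "finite I" "\<And>i. i \<in> I \<Longrightarrow> A i \<in> sets leb01" "disjoint_family_on A I"
  shows "cut_L1 (\<Union>i\<in>I. A i) f = (\<Sum>i\<in>I. cut_L1 (A i) f)"
  using assms
proof (induction I)
  case (insert i I)
  have "(\<Union>i\<in>I. A i) \<in> sets leb01" "A i \<in> sets leb01" using insert by auto
  moreover have "A i \<inter> (\<Union>i\<in>I. A i) = {}" using insert by (auto simp: disjoint_family_on_def)
  moreover have "cut_L1 (\<Union>i\<in>I. A i) f = (\<Sum>i\<in>I. cut_L1 (A i) f)"
    using insert by (auto simp: disjoint_family_on_def)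
  ultimately show ?case using insert.hyps by (simp add: cut_Un)
qed simp

lemma cut_Linf_UN:
  assumes "finite I" "\<And>i. i \<in> I \<Longrightarrow> A i \<in> sets leb01" "disjoint_family_on A I"
  shows "cut_Linf (\<Union>i\<in>I. A i) f = (\<Sum>i\<in>I. cut_Linf (A i) f)"
  by (rule Linf_eqI) (simp add: cut_UN[OF assms] pairing.sum_left pairing.sum_right flip: pairing_cut)

lemma embed_add: "embed (f + g) = embed f + embed g"
  by transfer (simp add: integrable_ess_bounded)

lemma embed_scale: "embed (scale_Linf c f) = scale_L1 c (embed f)"
  by transfer (simp add: integrable_ess_bounded)

lemma embed_scaleR: "embed (r *\<^sub>R f) = r *\<^sub>R embed f"
  using embed_scale[of "of_real r" f] by (simp add: scale_L1_of_real scale_Linf_of_real)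

lemma embed_cut: "embed (cut_Linf A g) = cut_L1 A (embed g)"
  by transfer (simp add: integrable_ess_bounded integrable_cutf)

lemma norm_embed_cut:
  assumes "A \<in> sets leb01"
  shows "norm (cut_L1 A (embed g)) \<le> mu A * norm g"
  using assms
proof transfer
  fix A and g :: "real \<Rightarrow> 'a"
  assume A: "A \<in> sets leb01" and g: "ess_bounded g \<and> ess_bounded g \<and> (AE x in leb01. g x = g x)"
  have [simp]: "A \<inter> {0<..<1} = A" using sets.sets_into_space[OF A] by auto
  have "(\<integral>x. norm (cutf A g x) \<partial>leb01) \<le> (\<integral>x. real_of_ereal (ess_norm g) * indicator A x \<partial>leb01)"
  proof (rule integral_mono_AE)
    show "integrable leb01 (\<lambda>x. norm (cutf A g x))"
      using g by (intro integrable_norm integrable_cutf integrable_ess_bounded) auto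
    show "integrable leb01 (\<lambda>x. real_of_ereal (ess_norm g) * indicator A x)"
      using A by (intro integrable_mult_right) (auto simp: integrable_indicator_iff leb01.emeasure_eq_measure)
    show "AE x in leb01. norm (cutf A g x) \<le> real_of_ereal (ess_norm g) * indicator A x"
      using ess_norm_AE[of g] g A by (auto elim!: eventually_mono simp: cutf_def indicator_def)
  qed
  then show "(\<integral>x. norm (cutf A g x) \<partial>leb01) \<le> mu A * real_of_ereal (ess_norm g)"
    using A by (simp add: mult.commute)
qed

lemma norm_embed: "norm (embed g) \<le> norm g"
  using norm_embed_cut[of "{0<..<1}" g] leb01.prob_space by simp

lemma norm_one_Linf: "norm (one_Linf :: 'k::scalar Linf) \<le> 1"
  by transfer (use ess_norm_le(2)[of "\<lambda>x. 1::'k" 1] in auto)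

lemma chi_eq: "chi_L1 A = cut_L1 A (embed one_Linf)"
  by (simp add: chi_L1_def chi_Linf_def embed_cut)

lemma norm_chi:
  assumes "A \<in> sets leb01"
  shows "norm (chi_L1 A :: 'k::scalar L1) = mu A"
proof -
  have [simp]: "A \<inter> {0<..<1} = A" using sets.sets_into_space[OF assms] by auto
  have "norm (cut_L1 A (embed one_Linf) :: 'k L1) = (\<integral>x. norm (cutf A (\<lambda>x. 1 :: 'k) x) \<partial>leb01)"
    by transfer simp
  also have "\<dots> = (\<integral>x. indicator A x \<partial>leb01)"
    using assms by (intro Bochner_Integration.integral_cong) (auto simp: cutf_def indicator_def)
  finally show ?thesis using assms by (simp add: chi_eq)
qed

lemma cut_chi: "A \<in> sets leb01 \<Longrightarrow> B \<in> sets leb01 \<Longrightarrow> cut_L1 A (chi_L1 B) = chi_L1 (A \<inter> B)"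
  by (simp add: chi_eq cut_cut)

lemma cut_Linf_chi_Linf: "A \<in> sets leb01 \<Longrightarrow> B \<in> sets leb01 \<Longrightarrow> cut_Linf A (chi_Linf B) = chi_Linf (A \<inter> B)"
  by (simp add: chi_Linf_def cut_Linf_cut_Linf)

section \<open>Completeness and simple functions\<close>

lemma L1_summable_convergent:
  fixes d :: "nat \<Rightarrow> 'k::scalar L1"
  assumes sum: "summable (\<lambda>n. norm (d n))"
  shows "\<exists>F. (\<lambda>n. \<Sum>i<n. d i) \<longlonglongrightarrow> F"
proof -
  have "\<exists>f. integrable leb01 f \<and> d n = abs_L1 f" for n
    by (rule abs_L1_cases[of "d n"]) blast
  then obtain f where f: "\<And>n. integrable leb01 (f n)" and d: "\<And>n. d n = abs_L1 (f n)" by metis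
  have norm_d: "norm (d n) = (\<integral>x. norm (f n x) \<partial>leb01)" for n
    unfolding d using f by (intro norm_L1.abs_eq) auto
  have [measurable]: "f n \<in> borel_measurable leb01" for n using f by auto
  have "(\<integral>\<^sup>+x. (\<Sum>n. ennreal (norm (f n x))) \<partial>leb01) = (\<Sum>n. \<integral>\<^sup>+x. ennreal (norm (f n x)) \<partial>leb01)"
    by (rule nn_integral_suminf) auto
  also have "\<dots> = (\<Sum>n. ennreal (norm (d n)))"
    using f by (simp add: norm_d nn_integral_eq_integral)
  also have "\<dots> < \<infinity>" using sum by (simp add: ennreal_suminf_neq_top less_top)
  finally have "AE x in leb01. (\<Sum>n. ennreal (norm (f n x))) \<noteq> \<infinity>"
    by (intro nn_integral_PInf_AE) auto
  then have AEsum: "AE x in leb01. summable (\<lambda>n. norm (f n x))"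
    by eventually_elim (intro summable_suminf_not_top, auto)
  define F where "F x = (\<Sum>n. f n x)" for x
  have F: "integrable leb01 F"
    unfolding F_def using f AEsum sum by (intro integrable_suminf) (simp_all only: norm_d)
  have G: "integrable leb01 (\<lambda>x. \<Sum>n. norm (f n x))"
    using f AEsum sum by (intro integrable_suminf integrable_norm) (simp_all only: norm_d real_norm_def abs_norm_cancel)
  have Fm [measurable]: "F \<in> borel_measurable leb01" using F by auto
  have "(\<lambda>n. \<integral>x. norm ((\<Sum>i<n. f i x) - F x) \<partial>leb01) \<longlonglongrightarrow> (\<integral>x. 0 \<partial>leb01)"
  proof (rule integral_dominated_convergence[where w = "\<lambda>x. (\<Sum>n. norm (f n x)) + (\<Sum>n. norm (f n x))"])
    show "AE x in leb01. (\<lambda>n. norm ((\<Sum>i<n. f i x) - F x)) \<longlonglongrightarrow> 0"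
      using AEsum
    proof eventually_elim
      case (elim x)
      then have "(\<lambda>n. \<Sum>i<n. f i x) \<longlonglongrightarrow> F x"
        unfolding F_def by (rule summable_LIMSEQ[OF summable_norm_cancel])
      then have "(\<lambda>n. (\<Sum>i<n. f i x) - F x) \<longlonglongrightarrow> 0" by (rule LIM_zero)
      then show ?case by (rule tendsto_norm_zero)
    qed
    show "AE x in leb01. norm (norm ((\<Sum>i<n. f i x) - F x)) \<le> (\<Sum>n. norm (f n x)) + (\<Sum>n. norm (f n x))" for n
      using AEsum
    proof eventually_elim
      case (elim x)
      have "norm (\<Sum>i<n. f i x) \<le> (\<Sum>i<n. norm (f i x))" by (rule norm_sum)
      also have "\<dots> \<le> (\<Sum>n. norm (f n x))" using elim by (intro sum_le_suminf) auto
      finally have "norm (\<Sum>i<n. f i x) \<le> (\<Sum>n. norm (f n x))" .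
      moreover have "norm (F x) \<le> (\<Sum>n. norm (f n x))"
        unfolding F_def using elim by (rule summable_norm)
      ultimately show ?case
        using norm_triangle_ineq4[of "\<Sum>i<n. f i x" "F x"] by simp
    qed
    show "integrable leb01 (\<lambda>x. (\<Sum>n. norm (f n x)) + (\<Sum>n. norm (f n x)))"
      using G by simp
  qed auto
  moreover have part: "(\<Sum>i<n. d i) = abs_L1 (\<lambda>x. \<Sum>i<n. f i x) \<and> integrable leb01 (\<lambda>x. \<Sum>i<n. f i x)" for n
  proof (induction n)
    case 0
    then show ?case by (simp add: zero_L1_def)
  next
    case (Suc n)
    then show ?case using f by (simp add: d plus_L1.abs_eq)
  qed
  moreover have "norm ((\<Sum>i<n. d i) - abs_L1 F) = (\<integral>x. norm ((\<Sum>i<n. f i x) - F x) \<partial>leb01)" for n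
    using part[of n] F by (simp add: minus_L1.abs_eq norm_L1.abs_eq)
  ultimately have "(\<lambda>n. norm ((\<Sum>i<n. d i) - abs_L1 F)) \<longlonglongrightarrow> 0" by simp
  then have "(\<lambda>n. \<Sum>i<n. d i) \<longlonglongrightarrow> abs_L1 F"
    by (simp add: LIM_zero_iff tendsto_norm_zero_iff)
  then show ?thesis ..
qed

instance L1 :: (scalar) banach
proof
  fix X :: "nat \<Rightarrow> 'a L1" assume X: "Cauchy X"
  have "\<exists>N. \<forall>m\<ge>N. \<forall>n\<ge>N. norm (X m - X n) < (1/2)^k" for k
    using X by (intro CauchyD) auto
  then obtain N where N: "\<And>k m n. m \<ge> N k \<Longrightarrow> n \<ge> N k \<Longrightarrow> norm (X m - X n) < (1/2)^k" by metis
  define r where "r k = (\<Sum>j\<le>k. N j) + k" for k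
  have rN: "N k \<le> r k" for k unfolding r_def by (cases k) auto
  have mono: "strict_mono r" by (intro strict_monoI_Suc) (simp add: r_def)
  have "norm (X (r (Suc k)) - X (r k)) \<le> (1/2)^k" for k
    using N[of k "r (Suc k)" "r k"] rN[of k] strict_mono_less_eq[OF mono, of k "Suc k"] by auto
  then have "summable (\<lambda>k. norm (X (r (Suc k)) - X (r k)))"
    by (intro summable_comparison_test'[OF summable_geometric[of "1/2::real"], of 0]) auto
  from L1_summable_convergent[OF this] obtain F
    where "(\<lambda>n. \<Sum>i<n. X (r (Suc i)) - X (r i)) \<longlonglongrightarrow> F" by auto
  then have "(\<lambda>n. (X (r n) - X (r 0)) + X (r 0)) \<longlonglongrightarrow> F + X (r 0)"
    by (intro tendsto_add tendsto_const) (simp only: sum_lessThan_telescope[of "\<lambda>i. X (r i)"])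
  then have "(X \<circ> r) \<longlonglongrightarrow> F + X (r 0)" by (simp add: o_def)
  then show "convergent X"
    using X mono unfolding convergent_def by (blast intro: Cauchy_converges_subseq)
qed

text \<open>The values of \<open>g\<close> lie in a compact ball, which is covered by finitely many balls of radius \<open>e\<close>.  Each
  value is rounded to the centre of the first ball, in a fixed enumeration, that contains it.\<close>
lemma Linf_simple_dense:
  fixes g :: "'k::{scalar, euclidean_space} Linf"
  assumes "e > 0"
  obtains Y E where "finite Y" "\<And>y. y \<in> Y \<Longrightarrow> E y \<in> sets leb01" "disjoint_family_on E Y"
    "norm (g - (\<Sum>y\<in>Y. scale_Linf y (chi_Linf (E y)))) \<le> e"
proof -
  obtain f where f: "ess_bounded f" "g = abs_Linf f" by (rule abs_Linf_cases)
  have [measurable]: "f \<in> borel_measurable leb01" using f ess_bounded_measurable by blast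
  define c where "c = real_of_ereal (ess_norm f)"
  obtain Z where Z: "finite Z" "cball (0::'k) c \<subseteq> (\<Union>z\<in>Z. ball z e)"
    using compact_cball[of "0::'k" c] assms unfolding compact_eq_totally_bounded by blast
  obtain zs where zs: "set zs = Z" using Z(1) finite_list by blast
  define pick where "pick = rec_list (\<lambda>_. 0) (\<lambda>z _ p y. if dist z y < e then z else p (y::'k))"
  have pick_simps: "pick [] = (\<lambda>_. 0)" "pick (z # l) = (\<lambda>y. if dist z y < e then z else pick l y)" for z l
    unfolding pick_def by simp_all
  have pick_in: "pick l y \<in> insert 0 (set l)" for l y
    by (induction l) (auto simp: pick_simps)
  have pick_m: "pick l \<in> borel_measurable borel" for l
    by (induction l) (auto simp: pick_simps)
  have pick_near: "dist (pick l y) y < e" if "\<exists>z\<in>set l. dist z y < e" for l y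
    using that by (induction l) (auto simp: pick_simps)
  define E where "E y = {x\<in>space leb01. pick zs (f x) = y}" for y
  have E: "E y \<in> sets leb01" for y
  proof -
    have "(\<lambda>x. pick zs (f x)) \<in> borel_measurable leb01" using pick_m by measurable
    then show ?thesis unfolding E_def by measurable
  qed
  define Y where "Y = insert 0 Z"
  define s where "s x = (\<Sum>y\<in>Y. y * cutf (E y) (\<lambda>_. 1) x)" for x
  have eb: "ess_bounded (\<lambda>x. \<Sum>y\<in>V. y * cutf (E y) (\<lambda>_. 1) x)
     \<and> abs_Linf (\<lambda>x. \<Sum>y\<in>V. y * cutf (E y) (\<lambda>_. 1) x) = (\<Sum>y\<in>V. scale_Linf y (chi_Linf (E y)))" if "finite V" for V
    using that
  proof induction
    case empty
    then show ?case by (simp add: ess_bounded_zero zero_Linf_def)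
  next
    case (insert y V)
    have 1: "ess_bounded (\<lambda>x. 1::'k)" using ess_norm_le(1)[of "\<lambda>x. 1::'k" 1] by auto
    have "chi_Linf (E y) = abs_Linf (cutf (E y) (\<lambda>_. 1::'k))"
      unfolding chi_Linf_def one_Linf_def using 1 by (simp add: cut_Linf.abs_eq)
    then show ?case using insert 1
      by (simp add: ess_bounded_add ess_bounded_cmult ess_bounded_cutf plus_Linf.abs_eq[symmetric] scale_Linf.abs_eq)
  qed
  have s_eq: "s x = pick zs (f x)" if "x \<in> space leb01" for x
  proof -
    have "s x = (\<Sum>y\<in>Y. if y = pick zs (f x) then y else 0)"
      unfolding s_def using that E by (intro sum.cong) (auto simp: cutf_def E_def indicator_def)
    also have "\<dots> = pick zs (f x)" using pick_in[of zs "f x"] Z(1) by (simp add: Y_def zs)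
    finally show ?thesis .
  qed
  have Yf: "finite Y" using Z by (simp add: Y_def)
  have "AE x in leb01. norm (f x + (-1) * s x) \<le> e"
    using ess_norm_AE[OF f(1)] AE_space
  proof eventually_elim
    case (elim x)
    then have "f x \<in> cball 0 c" by (simp add: c_def)
    then obtain z where "z \<in> Z" "f x \<in> ball z e" using Z(2) by blast
    then have "\<exists>z\<in>set zs. dist z (f x) < e" using zs by auto
    then have "dist (pick zs (f x)) (f x) < e" by (rule pick_near)
    then show ?case using s_eq[OF elim(2)] by (simp add: dist_norm norm_minus_commute)
  qed
  moreover have sb: "ess_bounded s" "abs_Linf s = (\<Sum>y\<in>Y. scale_Linf y (chi_Linf (E y)))"
    using eb[OF Yf] unfolding s_def by auto
  moreover have fs: "ess_bounded (\<lambda>x. f x + (-1) * s x)"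
    using sb f by (intro ess_bounded_add ess_bounded_cmult)
  moreover have "norm (abs_Linf (\<lambda>x. f x + (-1) * s x)) = real_of_ereal (ess_norm (\<lambda>x. f x + (-1) * s x))"
    using fs by (intro norm_Linf.abs_eq) auto
  ultimately have "norm (abs_Linf (\<lambda>x. f x + (-1) * s x)) \<le> e"
    by (metis ess_norm_le(2) ess_bounded_measurable)
  also have "abs_Linf (\<lambda>x. f x + (-1) * s x) = g - abs_Linf s"
  proof -
    have "ess_bounded (\<lambda>x. (-1) * s x)" using sb(1) by (rule ess_bounded_cmult)
    then show ?thesis
      using f sb(1) unfolding minus_Linf_def uminus_Linf_def
      by (subst scale_Linf.abs_eq, simp, subst (1) f(2), subst plus_Linf.abs_eq) auto
  qed
  finally show ?thesis
    using that[of Y E] Yf E sb by (auto simp: disjoint_family_on_def E_def)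
qed

abbreviation compl :: "real set \<Rightarrow> real set" where "compl A \<equiv> {0<..<1} - A"

lemma sets_compl [intro, simp]: "A \<in> sets leb01 \<Longrightarrow> compl A \<in> sets leb01"
  using sets.compl_sets[of A leb01] by simp

lemma sets_leb01D: "A \<in> sets leb01 \<Longrightarrow> A \<subseteq> {0<..<1}"
  using sets.sets_into_space[of A leb01] by simp

lemma mu_mono: "A \<subseteq> B \<Longrightarrow> B \<in> sets leb01 \<Longrightarrow> mu A \<le> mu B"
  by (rule leb01.finite_measure_mono)

lemma norm_split_compl: "A \<in> sets leb01 \<Longrightarrow> norm f = norm (cut_L1 A f) + norm (cut_L1 (compl A) f)"
  using norm_cut_Un[of A "compl A" f] sets_leb01D[of A] by (simp add: Un_absorb1)

lemma split_compl_L1: "A \<in> sets leb01 \<Longrightarrow> f = cut_L1 A f + cut_L1 (compl A) f"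
  using cut_Un[of A "compl A" f] sets_leb01D[of A] by (simp add: Un_absorb1)

lemma split_compl_Linf: "A \<in> sets leb01 \<Longrightarrow> g = cut_Linf A g + cut_Linf (compl A) g"
  using cut_Linf_Un[of A "compl A" g] sets_leb01D[of A] by (simp add: Un_absorb1)

lemma cut_Linf_null: "A \<in> sets leb01 \<Longrightarrow> mu A = 0 \<Longrightarrow> cut_Linf A g = 0"
  by (rule Linf_eqI) (simp add: cut_null pairing.zero_left pairing.zero_right flip: pairing_cut)

lemma mu_partial_unions:
  fixes D :: "nat \<Rightarrow> real set"
  assumes D: "\<And>n. D n \<in> sets leb01"
  shows "(\<lambda>N. mu (\<Union>n<N. D n)) \<longlonglongrightarrow> mu (\<Union>n. D n)"
proof -
  have "(\<lambda>N. mu (\<Union>n<N. D n)) \<longlonglongrightarrow> mu (\<Union>N. \<Union>n<N. D n)"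
  proof (rule leb01.finite_Lim_measure_incseq)
    show "incseq (\<lambda>N. \<Union>n<N. D n)" unfolding incseq_def by (intro allI impI UN_mono) auto
  qed (use D in auto)
  moreover have "(\<Union>N. \<Union>n<N. D n) = (\<Union>n. D n)" by auto
  ultimately show ?thesis by simp
qed

lemma partial_union_disjoint:
  fixes D :: "nat \<Rightarrow> 'a set"
  assumes "disjoint_family D" "N \<le> m"
  shows "(\<Union>n<N. D n) \<inter> D m = {}"
proof -
  have "D n \<inter> D m = {}" if "n < N" for n
  proof (rule disjoint_family_onD[OF assms(1)])
    show "n \<noteq> m" using that assms(2) by linarith
  qed simp_all
  then show ?thesis by auto
qed

text \<open>By Markov's inequality, for the set \<open>E\<close> where \<open>|f| > M\<close>.  Comparing with the mass of \<open>f\<close> on \<open>E\<close>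
  instead of its norm shows that \<open>E\<close> is a null set when \<open>f\<close> acts as an element of \<open>L\<^sub>\<infinity>\<close>.\<close>
lemma bounded_off_small_set:
  fixes f :: "'k::scalar L1"
  assumes M: "M > 0"
  obtains E g where "E \<in> sets leb01" "M * mu E \<le> norm (cut_L1 E f)" "cut_L1 (compl E) f = embed g"
proof -
  obtain F where F: "integrable leb01 F" "f = abs_L1 F" by (rule abs_L1_cases)
  have [measurable]: "F \<in> borel_measurable leb01" using F by auto
  define E where "E = {x\<in>space leb01. M < norm (F x)}"
  have E: "E \<in> sets leb01" unfolding E_def by measurable
  have compl: "compl E \<in> sets leb01" using E by simp
  have "M * mu E = (\<integral>x. M * indicator E x \<partial>leb01)"
    using sets_leb01D[OF E] by (simp add: Int_absorb2)
  also have "\<dots> \<le> (\<integral>x. norm (cutf E F x) \<partial>leb01)"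
    using E F(1) M
    by (intro integral_mono integrable_norm integrable_cutf integrable_mult_right integrable_real_indicator)
      (auto simp: leb01.emeasure_eq_measure cutf_def E_def indicator_def)
  also have "\<dots> = norm (cut_L1 E f)" using F by (simp add: norm_L1.abs_eq cut_L1.abs_eq integrable_cutf)
  finally have 1: "M * mu E \<le> norm (cut_L1 E f)" .
  have "AE x in leb01. norm (cutf (compl E) F x) \<le> M"
    using M compl by (intro AE_I2) (auto simp: cutf_def indicator_def E_def)
  moreover have "cutf (compl E) F \<in> borel_measurable leb01"
    using integrable_cutf[OF F(1)] by auto
  ultimately have eb: "ess_bounded (cutf (compl E) F)" by (intro ess_norm_le(1))
  have "cut_L1 (compl E) f = embed (abs_Linf (cutf (compl E) F))"
    using F eb by (simp add: cut_L1.abs_eq embed.abs_eq)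
  then show ?thesis using that E 1 by blast
qed

lemma embed_dense:
  fixes f :: "'k::scalar L1"
  assumes e: "e > 0"
  obtains g where "norm (f - embed g) < e"
proof -
  obtain d where d: "d > 0" "\<And>A. A \<in> sets leb01 \<Longrightarrow> mu A < d \<Longrightarrow> norm (cut_L1 A f) < e"
    using cut_small[OF e, of f] by blast
  have "(norm f + 1) / d > 0" using d by (simp add: add_nonneg_pos)
  then obtain E g where E: "E \<in> sets leb01" "(norm f + 1) / d * mu E \<le> norm (cut_L1 E f)" "cut_L1 (compl E) f = embed g"
    by (rule bounded_off_small_set)
  have "mu E < d"
  proof (rule ccontr)
    assume "\<not> mu E < d"
    then have "(norm f + 1) / d * d \<le> (norm f + 1) / d * mu E"
      using d by (intro mult_left_mono) auto
    with E(2) d norm_cut_le[of E f] show False by simp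
  qed
  moreover have "f - embed g = cut_L1 E f" using split_compl_L1[OF E(1), of f] E(3) by (simp add: algebra_simps)
  ultimately show ?thesis using d(2)[OF E(1)] that[of g] by simp
qed

lemma embed_chi_sum: "embed (\<Sum>y\<in>Y. scale_Linf y (chi_Linf (E y))) = (\<Sum>y\<in>Y. scale_L1 y (chi_L1 (E y)))"
proof (induction Y rule: infinite_finite_induct)
  case empty
  show ?case using embed_scaleR[of 0 0] by simp
next
  case (infinite Y)
  then show ?case using embed_scaleR[of 0 0] by simp
qed (simp add: embed_add embed_scale chi_L1_def)

lemma embed_diff: "embed (f - g) = embed f - embed g"
  using embed_add[of "f - g" g] by simp

lemma L1_simple_dense:
  fixes f :: "'k::{scalar, euclidean_space} L1"
  assumes "e > 0"
  obtains Y E where "finite Y" "\<And>y. y \<in> Y \<Longrightarrow> E y \<in> sets leb01" "disjoint_family_on E Y"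
    "norm (f - (\<Sum>y\<in>Y. scale_L1 y (chi_L1 (E y)))) < e"
proof -
  obtain g where g: "norm (f - embed g) < e / 2" using assms embed_dense[of "e/2" f] by auto
  obtain Y E where YE: "finite Y" "\<And>y. y \<in> Y \<Longrightarrow> E y \<in> sets leb01" "disjoint_family_on E Y"
    "norm (g - (\<Sum>y\<in>Y. scale_Linf y (chi_Linf (E y)))) \<le> e / 2"
    using Linf_simple_dense[of "e/2" g] assms by auto
  have "norm (embed g - (\<Sum>y\<in>Y. scale_L1 y (chi_L1 (E y)))) \<le> e / 2"
    using order_trans[OF norm_embed YE(4)] by (simp add: embed_diff embed_chi_sum)
  then have "norm (f - (\<Sum>y\<in>Y. scale_L1 y (chi_L1 (E y)))) < e"
    using norm_triangle_ineq[of "f - embed g" "embed g - (\<Sum>y\<in>Y. scale_L1 y (chi_L1 (E y)))"] g by simp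
  then show ?thesis using that YE by blast
qed

text \<open>The unit ball of \<open>L\<^sub>1\<close> is the closed convex hull of the normalised indicators times scalars of modulus
  at most \<open>1\<close>.\<close>
lemma L1_operator_bound:
  fixes V :: "'k::{scalar, euclidean_space} L1 \<Rightarrow> 'k L1"
  assumes V: "bounded_linear V" "\<And>c f. V (scale_L1 c f) = scale_L1 c (V f)"
    and le: "\<And>E. E \<in> sets leb01 \<Longrightarrow> norm (V (chi_L1 E)) \<le> \<kappa> * mu E" and \<kappa>: "0 \<le> \<kappa>"
  shows "norm (V f) \<le> \<kappa> * norm f"
proof -
  interpret V: bounded_linear V by fact
  obtain K where K: "K > 0" "\<And>f. norm (V f) \<le> norm f * K" using V.pos_bounded by blast
  have "norm (V f) \<le> \<kappa> * norm f + e" if e: "e > 0" for e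
  proof -
    define d where "d = e / (\<kappa> + K)"
    have d: "d > 0" using e K \<kappa> by (simp add: d_def)
    then obtain Y E where YE: "finite Y" "\<And>y. y \<in> Y \<Longrightarrow> E y \<in> sets leb01" "disjoint_family_on E Y"
      and near: "norm (f - (\<Sum>y\<in>Y. scale_L1 y (chi_L1 (E y)))) < d"
      using L1_simple_dense[of d f] by blast
    define s where "s = (\<Sum>y\<in>Y. scale_L1 y (chi_L1 (E y)))"
    have "s = (\<Sum>y\<in>Y. cut_L1 (E y) (scale_L1 y (chi_L1 (E y))))"
      unfolding s_def using YE by (intro sum.cong) (auto simp: cut_scale cut_chi)
    then have "norm s = (\<Sum>y\<in>Y. norm (cut_L1 (E y) (scale_L1 y (chi_L1 (E y)))))"
      using norm_cut_sum[OF YE(1-3), of "\<lambda>y. scale_L1 y (chi_L1 (E y))"] by simp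
    also have "\<dots> = (\<Sum>y\<in>Y. norm y * mu (E y))"
      using YE by (intro sum.cong) (auto simp: cut_scale cut_chi norm_scale_L1 norm_chi)
    finally have ns: "norm s = (\<Sum>y\<in>Y. norm y * mu (E y))" .
    have "norm (V s) \<le> (\<Sum>y\<in>Y. norm (V (scale_L1 y (chi_L1 (E y)))))"
      unfolding s_def by (simp add: V.sum norm_sum)
    also have "\<dots> \<le> (\<Sum>y\<in>Y. norm y * (\<kappa> * mu (E y)))"
      unfolding V(2) norm_scale_L1 using YE le by (intro sum_mono mult_left_mono) auto
    also have "\<dots> = \<kappa> * norm s" by (simp add: ns sum_distrib_left mult.left_commute)
    finally have Vs: "norm (V s) \<le> \<kappa> * norm s" .
    have "norm (V f) \<le> norm (V (f - s)) + norm (V s)"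
      using norm_triangle_ineq[of "V (f - s)" "V s"] by (simp add: V.diff)
    also have "\<dots> \<le> d * K + \<kappa> * (norm f + d)"
    proof (rule add_mono)
      have fs: "norm (f - s) \<le> d" using near by (simp add: s_def)
      then show "norm (V (f - s)) \<le> d * K"
        using K by (meson mult_right_mono less_imp_le order_trans)
      have "norm s \<le> norm f + d" using norm_triangle_ineq2[of s f] fs by (simp add: norm_minus_commute)
      then show "norm (V s) \<le> \<kappa> * (norm f + d)"
        using Vs \<kappa> by (meson mult_left_mono order_trans)
    qed
    also have "\<dots> = \<kappa> * norm f + d * (\<kappa> + K)" by (simp add: algebra_simps)
    also have "\<dots> = \<kappa> * norm f + e" using K \<kappa> by (simp add: d_def)
    finally show ?thesis .
  qed
  then show ?thesis by (rule field_le_epsilon)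
qed

section \<open>The absolutely continuous part of a functional\<close>

definition functional :: "('k::scalar Linf \<Rightarrow> 'k) \<Rightarrow> bool"
  where "functional \<phi> \<longleftrightarrow> bounded_linear \<phi> \<and> (\<forall>c g. \<phi> (scale_Linf c g) = c * \<phi> g)"

lemma bounded_linear_cut_Linf: "bounded_linear (cut_Linf A)"
proof (rule bounded_linear_intro[where K = 1])
  show "cut_Linf A (r *\<^sub>R g) = r *\<^sub>R cut_Linf A g" for r g
    using cut_Linf_scale[of A "of_real r" g] by (simp add: scale_Linf_of_real)
qed (simp_all add: cut_Linf_add norm_cut_Linf_le)

lemma functional_pairing: "functional (pairing h)"
  by (auto simp: functional_def pairing.bounded_linear_right pairing_scale_right)

lemma functional_compose:
  assumes "functional \<phi>" "bounded_linear T" "\<And>c g. T (scale_Linf c g) = scale_Linf c (T g)"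
  shows "functional (\<lambda>g. \<phi> (T g))"
  using assms bounded_linear_compose by (auto simp: functional_def)

lemma functional_cut_Linf: "functional \<phi> \<Longrightarrow> functional (\<lambda>g. \<phi> (cut_Linf A g))"
  by (rule functional_compose) (auto simp: bounded_linear_cut_Linf cut_Linf_scale)

lemma functional_diff: "functional \<phi> \<Longrightarrow> functional \<psi> \<Longrightarrow> functional (\<lambda>g. \<phi> g - \<psi> g)"
  by (auto simp: functional_def right_diff_distrib bounded_linear_sub)

lemma functional_eqI:
  fixes \<phi> :: "'k::{scalar, euclidean_space} Linf \<Rightarrow> 'k"
  assumes \<phi>: "functional \<phi>" and \<psi>: "functional \<psi>"
    and eq: "\<And>E. E \<in> sets leb01 \<Longrightarrow> \<phi> (chi_Linf E) = \<psi> (chi_Linf E)"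
  shows "\<phi> g = \<psi> g"
proof -
  define \<eta> where "\<eta> g = \<phi> g - \<psi> g" for g
  have \<eta>: "functional \<eta>" unfolding \<eta>_def using \<phi> \<psi> by (rule functional_diff)
  then interpret bounded_linear \<eta> by (simp add: functional_def)
  obtain K where K: "K > 0" "\<And>g. norm (\<eta> g) \<le> norm g * K" using pos_bounded by blast
  have "norm (\<eta> g) \<le> 0 + e" if e: "e > 0" for e
  proof -
    have "e / K > 0" using e K by simp
    then obtain Y E where YE: "\<And>y. y \<in> Y \<Longrightarrow> E y \<in> sets leb01"
      "norm (g - (\<Sum>y\<in>Y. scale_Linf y (chi_Linf (E y)))) \<le> e / K"
      using Linf_simple_dense[of "e / K" g] by metis
    have "\<eta> (\<Sum>y\<in>Y. scale_Linf y (chi_Linf (E y))) = (\<Sum>y\<in>Y. y * \<eta> (chi_Linf (E y)))"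
      using \<eta> by (simp add: sum functional_def)
    also have "\<dots> = 0" using YE eq by (simp add: \<eta>_def)
    finally have "norm (\<eta> g) = norm (\<eta> (g - (\<Sum>y\<in>Y. scale_Linf y (chi_Linf (E y)))))" by (simp add: diff)
    also have "\<dots> \<le> e / K * K" using K YE(2) by (meson mult_right_mono less_imp_le order_trans)
    finally show ?thesis using K by simp
  qed
  then have "norm (\<eta> g) \<le> 0" by (rule field_le_epsilon)
  then show ?thesis by (simp add: \<eta>_def)
qed

text \<open>Domination by a multiple of the measure turns finite additivity into countable additivity, so that
  the Radon--Nikodym theorem applies.\<close>
lemma bounded_real_density:
  fixes \<nu> :: "real set \<Rightarrow> real"
  assumes add: "\<And>A B. A \<in> sets leb01 \<Longrightarrow> B \<in> sets leb01 \<Longrightarrow> A \<inter> B = {} \<Longrightarrow> \<nu> (A \<union> B) = \<nu> A + \<nu> B"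
    and nonneg: "\<And>A. A \<in> sets leb01 \<Longrightarrow> 0 \<le> \<nu> A" and le: "\<And>A. A \<in> sets leb01 \<Longrightarrow> \<nu> A \<le> C * mu A"
  obtains D where "integrable leb01 D" "\<And>A. A \<in> sets leb01 \<Longrightarrow> (\<integral>x. indicator A x * D x \<partial>leb01) = \<nu> A"
proof -
  define N where "N = measure_of (space leb01) (sets leb01) (\<lambda>A. ennreal (\<nu> A))"
  have sN: "sets N = sets leb01" unfolding N_def by (rule sets.sets_measure_of_eq)
  have spN: "space N = space leb01" unfolding N_def by (simp add: space_measure_of_conv)
  have empty: "\<nu> {} = 0" using add[of "{}" "{}"] by simp
  have pos: "positive (sets leb01) (\<lambda>A. ennreal (\<nu> A))" by (simp add: positive_def empty)
  have ca: "countably_additive (sets leb01) (\<lambda>A. ennreal (\<nu> A))"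
  proof (rule sets.empty_continuous_imp_countably_additive)
    show "positive (sets leb01) (\<lambda>A. ennreal (\<nu> A))" by (fact pos)
    show "additive (sets leb01) (\<lambda>A. ennreal (\<nu> A))"
      by (auto simp: additive_def add nonneg)
    fix A :: "nat \<Rightarrow> real set" assume A: "range A \<subseteq> sets leb01" "decseq A" "(\<Inter>i. A i) = {}"
    have "(\<lambda>i. mu (A i)) \<longlonglongrightarrow> mu (\<Inter>i. A i)"
      by (rule leb01.finite_Lim_measure_decseq) (use A in auto)
    then have "(\<lambda>i. C * mu (A i)) \<longlonglongrightarrow> 0" using A(3) tendsto_mult_left[of _ 0 _ C] by fastforce
    then have "(\<lambda>i. \<nu> (A i)) \<longlonglongrightarrow> 0"
    proof (rule tendsto_sandwich[rotated 3])
      show "\<forall>\<^sub>F n in sequentially. \<nu> (A n) \<le> C * mu (A n)" "\<forall>\<^sub>F n in sequentially. 0 \<le> \<nu> (A n)"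
        using A nonneg le by (auto intro!: always_eventually)
    qed simp
    then have "(\<lambda>i. ennreal (\<nu> (A i))) \<longlonglongrightarrow> ennreal 0" by (rule tendsto_ennrealI)
    then show "(\<lambda>i. ennreal (\<nu> (A i))) \<longlonglongrightarrow> 0" by simp
  qed simp
  have eN: "emeasure N A = ennreal (\<nu> A)" if "A \<in> sets leb01" for A
    unfolding N_def using that pos ca by (intro emeasure_measure_of_sigma sets.sigma_algebra_axioms)
  have fin: "finite_measure N"
    by (rule finite_measureI) (simp add: spN eN[of "{0<..<1}", simplified])
  have ac: "absolutely_continuous leb01 N"
    unfolding absolutely_continuous_def
  proof
    fix A assume "A \<in> null_sets leb01"
    then have A: "A \<in> sets leb01" "mu A = 0" by (auto simp: null_sets_def measure_def)
    then have "\<nu> A = 0" using nonneg[of A] le[of A] by simp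
    then show "A \<in> null_sets N" using A sN eN by (auto simp: null_sets_def)
  qed
  define D where "D x = enn2real (RN_deriv leb01 N x)" for x
  have "AE x in leb01. RN_deriv leb01 N x \<noteq> \<infinity>"
    using fin by (intro leb01.RN_deriv_finite ac sN) (simp add: finite_measure_def)
  then have D: "D \<in> borel_measurable leb01" "AE x in leb01. RN_deriv leb01 N x = ennreal (D x)" "0 \<le> D x" for x
    unfolding D_def by (auto elim!: eventually_mono simp: less_top)
  have nn: "(\<integral>\<^sup>+x. ennreal (D x) * indicator A x \<partial>leb01) = ennreal (\<nu> A)" if A: "A \<in> sets leb01" for A
  proof -
    have "ennreal (\<nu> A) = emeasure (density leb01 (RN_deriv leb01 N)) A"
      using leb01.density_RN_deriv[OF ac sN] eN[OF A] by simp
    also have "\<dots> = (\<integral>\<^sup>+x. RN_deriv leb01 N x * indicator A x \<partial>leb01)"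
      using A by (intro emeasure_density) auto
    also have "\<dots> = (\<integral>\<^sup>+x. ennreal (D x) * indicator A x \<partial>leb01)"
      using D(2) by (intro nn_integral_cong_AE) auto
    finally show ?thesis by simp
  qed
  have "(\<integral>\<^sup>+x. ennreal (D x) \<partial>leb01) = (\<integral>\<^sup>+x. ennreal (D x) * indicator {0<..<1} x \<partial>leb01)"
    by (intro nn_integral_cong) (auto simp: indicator_def)
  then have "integrable leb01 D"
    using D nn[of "{0<..<1}"] by (intro integrableI_nonneg) auto
  moreover have "(\<integral>x. indicator A x * D x \<partial>leb01) = \<nu> A" if A: "A \<in> sets leb01" for A
  proof -
    have "(\<integral>x. indicator A x * D x \<partial>leb01) = enn2real (\<integral>\<^sup>+x. ennreal (indicator A x * D x) \<partial>leb01)"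
      using D A by (intro integral_eq_nn_integral) (auto intro!: AE_I2)
    also have "(\<integral>\<^sup>+x. ennreal (indicator A x * D x) \<partial>leb01) = ennreal (\<nu> A)"
      by (subst nn[OF A, symmetric]) (auto intro!: nn_integral_cong simp: indicator_def)
    finally show ?thesis using nonneg[OF A] by simp
  qed
  ultimately show ?thesis using that by blast
qed

text \<open>Apply the real case to each coordinate of \<open>\<nu>\<close>, shifted by \<open>C * mu\<close> to make it nonnegative.\<close>
lemma bounded_density:
  fixes \<nu> :: "real set \<Rightarrow> 'k::{scalar, euclidean_space}"
  assumes add: "\<And>A B. A \<in> sets leb01 \<Longrightarrow> B \<in> sets leb01 \<Longrightarrow> A \<inter> B = {} \<Longrightarrow> \<nu> (A \<union> B) = \<nu> A + \<nu> B"
    and le: "\<And>A. A \<in> sets leb01 \<Longrightarrow> norm (\<nu> A) \<le> C * mu A"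
  shows "\<exists>h. \<forall>A\<in>sets leb01. pairing h (chi_Linf A) = \<nu> A"
proof -
  have "\<exists>D. integrable leb01 D \<and> (\<forall>A\<in>sets leb01. (\<integral>x. indicator A x * D x \<partial>leb01) = \<nu> A \<bullet> b + C * mu A)"
    if b: "b \<in> Basis" for b :: 'k
  proof -
    have nb: "\<bar>\<nu> A \<bullet> b\<bar> \<le> C * mu A" if "A \<in> sets leb01" for A
      using le[OF that] Basis_le_norm[OF b, of "\<nu> A"] by simp
    show ?thesis
    proof (rule bounded_real_density[of "\<lambda>A. \<nu> A \<bullet> b + C * mu A" "2 * C"])
      show "0 \<le> \<nu> A \<bullet> b + C * mu A" "\<nu> A \<bullet> b + C * mu A \<le> 2 * C * mu A" if "A \<in> sets leb01" for A
        using nb[OF that] by auto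
    qed (auto simp: add inner_add_left leb01.finite_measure_Union algebra_simps)
  qed
  then obtain D where D: "\<And>b. b \<in> Basis \<Longrightarrow> integrable leb01 (D b)"
    "\<And>b A. b \<in> Basis \<Longrightarrow> A \<in> sets leb01 \<Longrightarrow> (\<integral>x. indicator A x * D b x \<partial>leb01) = \<nu> A \<bullet> b + C * mu A"
    by metis
  define h where "h x = (\<Sum>b\<in>Basis. (D b x - C) *\<^sub>R (b::'k))" for x
  have h: "integrable leb01 h" unfolding h_def using D by auto
  have "pairing (abs_L1 h) (chi_Linf A) = \<nu> A" if A: "A \<in> sets leb01" for A
  proof -
    have [simp]: "A \<inter> {0<..<1} = A" using sets_leb01D[OF A] by auto
    have 1: "ess_bounded (\<lambda>x. 1::'k)" using ess_norm_le(1)[of "\<lambda>x. 1::'k" 1] by auto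
    have "chi_Linf A = abs_Linf (cutf A (\<lambda>_. 1::'k))"
      unfolding chi_Linf_def one_Linf_def using 1 by (simp add: cut_Linf.abs_eq)
    then have "pairing (abs_L1 h) (chi_Linf A) = (\<integral>x. h x * cutf A (\<lambda>_. 1) x \<partial>leb01)"
      using h 1 by (simp add: pairing.abs_eq ess_bounded_cutf)
    also have "\<dots> = (\<integral>x. (\<Sum>b\<in>Basis. (indicator A x * D b x - C * indicator A x) *\<^sub>R b) \<partial>leb01)"
      using A by (intro Bochner_Integration.integral_cong) (auto simp: h_def cutf_def indicator_def)
    also have "\<dots> = (\<Sum>b\<in>Basis. (\<integral>x. (indicator A x * D b x - C * indicator A x) *\<^sub>R b \<partial>leb01))"
      using A D integrable_mult_indicator[OF A D(1)]
      by (intro Bochner_Integration.integral_sum integrable_scaleR_left Bochner_Integration.integrable_diff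
         integrable_mult_right integrable_real_indicator) (auto simp: leb01.emeasure_eq_measure)
    also have "\<dots> = (\<Sum>b\<in>Basis. (\<nu> A \<bullet> b) *\<^sub>R b)"
    proof (intro sum.cong refl)
      fix b :: 'k assume b: "b \<in> Basis"
      have i1: "integrable leb01 (\<lambda>x. indicator A x * D b x)"
        using integrable_mult_indicator[OF A D(1)[OF b]] by simp
      have i2: "integrable leb01 (\<lambda>x. C * indicator A x)"
        using A by (intro integrable_mult_right integrable_real_indicator) (auto simp: leb01.emeasure_eq_measure)
      have "(\<integral>x. (indicator A x * D b x - C * indicator A x) *\<^sub>R b \<partial>leb01)
        = (\<integral>x. indicator A x * D b x - C * indicator A x \<partial>leb01) *\<^sub>R b"
        using i1 i2 by (intro integral_scaleR_left) auto
      also have "(\<integral>x. indicator A x * D b x - C * indicator A x \<partial>leb01) = \<nu> A \<bullet> b"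
        using i1 i2 D(2)[OF b A] by (simp add: Bochner_Integration.integral_diff)
      finally show "(\<integral>x. (indicator A x * D b x - C * indicator A x) *\<^sub>R b \<partial>leb01) = (\<nu> A \<bullet> b) *\<^sub>R b" .
    qed
    also have "\<dots> = \<nu> A" by (rule euclidean_representation)
    finally show ?thesis .
  qed
  then show ?thesis by blast
qed

definition re :: "'k::{scalar, euclidean_space} \<Rightarrow> real" where "re x = 1 \<bullet> x"

lemma re_le_norm: "\<bar>re x\<bar> \<le> norm x"
  unfolding re_def using Cauchy_Schwarz_ineq2[of 1 x] by simp

lemma re_of_real: "re (of_real r :: 'k::{scalar, euclidean_space}) = r"
proof -
  have "(1::'k) \<bullet> 1 = 1" by (simp add: dot_square_norm)
  then show ?thesis by (simp add: re_def of_real_def)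
qed

lemma bounded_linear_re: "bounded_linear re"
  unfolding re_def by (rule bounded_linear_inner_right)

lemma re_zero: "re 0 = 0"
  and re_add: "re (x + y) = re x + re y"
  and re_diff: "re (x - y) = re x - re y"
  and re_scaleR: "re (r *\<^sub>R x) = r * re x"
  and re_sum: "re (\<Sum>i\<in>I. f i) = (\<Sum>i\<in>I. re (f i))"
  by (simp_all add: re_def inner_add_right inner_diff_right inner_sum_right)

text \<open>Used to bound norms by bounds on \<open>re\<close> over sets that are invariant under multiplication by scalars of
  modulus at most \<open>1\<close>.\<close>
lemma rotate:
  fixes x :: "'k::{scalar, euclidean_space}"
  obtains u where "norm u \<le> 1" "u * x = of_real (norm x)"
  by (cases "x = 0") (auto simp: norm_mult norm_inverse intro: that[of 0] that[of "of_real (norm x) * inverse x"])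

lemma functional_bound:
  assumes "functional \<phi>"
  obtains c where "0 < c" "\<And>g. norm (\<phi> g) \<le> c * norm g"
  using assms bounded_linear.pos_bounded[of \<phi>] unfolding functional_def by (metis mult.commute)

lemma functional_sum: "functional \<phi> \<Longrightarrow> \<phi> (\<Sum>i\<in>I. f i) = (\<Sum>i\<in>I. \<phi> (f i))"
  using linear_sum[of \<phi> f I] by (simp add: functional_def bounded_linear.linear)

lemma functional_addD: "functional \<phi> \<Longrightarrow> \<phi> (f + g) = \<phi> f + \<phi> g"
  using linear_add[of \<phi> f g] by (simp add: functional_def bounded_linear.linear)

lemma functional_scaleD: "functional \<phi> \<Longrightarrow> \<phi> (scale_Linf c g) = c * \<phi> g"
  by (simp add: functional_def)

lemma functional_zeroD: "functional \<phi> \<Longrightarrow> \<phi> 0 = 0"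
  using linear_0[of \<phi>] by (simp add: functional_def bounded_linear.linear)

text \<open>Exhaust the interval by disjoint sets on which \<open>\<phi>\<close> exceeds \<open>K\<close> times the measure.  The functions that
  witness this have disjoint supports, so their sums have norm at most \<open>1\<close>, while \<open>\<phi>\<close> adds up over them;
  hence the union \<open>A\<close> is small.  Nothing of positive measure off \<open>A\<close> has this property.\<close>
lemma dominated_off_small_set:
  fixes \<phi> :: "'k::{scalar, euclidean_space} Linf \<Rightarrow> 'k"
  assumes \<phi>: "functional \<phi>" and c: "\<And>g. norm (\<phi> g) \<le> c * norm g" and c0: "0 \<le> c" and K: "K > 0"
  obtains A where "A \<in> sets leb01" "K * mu A \<le> c"
    "\<And>E g. E \<in> sets leb01 \<Longrightarrow> E \<subseteq> compl A \<Longrightarrow> norm g \<le> 1 \<Longrightarrow> re (\<phi> (cut_Linf E g)) \<le> K * mu E"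
proof -
  define P where "P B \<longleftrightarrow> (\<exists>g. norm g \<le> 1 \<and> K * mu B < re (\<phi> (cut_Linf B g)))" for B
  from leb01.exhaustion[of P] obtain D :: "nat \<Rightarrow> real set"
    where D': "(\<forall>n. D n \<in> sets leb01 \<and> (D n = {} \<or> P (D n))) \<and> disjoint_family D \<and>
      (\<forall>E\<in>sets leb01. P E \<longrightarrow> E \<inter> (\<Union>n. D n) = {} \<longrightarrow> mu E = 0)" ..
  then have D: "\<And>n. D n \<in> sets leb01" "\<And>n. D n = {} \<or> P (D n)" "disjoint_family D"
    "\<And>E. E \<in> sets leb01 \<Longrightarrow> P E \<Longrightarrow> E \<inter> (\<Union>n. D n) = {} \<Longrightarrow> mu E = 0"
    by simp_all
  have "\<exists>g. norm g \<le> 1 \<and> K * mu (D n) \<le> re (\<phi> (cut_Linf (D n) g))" for n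
    using D(2)[of n]
  proof
    assume "D n = {}"
    then show ?thesis using functional_zeroD[OF \<phi>] by (intro exI[of _ 0]) (simp add: re_zero)
  qed (auto simp: P_def intro: less_imp_le)
  then obtain g where g: "\<And>n. norm (g n) \<le> 1" "\<And>n. K * mu (D n) \<le> re (\<phi> (cut_Linf (D n) (g n)))" by metis
  have part: "(\<Sum>n<N. K * mu (D n)) \<le> c" for N
  proof -
    have "(\<Sum>n<N. K * mu (D n)) \<le> re (\<phi> (\<Sum>n<N. cut_Linf (D n) (g n)))"
      by (simp add: functional_sum[OF \<phi>] re_sum sum_mono g)
    also have "\<dots> \<le> norm (\<phi> (\<Sum>n<N. cut_Linf (D n) (g n)))" using re_le_norm abs_le_D1 by blast
    also have "\<dots> \<le> c * norm (\<Sum>n<N. cut_Linf (D n) (g n))" by (rule c)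
    also have "\<dots> \<le> c * 1"
      using D g by (intro mult_left_mono c0 norm_cut_Linf_sum_le) (auto simp: disjoint_family_on_def)
    finally show ?thesis by simp
  qed
  define A where "A = (\<Union>n. D n)"
  have "(\<lambda>n. mu (D n)) sums mu A"
    unfolding A_def using D by (intro leb01.finite_measure_UNION) auto
  then have "(\<lambda>N. \<Sum>n<N. K * mu (D n)) \<longlonglongrightarrow> K * mu A"
    unfolding sums_def sum_distrib_left[symmetric] by (rule tendsto_mult_left)
  then have "K * mu A \<le> c" by (rule LIMSEQ_le_const2) (use part in auto)
  moreover have "re (\<phi> (cut_Linf E g)) \<le> K * mu E" if E: "E \<in> sets leb01" "E \<subseteq> compl A" "norm g \<le> 1" for E g
  proof (rule ccontr)
    assume not: "\<not> ?thesis"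
    then have "mu E = 0" using E by (intro D(4)) (auto simp: P_def A_def not_le)
    then show False using not cut_Linf_null[OF E(1), of g] functional_zeroD[OF \<phi>] by (simp add: re_zero)
  qed
  ultimately show ?thesis using that[of A] D(1) by (auto simp: A_def)
qed

lemma dominated_density:
  fixes \<phi> :: "'k::{scalar, euclidean_space} Linf \<Rightarrow> 'k"
  assumes \<phi>: "functional \<phi>" and A: "A \<in> sets leb01"
    and le: "\<And>E g. E \<in> sets leb01 \<Longrightarrow> E \<subseteq> A \<Longrightarrow> norm g \<le> 1 \<Longrightarrow> re (\<phi> (cut_Linf E g)) \<le> K * mu E"
    and K: "K > 0"
  obtains h where "\<And>g. \<phi> (cut_Linf A g) = pairing h (cut_Linf A g)"
proof -
  have n: "norm (\<phi> (chi_Linf (A \<inter> E))) \<le> K * mu E" if E: "E \<in> sets leb01" for E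
  proof -
    obtain u where u: "norm u \<le> 1" "u * \<phi> (chi_Linf (A \<inter> E)) = of_real (norm (\<phi> (chi_Linf (A \<inter> E))))" by (rule rotate)
    have "norm (scale_Linf u one_Linf) \<le> 1"
      using mult_mono[OF u(1) norm_one_Linf] by (intro order_trans[OF norm_scale_Linf_le]) simp
    then have "re (\<phi> (cut_Linf (A \<inter> E) (scale_Linf u one_Linf))) \<le> K * mu (A \<inter> E)"
      using A E by (intro le) auto
    then have "norm (\<phi> (chi_Linf (A \<inter> E))) \<le> K * mu (A \<inter> E)"
      using u(2) by (simp add: cut_Linf_scale functional_scaleD[OF \<phi>] re_of_real flip: chi_Linf_def)
    also have "\<dots> \<le> K * mu E" using K E by (intro mult_left_mono mu_mono) auto
    finally show ?thesis .
  qed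
  have add: "\<phi> (chi_Linf (A \<inter> (E \<union> F))) = \<phi> (chi_Linf (A \<inter> E)) + \<phi> (chi_Linf (A \<inter> F))"
    if "E \<in> sets leb01" "F \<in> sets leb01" "E \<inter> F = {}" for E F
  proof -
    have "chi_Linf (A \<inter> (E \<union> F)) = (chi_Linf (A \<inter> E) + chi_Linf (A \<inter> F) :: 'k Linf)"
      unfolding chi_Linf_def Int_Un_distrib using that A by (intro cut_Linf_Un) auto
    then show ?thesis by (simp add: functional_addD[OF \<phi>])
  qed
  from bounded_density[of "\<lambda>E. \<phi> (chi_Linf (A \<inter> E))", OF add n]
  obtain h where h: "\<forall>E\<in>sets leb01. pairing h (chi_Linf E) = \<phi> (chi_Linf (A \<inter> E))" ..
  have eq: "\<phi> (cut_Linf A g) = pairing h g" for g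
  proof (rule functional_eqI[of "\<lambda>g. \<phi> (cut_Linf A g)"])
    show "\<phi> (cut_Linf A (chi_Linf E)) = pairing h (chi_Linf E)" if "E \<in> sets leb01" for E
      using A that h by (simp add: cut_Linf_chi_Linf)
  qed (intro functional_cut_Linf functional_pairing \<phi>)+
  have "\<phi> (cut_Linf A g) = pairing h (cut_Linf A g)" for g
    using eq[of "cut_Linf A g"] A by (simp add: cut_Linf_cut_Linf)
  then show ?thesis using that by blast
qed

text \<open>The function \<open>h\<close> is the density of the absolutely continuous part of the finitely additive measure
  \<open>A \<mapsto> \<phi> (chi_Linf A)\<close>: the remaining, purely finitely additive part lives on sets of arbitrarily small
  measure.\<close>
definition ac_part :: "('k::scalar Linf \<Rightarrow> 'k) \<Rightarrow> 'k L1 \<Rightarrow> bool"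
  where "ac_part \<phi> h \<longleftrightarrow> (\<forall>e>0. \<exists>A\<in>sets leb01. mu A < e \<and>
    (\<forall>g. \<phi> (cut_Linf (compl A) g) = pairing h (cut_Linf (compl A) g)))"

text \<open>Exhaust the interval by disjoint sets \<open>D n\<close> on which \<open>\<phi>\<close> has a density.  The remainder is a null set,
  since by \<open>dominated_off_small_set\<close> every set of positive measure contains a piece of positive measure
  on which \<open>\<phi>\<close> is dominated by the measure.  The densities add up to an integrable function because the
  partial sums represent restrictions of \<open>\<phi>\<close> and are therefore bounded in norm by \<open>c\<close>.\<close>
theorem ac_part_exists:
  fixes \<phi> :: "'k::{scalar, euclidean_space} Linf \<Rightarrow> 'k"
  assumes \<phi>: "functional \<phi>"
  shows "\<exists>h. ac_part \<phi> h"
proof -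
  obtain c where c: "c > 0" "\<And>g. norm (\<phi> g) \<le> c * norm g" using functional_bound[OF \<phi>] by blast
  define P where "P D \<longleftrightarrow> D \<in> sets leb01 \<and> (\<exists>h. \<forall>g. \<phi> (cut_Linf D g) = pairing h (cut_Linf D g))" for D
  from leb01.exhaustion[of P] obtain D :: "nat \<Rightarrow> real set"
    where D': "(\<forall>n. D n \<in> sets leb01 \<and> (D n = {} \<or> P (D n))) \<and> disjoint_family D \<and>
      (\<forall>E\<in>sets leb01. P E \<longrightarrow> E \<inter> (\<Union>n. D n) = {} \<longrightarrow> mu E = 0)" ..
  then have D: "\<And>n. D n \<in> sets leb01" "\<And>n. D n = {} \<or> P (D n)" "disjoint_family D"
    "\<And>E. E \<in> sets leb01 \<Longrightarrow> P E \<Longrightarrow> E \<inter> (\<Union>n. D n) = {} \<Longrightarrow> mu E = 0"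
    by simp_all
  have "\<exists>h. \<forall>g. \<phi> (cut_Linf (D n) g) = pairing h (cut_Linf (D n) g)" for n
    using D(2)[of n] functional_zeroD[OF \<phi>] by (auto simp: P_def pairing.zero_right)
  then obtain h where h: "\<And>n g. \<phi> (cut_Linf (D n) g) = pairing (h n) (cut_Linf (D n) g)" by metis
  have UD: "(\<Union>n. D n) \<in> sets leb01" using D(1) by auto
  define R where "R = compl (\<Union>n. D n)"
  have R: "R \<in> sets leb01" unfolding R_def using UD by simp
  have R0: "mu R = 0"
  proof (rule ccontr)
    assume "mu R \<noteq> 0"
    then have pos: "mu R > 0" by (simp add: less_le)
    \<comment> \<open>This makes the exceptional set at most half as large as \<open>R\<close>.\<close>
    define K where "K = 2 * c / mu R"
    have K: "K > 0" using c pos by (simp add: K_def)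
    obtain A where A: "A \<in> sets leb01" "K * mu A \<le> c"
      "\<And>E g. E \<in> sets leb01 \<Longrightarrow> E \<subseteq> compl A \<Longrightarrow> norm g \<le> 1 \<Longrightarrow> re (\<phi> (cut_Linf E g)) \<le> K * mu E"
      using dominated_off_small_set[OF \<phi> c(2) less_imp_le[OF c(1)] K] by metis
    have RA: "R - A \<in> sets leb01" "R - A \<subseteq> compl A" using R A sets_leb01D[OF R] by auto
    then have "P (R - A)"
      using dominated_density[OF \<phi> RA(1) _ K] A(3) unfolding P_def by (metis order_trans)
    then have "mu (R - A) = 0" using RA by (intro D(4)) (auto simp: R_def)
    moreover have "mu R \<le> mu (R - A) + mu A"
      using R A measure_Un_le[of "R - A" leb01 A] mu_mono[of R "(R - A) \<union> A"] by auto
    moreover have "mu A \<le> mu R / 2" using A(2) c pos by (simp add: K_def field_simps)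
    ultimately show False using pos by simp
  qed
  define F where "F N = (\<Sum>n<N. cut_L1 (D n) (h n))" for N
  define U where "U N = (\<Union>n<N. D n)" for N
  have U: "U N \<in> sets leb01" for N unfolding U_def using D(1) by auto
  have FU: "pairing (F N) g = \<phi> (cut_Linf (U N) g)" for N g
  proof -
    have "cut_Linf (U N) g = (\<Sum>n<N. cut_Linf (D n) g)"
      unfolding U_def using D by (intro cut_Linf_UN) (auto simp: disjoint_family_on_def)
    then show ?thesis by (simp add: F_def functional_sum[OF \<phi>] pairing.sum_left pairing_cut h)
  qed
  have nF: "norm (F N) \<le> c" for N
  proof (rule norm_L1_le_pairing)
    fix g :: "'k Linf" assume "norm g \<le> 1"
    then have "c * norm (cut_Linf (U N) g) \<le> c * 1" using c norm_cut_Linf_le[of "U N" g] by (intro mult_left_mono) auto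
    then show "norm (pairing (F N) g) \<le> c" using c(2)[of "cut_Linf (U N) g"] by (simp add: FU)
  qed
  have "norm (F N) = (\<Sum>n<N. norm (cut_L1 (D n) (h n)))" for N
    unfolding F_def using D by (intro norm_cut_sum) (auto simp: disjoint_family_on_def)
  with nF have "(\<Sum>n<N. norm (cut_L1 (D n) (h n))) \<le> c" for N by metis
  then have "summable (\<lambda>n. norm (cut_L1 (D n) (h n)))"
    by (intro summableI_nonneg_bounded[of _ c]) auto
  then have "summable (\<lambda>n. cut_L1 (D n) (h n))" by (rule summable_norm_cancel)
  then obtain H where H: "F \<longlonglongrightarrow> H" unfolding F_def summable_def sums_def by blast
  have cutH: "cut_L1 (U N) H = F N" for N
  proof -
    have "(\<lambda>M. cut_L1 (U N) (F M)) \<longlonglongrightarrow> cut_L1 (U N) H"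
      by (rule bounded_linear.tendsto[OF bounded_linear_cut H])
    moreover have "cut_L1 (U N) (F M) = F N" if "M \<ge> N" for M
    proof -
      have "cut_L1 (U N) (F M) = (\<Sum>n<M. if n < N then cut_L1 (D n) (h n) else 0)"
        unfolding F_def bounded_linear.linear[OF bounded_linear_cut, THEN linear_sum]
      proof (intro sum.cong refl)
        fix n
        have "U N \<inter> D n = (if n < N then D n else {})"
          using partial_union_disjoint[OF D(3), of N n] unfolding U_def by (cases "n < N") auto
        then show "cut_L1 (U N) (cut_L1 (D n) (h n)) = (if n < N then cut_L1 (D n) (h n) else 0)"
          using U D by (simp add: cut_cut)
      qed
      also have "\<dots> = F N"
        using that unfolding F_def by (subst sum.If_cases) (auto intro!: sum.cong)
      finally show ?thesis .
    qed
    then have "(\<lambda>M. cut_L1 (U N) (F M)) \<longlonglongrightarrow> F N"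
      by (intro tendsto_eventually) (auto simp: eventually_sequentially)
    ultimately show ?thesis by (rule LIMSEQ_unique)
  qed
  have "\<exists>A\<in>sets leb01. mu A < e \<and> (\<forall>g. \<phi> (cut_Linf (compl A) g) = pairing H (cut_Linf (compl A) g))" if e: "e > 0" for e
  proof -
    have "(\<lambda>N. mu (U N)) \<longlonglongrightarrow> mu (\<Union>n. D n)"
      unfolding U_def by (rule mu_partial_unions[OF D(1)])
    moreover have "mu (\<Union>n. D n) = 1"
      using leb01.prob_compl[OF UD] R0 by (simp add: R_def)
    ultimately have "eventually (\<lambda>N. mu (U N) > 1 - e) sequentially"
      using e by (intro order_tendstoD) auto
    then obtain N where N: "mu (U N) > 1 - e" by (auto simp: eventually_sequentially)
    have "mu (compl (U N)) < e" using leb01.prob_compl[OF U[of N]] N by simp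
    moreover have "compl (compl (U N)) = U N" using sets_leb01D[OF U[of N]] by auto
    moreover have "\<phi> (cut_Linf (U N) g) = pairing H (cut_Linf (U N) g)" for g
      using FU[of N g] cutH[of N] by (simp add: pairing_cut[symmetric])
    ultimately show ?thesis using U by (intro bexI[of _ "compl (U N)"]) auto
  qed
  then show ?thesis unfolding ac_part_def by blast
qed

lemma ac_part_pairing: "ac_part (pairing z) z"
  unfolding ac_part_def by (auto intro!: bexI[of _ "{}"])

lemma ac_part_mono:
  assumes eq: "\<And>g. \<phi> (cut_Linf (compl A) g) = pairing h (cut_Linf (compl A) g)"
    and AB: "A \<in> sets leb01" "B \<in> sets leb01" "A \<subseteq> B"
  shows "\<phi> (cut_Linf (compl B) g) = pairing h (cut_Linf (compl B) g)"
proof -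
  have "cut_Linf (compl A) (cut_Linf (compl B) g) = cut_Linf (compl B) g"
    using AB by (subst cut_Linf_cut_Linf) (auto intro!: arg_cong2[where f = cut_Linf])
  then show ?thesis using eq[of "cut_Linf (compl B) g"] by simp
qed

lemma ac_part_add:
  assumes "ac_part \<phi> h" "ac_part \<psi> k"
  shows "ac_part (\<lambda>g. \<phi> g + \<psi> g) (h + k)"
  unfolding ac_part_def
proof (intro allI impI)
  fix e :: real assume e: "e > 0"
  obtain A where A: "A \<in> sets leb01" "mu A < e / 2" "\<And>g. \<phi> (cut_Linf (compl A) g) = pairing h (cut_Linf (compl A) g)"
    using assms(1) e unfolding ac_part_def by (meson half_gt_zero)
  obtain B where B: "B \<in> sets leb01" "mu B < e / 2" "\<And>g. \<psi> (cut_Linf (compl B) g) = pairing k (cut_Linf (compl B) g)"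
    using assms(2) e unfolding ac_part_def by (meson half_gt_zero)
  have "mu (A \<union> B) < e" using measure_Un_le[OF A(1) B(1)] A B by simp
  moreover have "\<phi> (cut_Linf (compl (A \<union> B)) g) = pairing h (cut_Linf (compl (A \<union> B)) g)"
    "\<psi> (cut_Linf (compl (A \<union> B)) g) = pairing k (cut_Linf (compl (A \<union> B)) g)" for g
    using ac_part_mono[of \<phi> A h "A \<union> B" g] ac_part_mono[of \<psi> B k "A \<union> B" g] A B by auto
  ultimately show "\<exists>A\<in>sets leb01. mu A < e \<and>
      (\<forall>g. \<phi> (cut_Linf (compl A) g) + \<psi> (cut_Linf (compl A) g) = pairing (h + k) (cut_Linf (compl A) g))"
    using A B by (intro bexI[of _ "A \<union> B"]) (auto simp: pairing.add_left)
qed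

lemma ac_part_scale:
  "ac_part \<phi> h \<Longrightarrow> ac_part (\<lambda>g. c * \<phi> g) (scale_L1 c h)"
  unfolding ac_part_def by (simp add: pairing_scale_left) metis

text \<open>Off a small set \<open>h\<close> represents a restriction of \<open>\<phi>\<close>, and little of its norm is lost on that set.\<close>
lemma ac_part_norm:
  assumes h: "ac_part \<phi> h" and c: "\<And>g. norm (\<phi> g) \<le> c * norm g" and c0: "0 \<le> c"
  shows "norm h \<le> c"
proof (rule field_le_epsilon)
  fix e :: real assume "e > 0"
  then obtain d where d: "d > 0" "\<And>A. A \<in> sets leb01 \<Longrightarrow> mu A < d \<Longrightarrow> norm (cut_L1 A h) < e"
    using cut_small by blast
  obtain A where A: "A \<in> sets leb01" "mu A < d" "\<And>g. \<phi> (cut_Linf (compl A) g) = pairing h (cut_Linf (compl A) g)"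
    using h d(1) unfolding ac_part_def by blast
  have "norm (cut_L1 (compl A) h) \<le> c"
  proof (rule norm_L1_le_pairing)
    fix g :: "'a Linf" assume "norm g \<le> 1"
    then have "c * norm (cut_Linf (compl A) g) \<le> c * 1"
      using c0 norm_cut_Linf_le[of "compl A" g] by (intro mult_left_mono) auto
    then show "norm (pairing (cut_L1 (compl A) h) g) \<le> c" using c[of "cut_Linf (compl A) g"] A(3) by (simp add: pairing_cut)
  qed
  then show "norm h \<le> c + e" using norm_split_compl[OF A(1), of h] d(2)[OF A(1,2)] by simp
qed

lemma ac_part_unique:
  assumes "ac_part \<phi> h" "ac_part \<phi> k"
  shows "h = k"
proof -
  have "ac_part (\<lambda>g. \<phi> g + (-1) * \<phi> g) (h + scale_L1 (-1) k)"
    using assms by (intro ac_part_add ac_part_scale)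
  then have "norm (h + scale_L1 (-1) k) \<le> 0" by (intro ac_part_norm) auto
  then show ?thesis
    using scale_L1_of_real[of "-1" k] by simp
qed

text \<open>A functional that is small on small sets, uniformly on the unit ball, has no other part than its
  absolutely continuous one.\<close>
lemma ac_part_eq_pairing:
  assumes \<phi>: "functional \<phi>" and h: "ac_part \<phi> h"
    and ac: "\<And>e. e > 0 \<Longrightarrow> \<exists>d>0. \<forall>A\<in>sets leb01. mu A < d \<longrightarrow> (\<forall>g. norm (\<phi> (cut_Linf A g)) \<le> e * norm g)"
  shows "\<phi> g = pairing h g"
proof -
  have "norm (\<phi> g - pairing h g) \<le> 0 + e" if e: "e > 0" for e
  proof -
    define k where "k = e / (norm g + 1)"
    define e' where "e' = k / 2"
    have e': "e' > 0" using e by (simp add: e'_def k_def add_nonneg_pos)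
    obtain d where d: "d > 0" "\<And>A g. A \<in> sets leb01 \<Longrightarrow> mu A < d \<Longrightarrow> norm (\<phi> (cut_Linf A g)) \<le> e' * norm g"
      using ac[OF e'] by blast
    obtain d' where d': "d' > 0" "\<And>A. A \<in> sets leb01 \<Longrightarrow> mu A < d' \<Longrightarrow> norm (cut_L1 A h) < e'"
      using cut_small[OF e'] by blast
    have "min d d' > 0" using d d' by simp
    then obtain A where A: "A \<in> sets leb01" "mu A < min d d'" "\<And>g. \<phi> (cut_Linf (compl A) g) = pairing h (cut_Linf (compl A) g)"
      using h unfolding ac_part_def by blast
    have "\<phi> g - pairing h g = \<phi> (cut_Linf A g) - pairing h (cut_Linf A g)"
      using A functional_addD[OF \<phi>, of "cut_Linf A g" "cut_Linf (compl A) g"]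
        pairing_add_right[of h "cut_Linf A g" "cut_Linf (compl A) g"] by (simp flip: split_compl_Linf[OF A(1)])
    also have "norm \<dots> \<le> norm (\<phi> (cut_Linf A g)) + norm (pairing (cut_L1 A h) g)"
      by (simp add: pairing_cut norm_triangle_ineq4)
    also have "\<dots> \<le> e' * norm g + e' * norm g"
      using d(2)[of A g] d'(2)[of A] A by (intro add_mono order_trans[OF norm_pairing] mult_right_mono) auto
    also have "\<dots> = k * norm g" by (simp add: e'_def)
    also have "\<dots> = e * (norm g / (norm g + 1))" by (simp add: k_def)
    also have "\<dots> \<le> e * 1" using e by (intro mult_left_mono) (auto simp: divide_le_eq_1 add_nonneg_pos)
    finally show ?thesis by simp
  qed
  then have "norm (\<phi> g - pairing h g) \<le> 0" by (rule field_le_epsilon)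
  then show ?thesis by simp
qed

section \<open>Existence of adjoints\<close>

lemma pairing_embed: "pairing (embed u) r = pairing (embed r) u"
  by transfer (simp add: mult.commute)

lemma bounded_linear_embed: "bounded_linear embed"
  by (rule bounded_linear_intro[where K = 1]) (simp_all add: embed_add embed_scaleR norm_embed)

lemma L1_eq_on_embed:
  fixes a b :: "'k::scalar L1 \<Rightarrow> 'b::real_normed_vector"
  assumes a: "bounded_linear a" and b: "bounded_linear b" and eq: "\<And>u. a (embed u) = b (embed u)"
  shows "a f = b f"
proof -
  interpret d: bounded_linear "\<lambda>f. a f - b f" using a b by (rule bounded_linear_sub)
  obtain K where K: "K > 0" "\<And>f. norm (a f - b f) \<le> norm f * K" using d.pos_bounded by blast
  have "norm (a f - b f) \<le> 0 + e" if "e > 0" for e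
  proof -
    obtain u where u: "norm (f - embed u) < e / K" using embed_dense[of "e / K" f] divide_pos_pos[OF \<open>e > 0\<close> K(1)] by blast
    have "norm (a f - b f) = norm (a (f - embed u) - b (f - embed u))"
      using d.diff[of f "embed u"] by (simp add: eq)
    also have "\<dots> \<le> norm (f - embed u) * K" by (rule K)
    also have "\<dots> \<le> e / K * K" using u K by (intro mult_right_mono) auto
    finally show ?thesis using K by simp
  qed
  then have "norm (a f - b f) \<le> 0" by (rule field_le_epsilon)
  then show ?thesis by simp
qed

text \<open>Let \<open>E\<close> be the set where \<open>|h| > K + 1\<close>.  Testing with the phase of \<open>h\<close> on \<open>E\<close> gives
  \<open>(K + 1) mu E \<le> K mu E\<close>, so \<open>E\<close> is a null set.\<close>
lemma bounded_dual_element: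
  fixes h :: "'k::scalar L1"
  assumes le: "\<And>u. norm (pairing h u) \<le> K * norm (embed u :: 'k L1)" and K: "0 \<le> K"
  obtains r where "h = embed r"
proof -
  have "K + 1 > 0" using K by simp
  then obtain E r where E: "E \<in> sets leb01" "(K + 1) * mu E \<le> norm (cut_L1 E h)" "cut_L1 (compl E) h = embed r"
    by (rule bounded_off_small_set)
  let ?u = "cut_Linf E (phase (cut_L1 E h))"
  have "norm (cut_L1 E h) = norm (pairing h ?u)"
    using pairing_phase[of "cut_L1 E h"] by (simp add: pairing_cut)
  also have "\<dots> \<le> K * norm (embed ?u)" by (rule le)
  also have "\<dots> \<le> K * (mu E * 1)"
    unfolding embed_cut using K E
    by (intro mult_left_mono order_trans[OF norm_embed_cut] norm_phase) auto
  finally have "(K + 1) * mu E \<le> K * mu E" using E(2) by simp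
  then have "mu E = 0" using measure_nonneg[of leb01 E] by (simp add: algebra_simps)
  then have "h = embed r" using split_compl_L1[OF E(1), of h] E by (simp add: cut_null)
  then show ?thesis by (rule that)
qed

lemma operatorsD: "T \<in> operators sc \<Longrightarrow> blinfun_apply T (sc c x) = sc c (blinfun_apply T x)"
  by (simp add: operators_def)

text \<open>For fixed \<open>g\<close> the functional \<open>f \<mapsto> pairing (S f) g\<close> restricts to an absolutely continuous functional
  on \<open>L\<^sub>\<infinity>\<close>.  Its density is bounded and is the value of the adjoint at \<open>g\<close>.\<close>
theorem adjoint_exists:
  fixes S :: "'k::{scalar, euclidean_space} L1 \<Rightarrow>\<^sub>L 'k L1"
  assumes S: "S \<in> operators scale_L1"
  shows "\<exists>R \<in> operators scale_Linf. is_adjoint S R"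
proof -
  have "\<exists>r. \<forall>f. pairing (S f) g = pairing f r" for g
  proof -
    define \<phi> where "\<phi> u = pairing (S (embed u)) g" for u
    have "bounded_linear (\<lambda>u. S (embed u))"
      by (rule bounded_linear_compose[OF blinfun.bounded_linear_right bounded_linear_embed])
    then have \<phi>: "functional \<phi>"
      unfolding functional_def \<phi>_def
      by (auto simp: embed_scale operatorsD[OF S] pairing_scale_left
          intro: bounded_linear_compose[OF pairing.bounded_linear_left])
    define K where "K = norm S * norm g"
    have K: "0 \<le> K" by (simp add: K_def)
    have le: "norm (\<phi> u) \<le> K * norm (embed u :: 'k L1)" for u
    proof -
      have "norm (\<phi> u) \<le> norm (S (embed u)) * norm g" unfolding \<phi>_def by (rule norm_pairing)
      also have "\<dots> \<le> (norm S * norm (embed u :: 'k L1)) * norm g" by (intro mult_right_mono norm_blinfun) auto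
      finally show ?thesis by (simp add: K_def mult_ac)
    qed
    obtain h where h: "ac_part \<phi> h" using ac_part_exists[OF \<phi>] by blast
    have \<phi>h: "\<phi> u = pairing h u" for u
    proof (rule ac_part_eq_pairing[OF \<phi> h])
      fix e :: real assume e: "e > 0"
      show "\<exists>d>0. \<forall>A\<in>sets leb01. mu A < d \<longrightarrow> (\<forall>g. norm (\<phi> (cut_Linf A g)) \<le> e * norm g)"
      proof (intro exI[of _ "e / (K + 1)"] conjI ballI impI allI)
        fix A and u :: "'k Linf" assume A: "A \<in> sets leb01" "mu A < e / (K + 1)"
        have "norm (\<phi> (cut_Linf A u)) \<le> K * norm (cut_L1 A (embed u) :: 'k L1)" using le[of "cut_Linf A u"] by (simp add: embed_cut)
        also have "\<dots> \<le> K * (mu A * norm u)" using K A by (intro mult_left_mono norm_embed_cut)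
        also have "\<dots> = (K * mu A) * norm u" by simp
        also have "K * mu A \<le> (K + 1) * mu A" by (intro mult_right_mono) auto
        also have "\<dots> \<le> e" using A(2) K by (simp add: field_simps)
        finally show "norm (\<phi> (cut_Linf A u)) \<le> e * norm u" by (simp add: mult_right_mono)
      qed (use e K in simp)
    qed
    obtain r where r: "h = embed r" by (rule bounded_dual_element[OF _ K]) (use le \<phi>h in auto)
    have "pairing (S f) g = pairing f r" for f
    proof (rule L1_eq_on_embed)
      show "bounded_linear (\<lambda>f. pairing (S f) g)"
        by (rule bounded_linear_compose[OF pairing.bounded_linear_left blinfun.bounded_linear_right])
      show "bounded_linear (\<lambda>f. pairing f r)" by (rule pairing.bounded_linear_left)
      show "pairing (S (embed u)) g = pairing (embed u) r" for u
        using \<phi>h[of u] by (simp add: \<phi>_def r pairing_embed)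
    qed
    then show ?thesis by blast
  qed
  then obtain R where R: "\<And>f g. pairing (S f) g = pairing f (R g)" by metis
  have "bounded_linear R"
  proof (rule bounded_linear_intro)
    show "R (g + h) = R g + R h" for g h
      by (rule Linf_eqI) (simp add: pairing_add_right flip: R)
    show "R (r *\<^sub>R g) = r *\<^sub>R R g" for r g
      by (rule Linf_eqI) (simp add: pairing_scaleR_right flip: R)
    show "norm (R g) \<le> norm g * norm S" for g
    proof (rule norm_Linf_le_pairing)
      fix f
      have "norm (pairing f (R g)) \<le> norm (S f) * norm g"
        by (simp add: norm_pairing flip: R)
      also have "\<dots> \<le> (norm S * norm f) * norm g" by (intro mult_right_mono norm_blinfun) auto
      finally show "norm (pairing f (R g)) \<le> norm g * norm S * norm f" by (simp add: mult_ac)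
    qed simp
  qed
  then have ap: "blinfun_apply (Blinfun R) = R" by (rule bounded_linear_Blinfun_apply)
  have "R (scale_Linf c g) = scale_Linf c (R g)" for c g
    by (rule Linf_eqI) (simp add: pairing_scale_right flip: R)
  then have "Blinfun R \<in> operators scale_Linf" by (simp add: operators_def ap)
  moreover have "is_adjoint S (Blinfun R)" by (simp add: is_adjoint_def ap R)
  ultimately show ?thesis by blast
qed

section \<open>Strictly singular operators on \<open>L\<^sub>1\<close>\<close>

definition equi_integrable :: "'k::scalar L1 set \<Rightarrow> bool"
  where "equi_integrable K \<longleftrightarrow> (\<forall>e>0. \<exists>d>0. \<forall>f\<in>K. \<forall>A\<in>sets leb01. mu A < d \<longrightarrow> norm (cut_L1 A f) \<le> e)"

lemma norm_cut_UN:
  assumes "finite I" "\<And>i. i \<in> I \<Longrightarrow> A i \<in> sets leb01" "disjoint_family_on A I"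
  shows "norm (cut_L1 (\<Union>i\<in>I. A i) f) = (\<Sum>i\<in>I. norm (cut_L1 (A i) f))"
  using norm_cut_sum[OF assms, of "\<lambda>_. f"] cut_UN[OF assms, of f] by simp

text \<open>Restricted to \<open>B j\<close>, the \<open>j\<close>-th term keeps norm at least \<open>p\<close> times the modulus of its coefficient.  Over
  all \<open>j\<close>, the other terms take away at most \<open>q\<close> times the sum of these moduli, because term \<open>k\<close> has
  mass at most \<open>q\<close> times the modulus of its coefficient on the part of \<open>W\<close> off \<open>B k\<close>.\<close>
lemma l1_lower_bound:
  fixes y :: "nat \<Rightarrow> 'k::scalar L1"
  assumes B: "\<And>k. B k \<in> sets leb01" "disjoint_family B" "\<And>k. B k \<subseteq> W" and W: "W \<in> sets leb01"
    and diag: "\<And>k. norm (cut_L1 (B k) (y k)) \<ge> p" and off: "\<And>k. norm (cut_L1 (W - B k) (y k)) \<le> q"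
    and I: "finite I"
  shows "(p - q) * (\<Sum>k\<in>I. norm (a k)) \<le> norm (\<Sum>k\<in>I. scale_L1 (a k) (y k))"
proof -
  let ?z = "\<Sum>k\<in>I. scale_L1 (a k) (y k)"
  have lin: "cut_L1 A (\<Sum>i\<in>J. f i) = (\<Sum>i\<in>J. cut_L1 A (f i))" for A and J :: "nat set" and f :: "nat \<Rightarrow> 'k L1"
    by (rule linear_sum[OF bounded_linear.linear[OF bounded_linear_cut]])
  have dI: "disjoint_family_on B J" for J using B(2) by (auto simp: disjoint_family_on_def)
  have low: "norm (a j) * p - (\<Sum>k\<in>I - {j}. norm (a k) * norm (cut_L1 (B j) (y k))) \<le> norm (cut_L1 (B j) ?z)"
    if j: "j \<in> I" for j
  proof -
    have "cut_L1 (B j) ?z = (\<Sum>k\<in>I. scale_L1 (a k) (cut_L1 (B j) (y k)))" by (simp add: lin cut_scale)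
    also have "\<dots> = scale_L1 (a j) (cut_L1 (B j) (y j)) + (\<Sum>k\<in>I - {j}. scale_L1 (a k) (cut_L1 (B j) (y k)))"
      using I j by (rule sum.remove)
    finally have "norm (scale_L1 (a j) (cut_L1 (B j) (y j))) \<le>
        norm (cut_L1 (B j) ?z) + norm (\<Sum>k\<in>I - {j}. scale_L1 (a k) (cut_L1 (B j) (y k)))"
      using norm_triangle_ineq4[of "cut_L1 (B j) ?z" "\<Sum>k\<in>I - {j}. scale_L1 (a k) (cut_L1 (B j) (y k))"] by simp
    moreover have "norm (\<Sum>k\<in>I - {j}. scale_L1 (a k) (cut_L1 (B j) (y k))) \<le> (\<Sum>k\<in>I - {j}. norm (a k) * norm (cut_L1 (B j) (y k)))"
      by (rule sum_norm_le) (simp add: norm_scale_L1)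
    moreover have "norm (a j) * p \<le> norm (scale_L1 (a j) (cut_L1 (B j) (y j)))"
      unfolding norm_scale_L1 by (intro mult_left_mono diag) auto
    ultimately show ?thesis by linarith
  qed
  have off': "(\<Sum>j\<in>I - {k}. norm (cut_L1 (B j) (y k))) \<le> q" for k
  proof -
    have "(\<Sum>j\<in>I - {k}. norm (cut_L1 (B j) (y k))) = norm (cut_L1 (\<Union>j\<in>I - {k}. B j) (y k))"
      using I B dI by (intro norm_cut_UN[symmetric]) auto
    also have "\<dots> \<le> norm (cut_L1 (W - B k) (y k))"
      using B W I by (intro norm_cut_mono) (auto simp: disjoint_family_on_def, blast)
    finally show ?thesis using off[of k] by simp
  qed
  have "(p - q) * (\<Sum>k\<in>I. norm (a k)) = (\<Sum>k\<in>I. norm (a k) * p) - (\<Sum>k\<in>I. norm (a k) * q)"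
    by (simp add: algebra_simps sum_distrib_left sum_subtractf)
  also have "\<dots> \<le> (\<Sum>k\<in>I. norm (a k) * p) - (\<Sum>k\<in>I. norm (a k) * (\<Sum>j\<in>I - {k}. norm (cut_L1 (B j) (y k))))"
    by (intro diff_left_mono sum_mono mult_left_mono off') auto
  also have "(\<Sum>k\<in>I. norm (a k) * (\<Sum>j\<in>I - {k}. norm (cut_L1 (B j) (y k))))
     = (\<Sum>k\<in>I. \<Sum>j\<in>I. if j = k then 0 else norm (a k) * norm (cut_L1 (B j) (y k)))"
    using I unfolding sum_distrib_left
    by (intro sum.cong refl sum.mono_neutral_cong_left) auto
  also have "\<dots> = (\<Sum>j\<in>I. \<Sum>k\<in>I. if j = k then 0 else norm (a k) * norm (cut_L1 (B j) (y k)))"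
    by (rule sum.swap)
  also have "\<dots> = (\<Sum>j\<in>I. \<Sum>k\<in>I - {j}. norm (a k) * norm (cut_L1 (B j) (y k)))"
    using I by (intro sum.cong refl sum.mono_neutral_cong_right) auto
  also have "(\<Sum>k\<in>I. norm (a k) * p) - \<dots> = (\<Sum>j\<in>I. norm (a j) * p - (\<Sum>k\<in>I - {j}. norm (a k) * norm (cut_L1 (B j) (y k))))"
    by (simp add: sum_subtractf)
  also have "\<dots> \<le> (\<Sum>j\<in>I. norm (cut_L1 (B j) ?z))" by (rule sum_mono) (rule low)
  also have "\<dots> = norm (cut_L1 (\<Union>j\<in>I. B j) ?z)" using I B dI by (intro norm_cut_UN[symmetric]) auto
  also have "\<dots> \<le> norm ?z" by (rule norm_cut_le)
  finally show ?thesis .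
qed

text \<open>Let \<open>\<alpha>\<close> be the largest mass that images of the unit ball retain on arbitrarily small sets; it is
  positive by assumption.  Choose \<open>f k\<close> with mass almost \<open>\<alpha>\<close> on \<open>A k\<close>, where the sets \<open>A k\<close> shrink so fast
  that their union \<open>W\<close> is still small and that \<open>T (f k)\<close> has little mass on the later sets.  On \<open>W\<close> the
  mass of \<open>T (f k)\<close> can hardly exceed \<open>\<alpha>\<close>, so almost nothing is left off \<open>A k\<close>: near-extremality controls
  the mass on the earlier sets.\<close>
lemma infinite_sequence_of_bumps:
  fixes T :: "'k::scalar L1 \<Rightarrow>\<^sub>L 'k L1"
  assumes "\<not> equi_integrable (T ` cball 0 1)"
  shows "\<exists>f c. c > 0 \<and> (\<forall>k. norm (f k) \<le> 1) \<and> (\<forall>(I::nat set) a. finite I \<longrightarrow>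
    c * (\<Sum>k\<in>I. norm (a k)) \<le> norm (\<Sum>k\<in>I. scale_L1 (a k) (T (f k))))"
proof -
  define X where "X d = {norm (cut_L1 A (T f)) | A f. A \<in> sets leb01 \<and> mu A < d \<and> norm f \<le> 1}" for d
  define \<omega> where "\<omega> d = Sup (X d)" for d
  have bound: "norm (cut_L1 A (T f)) \<le> norm T" if "norm f \<le> 1" for A f
    using norm_cut_le[of A "T f"] norm_blinfun[of T f] mult_left_mono[OF that norm_ge_zero[of T]] by simp
  have bdd: "bdd_above (X d)" for d
    unfolding X_def by (auto intro!: bdd_aboveI[of _ "norm T"] bound)
  have \<omega>_upper: "norm (cut_L1 A (T f)) \<le> \<omega> d" if "A \<in> sets leb01" "mu A < d" "norm f \<le> 1" for A f d
    unfolding \<omega>_def using that by (intro cSup_upper bdd) (auto simp: X_def)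
  obtain e where e: "e > 0" "\<forall>d>0. \<exists>f A. norm f \<le> 1 \<and> A \<in> sets leb01 \<and> mu A < d \<and> norm (cut_L1 A (T f)) > e"
  proof -
    from assms obtain e where e: "e > 0"
      "\<And>d. d > 0 \<Longrightarrow> \<exists>f\<in>T ` cball 0 1. \<exists>A\<in>sets leb01. mu A < d \<and> \<not> norm (cut_L1 A f) \<le> e"
      unfolding equi_integrable_def by meson
    show ?thesis
    proof (rule that[OF e(1)], intro allI impI)
      fix d :: real assume "d > 0"
      from e(2)[OF this] show "\<exists>f A. norm f \<le> 1 \<and> A \<in> sets leb01 \<and> mu A < d \<and> norm (cut_L1 A (T f)) > e"
        by (auto simp: not_le)
    qed
  qed
  have \<omega>e: "e \<le> \<omega> d" if "d > 0" for d
    using e(2) that \<omega>_upper[of _ d] by (meson less_imp_le order_trans)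
  define \<alpha> where "\<alpha> = Inf (\<omega> ` {0<..})"
  have \<alpha>e: "e \<le> \<alpha>" unfolding \<alpha>_def by (intro cInf_greatest) (auto simp: \<omega>e intro: exI[of _ 1])
  have \<alpha>_le: "\<alpha> \<le> \<omega> d" if "d > 0" for d
    unfolding \<alpha>_def using that by (intro cInf_lower bdd_belowI[of _ e]) (auto simp: \<omega>e)
  define \<theta> where "\<theta> = \<alpha> / 10"
  have \<theta>: "\<theta> > 0" using e \<alpha>e by (simp add: \<theta>_def)
  have "\<exists>d>0. \<omega> d < \<alpha> + \<theta>"
  proof -
    have "\<exists>y\<in>\<omega> ` {0<..}. y < \<alpha> + \<theta>"
      by (rule cInf_lessD) (use \<theta> in \<open>auto simp: \<alpha>_def\<close>)
    then show ?thesis by auto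
  qed
  then obtain \<delta> where \<delta>: "\<delta> > 0" "\<omega> \<delta> < \<alpha> + \<theta>" by blast
  \<comment> \<open>Below every threshold the supremum is at least \<open>\<alpha>\<close>, so there are images with mass above \<open>\<alpha> - \<theta>\<close>.\<close>
  have bump: "\<exists>f A. norm f \<le> 1 \<and> A \<in> sets leb01 \<and> mu A < d \<and> norm (cut_L1 A (T f)) > \<alpha> - \<theta>" if d: "d > 0" for d
  proof -
    have "norm (cut_L1 {} (T 0)) \<in> X d"
      unfolding X_def using d by (intro CollectI exI[of _ "{}::real set"] exI[of _ "0 :: 'k L1"]) simp
    then have "X d \<noteq> {}" by blast
    moreover have "\<alpha> - \<theta> < Sup (X d)" using \<alpha>_le[OF d] \<theta> by (simp add: \<omega>_def)
    ultimately obtain x where "x \<in> X d" "\<alpha> - \<theta> < x" using less_cSupD by blast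
    then show ?thesis unfolding X_def by blast
  qed
  \<comment> \<open>A triple also records a size \<open>r\<close> below which sets carry almost nothing of the mass of \<open>T f\<close>.\<close>
  define good where "good = (\<lambda>(f, A, r). norm f \<le> 1 \<and> A \<in> sets leb01 \<and> norm (cut_L1 A (T f)) > \<alpha> - \<theta> \<and>
     r > 0 \<and> (\<forall>B\<in>sets leb01. mu B < r \<longrightarrow> norm (cut_L1 B (T f)) < \<theta>))"
  have ex: "\<exists>f A r. good (f, A, r) \<and> mu A < d \<and> r \<le> d" if d: "d > 0" for d
  proof -
    obtain f A where fA: "norm f \<le> 1" "A \<in> sets leb01" "mu A < d" "norm (cut_L1 A (T f)) > \<alpha> - \<theta>"
      using bump[OF d] by blast
    obtain r where r: "r > 0" "\<forall>B\<in>sets leb01. mu B < r \<longrightarrow> norm (cut_L1 B (T f)) < \<theta>"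
      using cut_small[OF \<theta>] by blast
    show ?thesis
      using fA r d by (intro exI[of _ f] exI[of _ A] exI[of _ "min r d"]) (auto simp: good_def)
  qed
  define P where "P = (\<lambda>(n::nat) (f, A, r). good (f, A, r) \<and> (n = 0 \<longrightarrow> mu A < \<delta> / 2 \<and> r \<le> \<delta> / 2))"
  \<comment> \<open>The factor \<open>1/4\<close> leaves room: the measures of all later sets add up to less than \<open>r\<close>.\<close>
  define Q where "Q = (\<lambda>(n::nat) (f::'k L1, A::real set, r::real) (f'::'k L1, A', r'). mu A' < r / 4 \<and> r' \<le> r / 4)"
  have "\<exists>s. \<forall>n. P n (s n) \<and> Q n (s n) (s (Suc n))"
  proof (rule dependent_nat_choice)
    show "\<exists>x. P 0 x" using ex[of "\<delta> / 2"] \<delta> by (auto simp: P_def)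
    show "\<exists>y. P (Suc n) y \<and> Q n x y" if "P n x" for x n
    proof (cases x)
      case (fields f A r)
      then have "r / 4 > 0" using that by (simp add: P_def good_def)
      from ex[OF this] show ?thesis by (auto simp: P_def Q_def fields)
    qed
  qed
  then obtain s where s: "\<And>n. P n (s n)" "\<And>n. Q n (s n) (s (Suc n))" by blast
  define f where "f n = fst (s n)" for n
  define A where "A n = fst (snd (s n))" for n
  define r where "r n = snd (snd (s n))" for n
  have s_eq: "s n = (f n, A n, r n)" for n by (simp add: f_def A_def r_def)
  have good: "norm (f n) \<le> 1" "A n \<in> sets leb01" "norm (cut_L1 (A n) (T (f n))) > \<alpha> - \<theta>"
     "r n > 0" "\<And>B. B \<in> sets leb01 \<Longrightarrow> mu B < r n \<Longrightarrow> norm (cut_L1 B (T (f n))) < \<theta>" for n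
    using s(1)[of n] by (auto simp: P_def good_def s_eq)
  have init: "mu (A 0) < \<delta> / 2" "r 0 \<le> \<delta> / 2" using s(1)[of 0] by (auto simp: P_def s_eq)
  have step: "mu (A (Suc n)) < r n / 4" "r (Suc n) \<le> r n / 4" for n using s(2)[of n] by (auto simp: Q_def s_eq)
  have rpow: "r (k + i) \<le> r k * (1/2)^i" for k i
  proof (induction i)
    case (Suc i)
    have "r (k + Suc i) \<le> r (k + i) / 4" using step(2)[of "k + i"] by simp
    also have "\<dots> \<le> r (k + i) / 2" using good(4)[of "k + i"] by simp
    also have "\<dots> \<le> r k * (1/2)^i / 2" using Suc by simp
    finally show ?case by simp
  qed simp
  define U where "U k = (\<Union>i. A (k + Suc i))" for k
  have U: "U k \<in> sets leb01" for k unfolding U_def using good(2) by auto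
  have muU: "mu (U k) < r k" for k
  proof -
    have le: "mu (A (k + Suc i)) \<le> r k / 4 * (1/2)^i" for i
      using step(1)[of "k + i"] rpow[of k i] by simp
    have sm: "(\<lambda>i. r k / 4 * (1/2)^i) sums (r k / 4 * (1 / (1 - 1/2)))"
      by (intro sums_mult geometric_sums) auto
    have sum: "summable (\<lambda>i. mu (A (k + Suc i)))"
      using le by (intro summable_comparison_test'[OF sums_summable[OF sm], of 0]) auto
    have "mu (U k) \<le> (\<Sum>i. mu (A (k + Suc i)))"
      unfolding U_def using good(2) sum by (intro leb01.finite_measure_subadditive_countably) auto
    also have "\<dots> \<le> (\<Sum>i. r k / 4 * (1/2)^i)" using le sum sums_summable[OF sm] by (intro suminf_le) auto
    also have "\<dots> = r k / 2" using sums_unique[OF sm] by simp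
    also have "\<dots> < r k" using good(4)[of k] by simp
    finally show ?thesis .
  qed
  define W where "W = A 0 \<union> U 0"
  have W: "W \<in> sets leb01" unfolding W_def using good(2) U by auto
  have AW: "A k \<subseteq> W" for k
    by (cases k) (auto simp: W_def U_def)
  have muW: "mu W < \<delta>" unfolding W_def using measure_Un_le[OF good(2)[of 0] U[of 0]] init muU[of 0] by simp
  define B where "B k = A k - U k" for k
  have B: "B k \<in> sets leb01" "B k \<subseteq> W" for k unfolding B_def using good(2) U AW by auto
  have dB: "disjoint_family B"
    unfolding disjoint_family_on_def
  proof (intro ballI impI)
    have *: "B m \<inter> B n = {}" if "m < n" for m n
    proof -
      have "A n \<subseteq> U m" unfolding U_def using that by (auto intro!: exI[of _ "n - m - 1"])
      then show ?thesis unfolding B_def by blast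
    qed
    fix m n :: nat assume "m \<noteq> n"
    then show "B m \<inter> B n = {}" using *[of m n] *[of n m] by (cases "m < n") auto
  qed
  have diag: "\<alpha> - 2 * \<theta> \<le> norm (cut_L1 (B k) (T (f k)))" for k
  proof -
    have eqA: "A k = B k \<union> (A k \<inter> U k)" by (auto simp: B_def)
    have "norm (cut_L1 (A k) (T (f k))) = norm (cut_L1 (B k) (T (f k))) + norm (cut_L1 (A k \<inter> U k) (T (f k)))"
      by (subst eqA, rule norm_cut_Un) (use B good(2) U in \<open>auto simp: B_def\<close>)
    moreover have "norm (cut_L1 (A k \<inter> U k) (T (f k))) < \<theta>"
      using mu_mono[of "A k \<inter> U k" "U k"] muU[of k] U good(2) by (intro good(5)) auto
    ultimately show ?thesis using good(3)[of k] by simp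
  qed
  have off: "norm (cut_L1 (W - B k) (T (f k))) \<le> 3 * \<theta>" for k
  proof -
    have "norm (cut_L1 (B k \<union> (W - B k)) (T (f k))) = norm (cut_L1 (B k) (T (f k))) + norm (cut_L1 (W - B k) (T (f k)))"
      using B W by (intro norm_cut_Un) auto
    moreover have "B k \<union> (W - B k) = W" using B(2) by auto
    moreover have "norm (cut_L1 W (T (f k))) \<le> \<omega> \<delta>" using W muW good(1) by (intro \<omega>_upper)
    ultimately show ?thesis using diag[of k] \<delta> by simp
  qed
  have "\<alpha> / 2 * (\<Sum>k\<in>I. norm (a k)) \<le> norm (\<Sum>k\<in>I. scale_L1 (a k) (T (f k)))" if "finite I" for I a
    using l1_lower_bound[OF B(1) dB B(2) W diag off that, of a] by (simp add: \<theta>_def)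
  moreover have "\<alpha> / 2 > 0" using e \<alpha>e by simp
  ultimately show ?thesis using good(1) by (intro exI[of _ f] exI[of _ "\<alpha> / 2"]) simp
qed

definition submodule_of_L1 :: "'k::scalar L1 set \<Rightarrow> ('k, 'k L1) module"
  where "submodule_of_L1 V = \<lparr>carrier = V, monoid.mult = (\<lambda>x y. 0), one = 0, ring.zero = 0, add = (+), smult = scale_L1\<rparr>"

lemma submodule_of_L1_simps [simp]:
  "carrier (submodule_of_L1 V) = V" "\<zero>\<^bsub>submodule_of_L1 V\<^esub> = 0" "x \<oplus>\<^bsub>submodule_of_L1 V\<^esub> y = x + y"
  "c \<odot>\<^bsub>submodule_of_L1 V\<^esub> x = scale_L1 c x"
  by (simp_all add: submodule_of_L1_def)

lemma cring_scalar_ring: "cring (scalar_ring :: 'k::scalar ring)"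
proof (rule cringI)
  show "abelian_group (scalar_ring :: 'k ring)"
    by (rule abelian_groupI) (auto simp: scalar_ring_def add.assoc add.commute intro: exI[of _ "- x" for x] left_minus)
  show "comm_monoid (scalar_ring :: 'k ring)"
    by (rule comm_monoidI) (auto simp: scalar_ring_def mult.assoc mult.commute)
qed (auto simp: scalar_ring_def distrib_right)

lemma module_submodule_of_L1:
  fixes V :: "'k::scalar L1 set"
  assumes V: "L1.subspace V"
  shows "module scalar_ring (submodule_of_L1 V)"
proof (rule moduleI)
  show "cring (scalar_ring :: 'k ring)" by (rule cring_scalar_ring)
  show "abelian_group (submodule_of_L1 V)"
  proof (rule abelian_groupI)
    fix x assume "x \<in> carrier (submodule_of_L1 V)"
    then show "\<exists>y\<in>carrier (submodule_of_L1 V). y \<oplus>\<^bsub>submodule_of_L1 V\<^esub> x = \<zero>\<^bsub>submodule_of_L1 V\<^esub>"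
      using L1.subspace_neg[OF V] by (intro bexI[of _ "- x"]) auto
  qed (use L1.subspace_add[OF V] L1.subspace_0[OF V] in \<open>auto simp: add.assoc add.commute\<close>)
qed (use L1.subspace_scale[OF V] in \<open>auto simp: scalar_ring_def scale_L1_simps\<close>)

lemma banach_space_submodule_of_L1:
  fixes V :: "'k::scalar L1 set"
  assumes V: "L1.subspace V" and cl: "closed V"
  shows "banach_space (submodule_of_L1 V) norm"
proof -
  interpret module scalar_ring "submodule_of_L1 V" by (rule module_submodule_of_L1[OF V])
  have diff: "x \<ominus>\<^bsub>submodule_of_L1 V\<^esub> y = x - y" if "x \<in> V" "y \<in> V" for x y
  proof -
    have "\<ominus>\<^bsub>submodule_of_L1 V\<^esub> y = - y"
      using that L1.subspace_neg[OF V] by (intro M.minus_equality) auto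
    then show ?thesis by (simp add: a_minus_def)
  qed
  show ?thesis
    unfolding banach_space_def
  proof (intro conjI ballI allI impI module_submodule_of_L1[OF V])
    fix \<sigma> :: "nat \<Rightarrow> 'k L1"
    assume \<sigma>: "range \<sigma> \<subseteq> carrier (submodule_of_L1 V) \<and>
      (\<forall>e>0. \<exists>N. \<forall>m\<ge>N. \<forall>n\<ge>N. norm (\<sigma> m \<ominus>\<^bsub>submodule_of_L1 V\<^esub> \<sigma> n) < e)"
    then have in_V: "\<sigma> n \<in> V" for n by auto
    then have "Cauchy \<sigma>" using \<sigma> by (simp add: Cauchy_iff diff)
    then obtain z where z: "\<sigma> \<longlonglongrightarrow> z" using Cauchy_convergent convergent_def by blast
    then have "z \<in> V" using cl in_V closed_sequentially by blast
    moreover have "(\<lambda>n. norm (\<sigma> n - z)) \<longlonglongrightarrow> 0"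
      using z by (simp add: LIM_zero_iff tendsto_norm_zero_iff)
    ultimately show "\<exists>z\<in>carrier (submodule_of_L1 V). (\<lambda>n. norm (\<sigma> n \<ominus>\<^bsub>submodule_of_L1 V\<^esub> z)) \<longlonglongrightarrow> 0"
      using in_V by (auto simp: diff)
  qed (auto simp: norm_scale_L1 norm_triangle_ineq)
qed

lemma infinite_dimensional_submodule_of_L1:
  fixes V :: "'k::scalar L1 set"
  assumes V: "L1.subspace V" and B: "B \<subseteq> V" "L1.independent B" "infinite B"
  shows "infinite_dimensional (submodule_of_L1 V)"
  unfolding infinite_dimensional_def
proof (rule notI, elim exE conjE)
  interpret module scalar_ring "submodule_of_L1 V" by (rule module_submodule_of_L1[OF V])
  fix C assume C: "finite C" "C \<subseteq> carrier (submodule_of_L1 V)"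
    "\<forall>z\<in>carrier (submodule_of_L1 V). \<exists>c. z = (\<Oplus>\<^bsub>submodule_of_L1 V\<^esub>b\<in>C. c b \<odot>\<^bsub>submodule_of_L1 V\<^esub> b)"
  have sum: "(\<Oplus>\<^bsub>submodule_of_L1 V\<^esub>b\<in>D. c b \<odot>\<^bsub>submodule_of_L1 V\<^esub> b) = (\<Sum>b\<in>D. scale_L1 (c b) b)"
    if "finite D" "D \<subseteq> V" for c D
    using that
  proof (induction D rule: finite_induct)
    case (insert z D)
    then show ?case
      using L1.subspace_scale[OF V] by (subst M.finsum_insert) (auto simp: subset_iff)
  qed simp
  have "B \<subseteq> L1.span C"
  proof
    fix x assume "x \<in> B"
    then have "x \<in> V" using B(1) by blast
    then obtain c where x: "x = (\<Sum>b\<in>C. scale_L1 (c b) b)" using C sum[of C] by fastforce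
    show "x \<in> L1.span C" unfolding x by (intro L1.span_sum L1.span_scale L1.span_base)
  qed
  then show False using L1.independent_span_bound[OF C(1) B(2)] B(3) by blast
qed

lemma L1_subspace_closure:
  fixes V :: "'k::scalar L1 set"
  assumes V: "L1.subspace V"
  shows "L1.subspace (closure V)"
proof (rule L1.subspaceI)
  show "0 \<in> closure V" using L1.subspace_0[OF V] closure_subset by blast
next
  fix x y assume "x \<in> closure V" "y \<in> closure V"
  then obtain a b where ab: "\<And>n. a n \<in> V" "\<And>n. b n \<in> V" "a \<longlonglongrightarrow> x" "b \<longlonglongrightarrow> y"
    unfolding closure_sequential by blast
  have "(\<lambda>n. a n + b n) \<longlonglongrightarrow> x + y" by (intro tendsto_add ab)
  moreover have "\<forall>n. a n + b n \<in> V" using ab L1.subspace_add[OF V] by blast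
  ultimately show "x + y \<in> closure V" unfolding closure_sequential by (intro exI[of _ "\<lambda>n. a n + b n"]) simp
next
  fix x and c :: 'k assume "x \<in> closure V"
  then obtain a where a: "\<And>n. a n \<in> V" "a \<longlonglongrightarrow> x" unfolding closure_sequential by blast
  have "(\<lambda>n. scale_L1 c (a n)) \<longlonglongrightarrow> scale_L1 c x"
    by (rule bounded_linear.tendsto[OF bounded_linear_scale_L1 a(2)])
  moreover have "\<forall>n. scale_L1 c (a n) \<in> V" using a L1.subspace_scale[OF V] by blast
  ultimately show "scale_L1 c x \<in> closure V" unfolding closure_sequential by (intro exI[of _ "\<lambda>n. scale_L1 c (a n)"]) simp
qed

text \<open>Otherwise \<open>T\<close> is bounded below on the closed span of the functions \<open>f k\<close> of
  \<open>infinite_sequence_of_bumps\<close>: the norm of a combination is at most the sum of the moduli of its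
  coefficients, which is controlled by the norm of the image.  The span is infinite dimensional for the
  same reason.\<close>
theorem strictly_singular_equi_integrable:
  fixes T :: "'k::scalar L1 \<Rightarrow>\<^sub>L 'k L1"
  assumes T: "T \<in> operators scale_L1" and ss: "strictly_singular scale_L1 T"
  shows "equi_integrable (T ` cball 0 1)"
proof (rule ccontr)
  assume "\<not> ?thesis"
  from infinite_sequence_of_bumps[OF this] obtain f :: "nat \<Rightarrow> 'k L1" and c where c: "c > 0" and f: "\<forall>k. norm (f k) \<le> 1"
    and low: "\<forall>(I::nat set) a. finite I \<longrightarrow> c * (\<Sum>k\<in>I. norm (a k)) \<le> norm (\<Sum>k\<in>I. scale_L1 (a k) (T (f k)))"
    by (elim exE conjE)
  have low': "c * (\<Sum>k\<in>I. norm (a k)) \<le> norm (T (\<Sum>k\<in>I. scale_L1 (a k) (f k)))"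
    if "finite I" for I :: "nat set" and a
    using low that by (simp add: blinfun.sum_right operatorsD[OF T])
  have rep: "\<exists>I a. finite (I::nat set) \<and> z = (\<Sum>k\<in>I. scale_L1 (a k) (f k))" if "z \<in> L1.span (range f)" for z
    using that
  proof (induction rule: L1.span_induct_alt)
    case base
    show ?case by (intro exI[of _ "{}"]) simp
  next
    case (step b x y)
    then obtain i I a where x: "x = f i" and y: "finite I" "y = (\<Sum>k\<in>I. scale_L1 (a k) (f k))" by auto
    define a' where "a' k = (if k = i then b else 0) + (if k \<in> I then a k else 0)" for k
    have "(\<Sum>k\<in>insert i I. scale_L1 (a' k) (f k)) =
       (\<Sum>k\<in>insert i I. scale_L1 (if k = i then b else 0) (f k)) + (\<Sum>k\<in>insert i I. scale_L1 (if k \<in> I then a k else 0) (f k))"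
      by (simp add: a'_def scale_L1_simps sum.distrib)
    also have "(\<Sum>k\<in>insert i I. scale_L1 (if k = i then b else 0) (f k)) = (\<Sum>k\<in>insert i I. if k = i then scale_L1 b (f i) else 0)"
      by (intro sum.cong) auto
    also have "\<dots> = scale_L1 b x" using y by (simp add: x)
    also have "(\<Sum>k\<in>insert i I. scale_L1 (if k \<in> I then a k else 0) (f k)) = y"
      unfolding y(2) using y(1) by (intro sum.mono_neutral_cong_right) auto
    finally show ?case using y(1) by (intro exI[of _ "insert i I"] exI[of _ a']) auto
  qed
  define V where "V = closure (L1.span (range f))"
  have V: "L1.subspace V" unfolding V_def by (intro L1_subspace_closure L1.subspace_span)
  have bound: "norm z \<le> 1 / c * norm (T z)" if "z \<in> V" for z
  proof -
    have "L1.span (range f) \<subseteq> {z. norm z \<le> 1 / c * norm (T z)}"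
    proof
      fix z assume "z \<in> L1.span (range f)"
      then obtain I a where I: "finite (I::nat set)" "z = (\<Sum>k\<in>I. scale_L1 (a k) (f k))" using rep by blast
      have "norm z \<le> (\<Sum>k\<in>I. norm (a k))"
        unfolding I(2) using f by (intro sum_norm_le) (simp add: norm_scale_L1 mult_left_le)
      also have "\<dots> \<le> 1 / c * norm (T z)"
        using low'[OF I(1), of a] c by (simp add: I(2) field_simps)
      finally show "z \<in> {z. norm z \<le> 1 / c * norm (T z)}" by simp
    qed
    moreover have "closed {z. norm z \<le> 1 / c * norm (T z)}"
      by (intro closed_Collect_le continuous_intros)
    ultimately have "V \<subseteq> {z. norm z \<le> 1 / c * norm (T z)}"
      unfolding V_def by (rule closure_minimal)
    with that show ?thesis by blast
  qed
  have inj: "inj f"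
  proof (rule injI, rule ccontr)
    fix i j assume ij: "f i = f j" "i \<noteq> j"
    have "c * (\<Sum>k\<in>{i,j}. norm (if k = i then 1 else -1 :: 'k)) \<le>
       norm (T (\<Sum>k\<in>{i,j}. scale_L1 (if k = i then 1 else -1) (f k)))"
      by (rule low') simp
    moreover have "(\<Sum>k\<in>{i,j}. scale_L1 (if k = i then 1 else -1 :: 'k) (f k)) = 0"
      using ij scale_L1_of_real[of "-1" "f j"] by (simp add: scale_L1_simps)
    ultimately show False using ij c by (simp add: blinfun.zero_right)
  qed
  have "L1.independent (range f)"
    unfolding L1.dependent_explicit
  proof (rule notI, elim exE conjE bexE)
    fix U u v assume U: "finite U" "U \<subseteq> range f" "(\<Sum>v\<in>U. scale_L1 (u v) v) = 0" "v \<in> U" "u v \<noteq> 0"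
    then obtain I where I: "U = f ` I" "finite I" using finite_subset_image by blast
    have "(\<Sum>k\<in>I. scale_L1 (u (f k)) (f k)) = 0"
      using U(3) unfolding I(1) sum.reindex[OF inj_on_subset[OF inj subset_UNIV]] o_def .
    then have "c * (\<Sum>k\<in>I. norm (u (f k))) \<le> 0"
      using low'[OF I(2), of "\<lambda>k. u (f k)"] by (simp add: blinfun.zero_right)
    moreover have "0 \<le> (\<Sum>k\<in>I. norm (u (f k)))" by (intro sum_nonneg) simp
    ultimately have "(\<Sum>k\<in>I. norm (u (f k))) = 0" using c mult_pos_pos[of c "\<Sum>k\<in>I. norm (u (f k))"] by linarith
    then show False using U(4,5) I by (auto simp: sum_nonneg_eq_0_iff)
  qed
  moreover have "range f \<subseteq> V" unfolding V_def by (rule order_trans[OF L1.span_superset closure_subset])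
  ultimately have "infinite_dimensional (submodule_of_L1 V)"
    using V range_inj_infinite[OF inj] by (intro infinite_dimensional_submodule_of_L1)
  moreover have "banach_space (submodule_of_L1 V) norm"
    using V by (intro banach_space_submodule_of_L1) (simp_all add: V_def)
  moreover have "bounded_operator (submodule_of_L1 V) norm scale_L1 (\<lambda>x. x)"
    unfolding bounded_operator_def by (auto intro: exI[of _ 1])
  ultimately show False
    using ss bound unfolding strictly_singular_def by (metis submodule_of_L1_simps(1))
qed

section \<open>A smooth strictly convex energy on \<open>L\<^sub>1\<close>\<close>

text \<open>A smooth and strictly convex substitute for the norm, with the same growth; its gradient at \<open>v\<close> is
  \<open>v / psi v\<close>.\<close>
definition psi :: "'a::real_inner \<Rightarrow> real" where "psi v = sqrt (1 + v \<bullet> v)"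

lemma psi_square: "psi v * psi v = 1 + v \<bullet> v"
  unfolding psi_def by (simp add: add_nonneg_nonneg)

lemma psi_ge_1: "1 \<le> psi v"
  unfolding psi_def by simp

lemma psi_pos: "0 < psi v"
  using psi_ge_1[of v] by linarith

lemma norm_le_psi: "norm v \<le> psi v"
  unfolding psi_def norm_eq_sqrt_inner by simp

lemma psi_le: "psi v \<le> 1 + norm v"
proof (rule power2_le_imp_le)
  show "(psi v)\<^sup>2 \<le> (1 + norm v)\<^sup>2"
    using psi_square[of v] by (simp add: power2_eq_square algebra_simps dot_square_norm)
qed simp

lemma psi_lipschitz: "\<bar>psi u - psi v\<bar> \<le> norm (u - v)"
proof -
  have "\<bar>psi u - psi v\<bar> * (psi u + psi v) = \<bar>(psi u - psi v) * (psi u + psi v)\<bar>"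
    using psi_pos[of u] psi_pos[of v] by (simp add: abs_mult)
  also have "\<dots> = \<bar>u \<bullet> u - v \<bullet> v\<bar>" by (simp add: algebra_simps psi_square)
  also have "u \<bullet> u - v \<bullet> v = (u - v) \<bullet> (u + v)" by (simp add: algebra_simps inner_commute)
  also have "\<bar>(u - v) \<bullet> (u + v)\<bar> \<le> norm (u - v) * norm (u + v)" by (rule Cauchy_Schwarz_ineq2)
  also have "\<dots> \<le> norm (u - v) * (psi u + psi v)"
    using norm_triangle_ineq[of u v] norm_le_psi[of u] norm_le_psi[of v] by (intro mult_left_mono) auto
  finally show ?thesis using psi_pos[of u] psi_pos[of v] by simp
qed

text \<open>Second order smoothness: \<open>psi (w + v) - psi w\<close> is \<open>(2 (w \<bullet> v) + v \<bullet> v) / (psi (w + v) + psi w)\<close>, and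
  replacing the denominator by \<open>2 psi w\<close> costs another multiple of \<open>v \<bullet> v\<close> since \<open>psi\<close> is a contraction.\<close>
lemma psi_upper: "psi (w + v) \<le> psi w + (w \<bullet> v) / psi w + v \<bullet> v"
proof -
  let ?p = "psi w" and ?q = "psi (w + v)"
  have p: "?p \<ge> 1" "?q \<ge> 1" by (rule psi_ge_1)+
  have "(?q - ?p) * (?q + ?p) = 2 * (w \<bullet> v) + v \<bullet> v"
    by (simp add: algebra_simps psi_square inner_commute)
  then have "(?q - ?p - (w \<bullet> v) / ?p) * (?q + ?p) = v \<bullet> v + (w \<bullet> v) / ?p * (?p - ?q)"
    using p by (simp add: field_simps)
  also have "(w \<bullet> v) / ?p * (?p - ?q) \<le> norm v * norm v"
  proof -
    have "\<bar>(w \<bullet> v) / ?p\<bar> \<le> norm v"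
    proof -
      have "\<bar>w \<bullet> v\<bar> \<le> norm w * norm v" by (rule Cauchy_Schwarz_ineq2)
      also have "\<dots> \<le> ?p * norm v" by (intro mult_right_mono norm_le_psi) simp
      finally show ?thesis using p by (simp add: field_simps)
    qed
    moreover have "\<bar>?p - ?q\<bar> \<le> norm v" using psi_lipschitz[of w "w + v"] by simp
    ultimately have "\<bar>(w \<bullet> v) / ?p\<bar> * \<bar>?p - ?q\<bar> \<le> norm v * norm v" by (intro mult_mono) auto
    then show ?thesis by (metis abs_ge_self abs_mult order_trans)
  qed
  also have "v \<bullet> v + norm v * norm v = (v \<bullet> v) * 2" by (simp add: dot_square_norm power2_eq_square)
  also have "\<dots> \<le> (v \<bullet> v) * (?q + ?p)" using p by (intro mult_left_mono) auto
  finally have "?q - ?p - (w \<bullet> v) / ?p \<le> v \<bullet> v" using p by simp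
  then show ?thesis by simp
qed

lemma psi_upper': "psi (w + v) \<le> psi w + (w \<bullet> v) / psi w + 2 * norm v"
proof -
  have "\<bar>w \<bullet> v\<bar> \<le> norm w * norm v" by (rule Cauchy_Schwarz_ineq2)
  also have "\<dots> \<le> psi w * norm v" by (intro mult_right_mono norm_le_psi) simp
  finally have "- norm v \<le> (w \<bullet> v) / psi w" using psi_pos[of w] by (simp add: field_simps)
  then show ?thesis using psi_lipschitz[of "w + v" w] by simp
qed

text \<open>Strong convexity.  With \<open>U = (1, u)\<close> and \<open>A = (1, a)\<close> in the product space, \<open>psi\<close> is the length, and
  the excess over the tangent at \<open>a\<close> is \<open>(|U| |A| - U \<bullet> A) / |A|\<close>.  By Lagrange's identity
  \<open>|U|\<^sup>2 |A|\<^sup>2 - (U \<bullet> A)\<^sup>2\<close> is at least the part \<open>|u - a|\<^sup>2\<close> contributed by the minors with the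
  coordinate \<open>1\<close>.\<close>
lemma psi_lower: "psi a + (a \<bullet> (u - a)) / psi a + ((u - a) \<bullet> (u - a)) / (2 * psi u * (psi a)\<^sup>2) \<le> psi u"
proof -
  let ?p = "psi a" and ?q = "psi u"
  have p: "?p > 0" "?q > 0" by (rule psi_pos)+
  let ?x = "?q * ?p - 1 - a \<bullet> u"
  have "\<bar>a \<bullet> u\<bar> \<le> norm a * norm u" by (rule Cauchy_Schwarz_ineq2)
  have CS: "(a \<bullet> u)\<^sup>2 \<le> (a \<bullet> a) * (u \<bullet> u)" by (rule Cauchy_Schwarz_ineq)
  have sq: "(?q * ?p)\<^sup>2 = (1 + u \<bullet> u) * (1 + a \<bullet> a)"
    using psi_square[of u] psi_square[of a] by (simp add: power2_eq_square mult_ac)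
  have prod: "(u - a) \<bullet> (u - a) \<le> ?x * (?q * ?p + 1 + a \<bullet> u)"
  proof -
    have "?x * (?q * ?p + 1 + a \<bullet> u) = (?q * ?p)\<^sup>2 - (1 + a \<bullet> u)\<^sup>2" by (simp add: power2_eq_square algebra_simps)
    also have "\<dots> = (u - a) \<bullet> (u - a) + ((a \<bullet> a) * (u \<bullet> u) - (a \<bullet> u)\<^sup>2)"
      unfolding sq by (simp add: power2_eq_square algebra_simps inner_commute)
    finally show ?thesis using CS by simp
  qed
  have le: "\<bar>1 + a \<bullet> u\<bar> \<le> ?q * ?p"
  proof (rule power2_le_imp_le)
    have "0 \<le> (u - a) \<bullet> (u - a)" by simp
    then show "\<bar>1 + a \<bullet> u\<bar>\<^sup>2 \<le> (?q * ?p)\<^sup>2"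
      unfolding sq using CS by (simp add: power2_eq_square algebra_simps inner_commute)
  qed (use p in simp)
  then have "0 \<le> ?x" "?q * ?p + 1 + a \<bullet> u \<le> 2 * (?q * ?p)" by linarith+
  then have "?x * (?q * ?p + 1 + a \<bullet> u) \<le> ?x * (2 * (?q * ?p))" by (rule mult_left_mono[rotated])
  with prod have "(u - a) \<bullet> (u - a) \<le> ?x * (2 * (?q * ?p))" by simp
  then have "((u - a) \<bullet> (u - a)) / (2 * ?q * ?p\<^sup>2) \<le> ?x / ?p"
    using p by (simp add: field_simps power2_eq_square)
  moreover have "?p + (a \<bullet> (u - a)) / ?p + ?x / ?p = ?q"
    using p psi_square[of a] by (simp add: field_simps inner_diff_right)
  ultimately show ?thesis by linarith
qed

lemma norm_le_psi_square:
  assumes e: "e > 0"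
  shows "norm w \<le> e + (1 + 1 / e) * ((w \<bullet> w) / psi w)"
proof (cases "norm w \<le> e")
  case True
  have "0 \<le> (1 + 1 / e) * ((w \<bullet> w) / psi w)" using e psi_pos[of w] by simp
  then show ?thesis using True by linarith
next
  case False
  have "norm w * psi w \<le> norm w * (1 + norm w)" by (intro mult_left_mono psi_le) simp
  also have "\<dots> \<le> norm w * (norm w / e + norm w)"
    using False e by (intro mult_left_mono) (auto simp: field_simps)
  also have "\<dots> = (1 + 1 / e) * (w \<bullet> w)" by (simp add: dot_square_norm power2_eq_square algebra_simps)
  finally have "norm w \<le> (1 + 1 / e) * ((w \<bullet> w) / psi w)" using psi_pos[of w] by (simp add: field_simps)
  then show ?thesis using e by linarith
qed

text \<open>Multiplication by \<open>w\<close> scales norms by \<open>|w|\<close>, so it scales inner products by \<open>|w|\<^sup>2\<close>, by polarisation.\<close>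
lemma inner_mult_left:
  fixes w x y :: "'k::{scalar, euclidean_space}"
  shows "(w * x) \<bullet> (w * y) = (norm w)\<^sup>2 * (x \<bullet> y)"
proof -
  have "norm (w * x + w * y) = norm w * norm (x + y)" by (simp add: norm_mult flip: distrib_left)
  then show ?thesis by (simp add: dot_norm norm_mult power_mult_distrib algebra_simps diff_divide_distrib add_divide_distrib)
qed

text \<open>The gradient of \<open>psi\<close>, as the scalar that represents it under multiplication; for complex scalars it is
  the conjugate of \<open>w / psi w\<close>.\<close>
definition slopef :: "'k::{scalar, euclidean_space} \<Rightarrow> 'k" where "slopef w = of_real ((norm w)\<^sup>2 / psi w) * inverse w"

lemma re_mult_slopef: "re (v * slopef w) = (w \<bullet> v) / psi w"
proof (cases "w = 0")
  case False
  have "(w * 1) \<bullet> (w * (inverse w * v)) = (norm w)\<^sup>2 * (1 \<bullet> (inverse w * v))" by (rule inner_mult_left)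
  then have "w \<bullet> v = (norm w)\<^sup>2 * re (inverse w * v)" using False by (simp add: re_def flip: mult.assoc)
  moreover have "v * slopef w = ((norm w)\<^sup>2 / psi w) *\<^sub>R (inverse w * v)"
    by (simp add: slopef_def scaleR_conv_of_real mult_ac)
  ultimately show ?thesis by (simp add: re_scaleR)
qed (simp add: slopef_def re_zero)

lemma ess_bounded_slopef:
  fixes f :: "real \<Rightarrow> 'k::{scalar, euclidean_space}"
  assumes "f \<in> borel_measurable leb01"
  shows "ess_bounded (\<lambda>x. slopef (f x))"
proof -
  have "slopef w = of_real ((norm w)\<^sup>2 / sqrt (1 + (norm w)\<^sup>2)) * inverse w" for w :: 'k
    by (simp add: slopef_def psi_def dot_square_norm)
  then have eq: "(\<lambda>x. slopef (f x)) = (\<lambda>x. of_real ((\<lambda>t. t\<^sup>2 / sqrt (1 + t\<^sup>2)) (norm (f x))) * inverse (f x))"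
    by (simp add: fun_eq_iff)
  show ?thesis
    unfolding eq
  proof (rule ess_bounded_normalized(1)[OF assms, where c = 1])
    fix t :: real assume t: "0 \<le> t"
    have "t \<le> sqrt (1 + t\<^sup>2)" by (rule real_le_rsqrt) simp
    moreover have "t\<^sup>2 / sqrt (1 + t\<^sup>2) * inverse t = t / sqrt (1 + t\<^sup>2)"
      by (cases "t = 0") (auto simp: power2_eq_square field_simps)
    moreover have "sqrt (1 + t\<^sup>2) > 0" by (simp add: add_pos_nonneg)
    ultimately show "\<bar>t\<^sup>2 / sqrt (1 + t\<^sup>2) * inverse t\<bar> \<le> 1" using t by simp
  qed measurable
qed

lemma integrable_psi:
  fixes f :: "real \<Rightarrow> 'k::{scalar, euclidean_space}"
  assumes f: "integrable leb01 f"
  shows "integrable leb01 (\<lambda>x. psi (f x))"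
proof (rule Bochner_Integration.integrable_bound)
  show "integrable leb01 (\<lambda>x. 1 + norm (f x))" using f by simp
  show "(\<lambda>x. psi (f x)) \<in> borel_measurable leb01" unfolding psi_def using f by measurable
  show "AE x in leb01. norm (psi (f x)) \<le> norm (1 + norm (f x))"
  proof (rule AE_I2)
    show "norm (psi (f x)) \<le> norm (1 + norm (f x))" for x
      using psi_le[of "f x"] psi_pos[of "f x"] by simp
  qed
qed

lift_definition slope :: "'k::{scalar, euclidean_space} L1 \<Rightarrow> 'k Linf" is "\<lambda>f x. slopef (f x)"
  by (auto intro: ess_bounded_slopef elim!: eventually_mono)

lift_definition energy :: "'k::{scalar, euclidean_space} L1 \<Rightarrow> real" is "\<lambda>f. \<integral>x. psi (f x) \<partial>leb01"
  by (rule integral_cong_AE) (auto elim!: eventually_mono dest: integrable_psi)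

lemma energy_abs: "integrable leb01 f \<Longrightarrow> energy (abs_L1 f) = (\<integral>x. psi (f x) \<partial>leb01)"
  by (simp add: energy.abs_eq)

lemma re_pairing_slope:
  fixes f g :: "real \<Rightarrow> 'k::{scalar, euclidean_space}"
  assumes f: "integrable leb01 f" and g: "integrable leb01 g"
  shows "integrable leb01 (\<lambda>x. (f x \<bullet> g x) / psi (f x))"
    "re (pairing (abs_L1 g) (slope (abs_L1 f))) = (\<integral>x. (f x \<bullet> g x) / psi (f x) \<partial>leb01)"
proof -
  have eb: "ess_bounded (\<lambda>x. slopef (f x))" using f by (intro ess_bounded_slopef) auto
  have int: "integrable leb01 (\<lambda>x. g x * slopef (f x))" by (rule integrable_mult_ess_bounded[OF g eb])
  have "pairing (abs_L1 g) (slope (abs_L1 f)) = (\<integral>x. g x * slopef (f x) \<partial>leb01)"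
    using f g eb by (simp add: slope.abs_eq pairing.abs_eq)
  then have "re (pairing (abs_L1 g) (slope (abs_L1 f))) = (\<integral>x. re (g x * slopef (f x)) \<partial>leb01)"
    using integral_bounded_linear[OF bounded_linear_re int] by simp
  then show "re (pairing (abs_L1 g) (slope (abs_L1 f))) = (\<integral>x. (f x \<bullet> g x) / psi (f x) \<partial>leb01)"
    by (simp add: re_mult_slopef)
  show "integrable leb01 (\<lambda>x. (f x \<bullet> g x) / psi (f x))"
    using integrable_bounded_linear[OF bounded_linear_re int] by (simp add: re_mult_slopef)
qed

lemma energy_nonneg: "0 \<le> energy u"
  by transfer (auto intro!: Bochner_Integration.integral_nonneg simp: less_imp_le[OF psi_pos])

lemma energy_le: "energy u \<le> 1 + norm u"
proof transfer
  fix u :: "real \<Rightarrow> 'a" assume u: "integrable leb01 u \<and> integrable leb01 u \<and> (AE x in leb01. u x = u x)"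
  have "(\<integral>x. psi (u x) \<partial>leb01) \<le> (\<integral>x. 1 + norm (u x) \<partial>leb01)"
    using u by (intro integral_mono integrable_psi psi_le) auto
  also have "\<dots> = 1 + (\<integral>x. norm (u x) \<partial>leb01)"
    using u leb01.prob_space by (subst Bochner_Integration.integral_add) auto
  finally show "(\<integral>x. psi (u x) \<partial>leb01) \<le> 1 + (\<integral>x. norm (u x) \<partial>leb01)" .
qed

text \<open>A small derivative of the energy in the direction of \<open>w\<close> itself forces \<open>w\<close> to be small.\<close>
lemma norm_le_slope:
  assumes e: "e > 0"
  shows "norm w \<le> e + (1 + 1 / e) * re (pairing w (slope w))"
proof -
  obtain f where f: "integrable leb01 f" "w = abs_L1 f" by (rule abs_L1_cases)
  have int: "integrable leb01 (\<lambda>x. (1 + 1 / e) * ((f x \<bullet> f x) / psi (f x)))"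
    using re_pairing_slope(1)[OF f(1) f(1)] by (rule integrable_mult_right)
  have "norm w = (\<integral>x. norm (f x) \<partial>leb01)" using f by (simp add: norm_L1.abs_eq)
  also have "\<dots> \<le> (\<integral>x. e + (1 + 1 / e) * ((f x \<bullet> f x) / psi (f x)) \<partial>leb01)"
    using f int by (intro integral_mono norm_le_psi_square e Bochner_Integration.integrable_add) auto
  also have "\<dots> = e + (1 + 1 / e) * re (pairing w (slope w))"
  proof -
    have "(\<integral>x. (1 + 1 / e) * ((f x \<bullet> f x) / psi (f x)) \<partial>leb01) = (1 + 1 / e) * re (pairing w (slope w))"
      unfolding f(2) re_pairing_slope(2)[OF f(1) f(1)] by (rule integral_mult_right_zero)
    then show ?thesis
      using int leb01.prob_space by (subst Bochner_Integration.integral_add) auto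
  qed
  finally show ?thesis .
qed

text \<open>The quadratic bound is used where \<open>|v| \<le> M\<close>, and the linear one on the remaining small set \<open>E\<close>.\<close>
lemma energy_upper:
  fixes w v :: "'k::{scalar, euclidean_space} L1"
  assumes t: "0 \<le> t" and M: "M > 0"
  obtains E where "E \<in> sets leb01" "M * mu E \<le> norm v"
    "energy (w + t *\<^sub>R v) \<le> energy w + t * re (pairing v (slope w)) + t\<^sup>2 * M * norm v + 2 * t * norm (cut_L1 E v)"
proof -
  obtain f where f: "integrable leb01 f" "w = abs_L1 f" by (rule abs_L1_cases)
  obtain g where g: "integrable leb01 g" "v = abs_L1 g" by (rule abs_L1_cases)
  have [measurable]: "g \<in> borel_measurable leb01" using g by auto
  define E where "E = {x\<in>space leb01. M < norm (g x)}"
  have E: "E \<in> sets leb01" unfolding E_def by measurable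
  have "M * mu E = (\<integral>x. M * indicator E x \<partial>leb01)"
    using sets_leb01D[OF E] by (simp add: Int_absorb2)
  also have "\<dots> \<le> (\<integral>x. norm (g x) \<partial>leb01)"
    using E g(1) M by (intro integral_mono integrable_norm integrable_mult_right integrable_real_indicator)
      (auto simp: leb01.emeasure_eq_measure E_def indicator_def)
  also have "\<dots> = norm v" using g by (simp add: norm_L1.abs_eq)
  finally have 1: "M * mu E \<le> norm v" .
  let ?r = "\<lambda>x. psi (f x) + t * ((f x \<bullet> g x) / psi (f x)) + (t\<^sup>2 * M * norm (g x) + 2 * t * norm (cutf E g x))"
  have pt: "psi (f x + t *\<^sub>R g x) \<le> ?r x" if x: "x \<in> space leb01" for x
  proof (cases "x \<in> E")
    case True
    then have "cutf E g x = g x" using E by (simp add: cutf_def)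
    moreover have "0 \<le> t\<^sup>2 * M * norm (g x)" using M by simp
    ultimately show ?thesis using psi_upper'[of "f x" "t *\<^sub>R g x"] t by simp
  next
    case False
    then have "norm (g x) \<le> M" using x by (simp add: E_def)
    then have "t\<^sup>2 * (norm (g x) * norm (g x)) \<le> t\<^sup>2 * (M * norm (g x))"
      by (intro mult_left_mono mult_right_mono) auto
    then have "(t *\<^sub>R g x) \<bullet> (t *\<^sub>R g x) \<le> t\<^sup>2 * M * norm (g x)"
      by (simp add: dot_square_norm power2_eq_square mult_ac)
    moreover have "0 \<le> 2 * t * norm (cutf E g x)" using t by simp
    ultimately show ?thesis using psi_upper[of "f x" "t *\<^sub>R g x"] by simp
  qed
  have i2: "integrable leb01 (\<lambda>x. t * ((f x \<bullet> g x) / psi (f x)))"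
    by (intro integrable_mult_right re_pairing_slope f g)
  have i3: "integrable leb01 (\<lambda>x. t\<^sup>2 * M * norm (g x))" "integrable leb01 (\<lambda>x. 2 * t * norm (cutf E g x))"
    using g by (auto intro!: integrable_mult_right integrable_norm integrable_cutf)
  note i1 = integrable_psi[OF f(1)]
  have "energy (w + t *\<^sub>R v) = (\<integral>x. psi (f x + t *\<^sub>R g x) \<partial>leb01)"
    using f g by (simp add: plus_L1.abs_eq scaleR_L1.abs_eq energy_abs)
  also have "\<dots> \<le> (\<integral>x. ?r x \<partial>leb01)"
    using f g i1 i2 i3 pt by (intro integral_mono integrable_psi Bochner_Integration.integrable_add integrable_scaleR_right)
  also have "\<dots> = (\<integral>x. psi (f x) \<partial>leb01) + (\<integral>x. t * ((f x \<bullet> g x) / psi (f x)) \<partial>leb01)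
      + ((\<integral>x. t\<^sup>2 * M * norm (g x) \<partial>leb01) + (\<integral>x. 2 * t * norm (cutf E g x) \<partial>leb01))"
    using i1 i2 i3 by (simp only: Bochner_Integration.integral_add Bochner_Integration.integrable_add)
  also have "\<dots> = energy w + t * re (pairing v (slope w)) + (t\<^sup>2 * M * norm v + 2 * t * norm (cut_L1 E v))"
  proof -
    have "(\<integral>x. t * ((f x \<bullet> g x) / psi (f x)) \<partial>leb01) = t * re (pairing v (slope w))"
      unfolding f(2) g(2) re_pairing_slope(2)[OF f(1) g(1)] by (rule integral_mult_right_zero)
    then show ?thesis using f g by (simp add: energy_abs norm_L1.abs_eq cut_L1.abs_eq integrable_cutf)
  qed
  finally show ?thesis using that[OF E 1] by simp
qed

text \<open>Off the small set \<open>E\<close> both functions are bounded by \<open>M\<close>, and there the excess of the energy over its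
  tangent at \<open>a\<close> controls the square of \<open>|u - a|\<close>, hence \<open>|u - a|\<close> up to the error \<open>e / 4\<close>.\<close>
lemma energy_lower:
  fixes u a :: "'k::{scalar, euclidean_space} L1"
  assumes e: "e > 0" and M: "M > 0"
  obtains E where "E \<in> sets leb01" "M * mu E \<le> norm u + norm a"
    "norm (u - a) \<le> e / 4 + 2 * (1 + M\<^sup>2)\<^sup>2 / e * (energy u - energy a - re (pairing (u - a) (slope a))) + norm (cut_L1 E (u - a))"
proof -
  obtain f where f: "integrable leb01 f" "u = abs_L1 f" by (rule abs_L1_cases)
  obtain g where g: "integrable leb01 g" "a = abs_L1 g" by (rule abs_L1_cases)
  have [measurable]: "f \<in> borel_measurable leb01" "g \<in> borel_measurable leb01" using f g by auto
  define E where "E = {x\<in>space leb01. M < norm (f x) \<or> M < norm (g x)}"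
  have E: "E \<in> sets leb01" unfolding E_def by measurable
  have "M * mu E = (\<integral>x. M * indicator E x \<partial>leb01)"
    using sets_leb01D[OF E] by (simp add: Int_absorb2)
  also have "\<dots> \<le> (\<integral>x. norm (f x) + norm (g x) \<partial>leb01)"
  proof (intro integral_mono integrable_mult_right integrable_real_indicator)
    show "M * indicator E x \<le> norm (f x) + norm (g x)" for x
      using M by (auto simp: E_def indicator_def intro: add_increasing add_increasing2)
  qed (use E f g in \<open>auto simp: leb01.emeasure_eq_measure\<close>)
  also have "\<dots> = norm u + norm a" using f g by (simp add: norm_L1.abs_eq)
  finally have 1: "M * mu E \<le> norm u + norm a" .
  define C where "C = 2 * (1 + M\<^sup>2)\<^sup>2"
  have "1 + M\<^sup>2 > 0" by (simp add: add_pos_nonneg)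
  then have C: "C > 0" unfolding C_def by simp
  define d where "d x = f x - g x" for x
  have d: "integrable leb01 d" "u - a = abs_L1 d" unfolding d_def using f g by (auto simp: minus_L1.abs_eq)
  let ?B = "\<lambda>x. psi (f x) - psi (g x) - (g x \<bullet> d x) / psi (g x)"
  have B: "(d x \<bullet> d x) / (2 * psi (f x) * (psi (g x))\<^sup>2) \<le> ?B x" for x
    using psi_lower[of "g x" "f x"] by (simp add: d_def)
  have B0: "0 \<le> ?B x" for x
    using B[of x] psi_pos[of "f x"] by (rule_tac order_trans[OF _ B]) (simp add: less_imp_le)
  have pt: "norm (d x) \<le> e / 4 + C / e * ?B x + norm (cutf E d x)" if x: "x \<in> space leb01" for x
  proof (cases "x \<in> E")
    case True
    then have "cutf E d x = d x" using E by (simp add: cutf_def)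
    then show ?thesis using e C B0[of x] by simp
  next
    case False
    then have fg: "norm (f x) \<le> M" "norm (g x) \<le> M" using x by (auto simp: E_def not_less)
    have small: "(psi v)\<^sup>2 \<le> 1 + M\<^sup>2" if "norm v \<le> M" for v :: 'k
      using psi_square[of v] power_mono[OF that, of 2] by (simp add: power2_eq_square dot_square_norm)
    have "psi (f x) \<le> (psi (f x))\<^sup>2" using psi_ge_1[of "f x"] by (simp add: power2_eq_square)
    then have "2 * psi (f x) * (psi (g x))\<^sup>2 \<le> 2 * (1 + M\<^sup>2) * (1 + M\<^sup>2)"
      using small[OF fg(1)] small[OF fg(2)] psi_pos[of "f x"] by (intro mult_mono) auto
    also have "\<dots> = C" by (simp add: C_def power2_eq_square)
    finally have "(d x \<bullet> d x) / C \<le> (d x \<bullet> d x) / (2 * psi (f x) * (psi (g x))\<^sup>2)"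
      using psi_pos[of "f x"] psi_pos[of "g x"] C by (intro divide_left_mono) auto
    then have "(d x \<bullet> d x) / C \<le> ?B x" using B[of x] by (rule order_trans)
    then have "d x \<bullet> d x \<le> ?B x * C" by (simp only: pos_divide_le_eq[OF C])
    then have dC: "d x \<bullet> d x \<le> C * ?B x" by (simp only: mult.commute[of C])
    have "0 \<le> (norm (d x) - e / 2)\<^sup>2" by simp
    then have "norm (d x) * e \<le> e / 4 * e + (norm (d x))\<^sup>2" by (simp add: power2_eq_square algebra_simps)
    also have "\<dots> \<le> e / 4 * e + C * ?B x" using dC by (simp add: dot_square_norm)
    finally have "norm (d x) \<le> e / 4 + C / e * ?B x" using e by (simp add: field_simps)
    then show ?thesis by (meson add_increasing2 norm_ge_zero)
  qed
  note i1 = integrable_psi[OF f(1)] integrable_psi[OF g(1)] re_pairing_slope(1)[OF g(1) d(1)]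
  have i2: "integrable leb01 (\<lambda>x. C / e * ?B x)"
    using i1 by (intro integrable_mult_right Bochner_Integration.integrable_diff)
  have i3: "integrable leb01 (\<lambda>x. norm (cutf E d x))" using d by (intro integrable_norm integrable_cutf)
  have IB: "(\<integral>x. ?B x \<partial>leb01) = energy u - energy a - re (pairing (u - a) (slope a))"
    using i1 f g re_pairing_slope(2)[OF g(1) d(1)]
    by (simp add: Bochner_Integration.integral_diff Bochner_Integration.integrable_diff energy_abs d(2)[symmetric, folded g(2)])
  have "norm (u - a) = (\<integral>x. norm (d x) \<partial>leb01)" using d by (simp add: norm_L1.abs_eq)
  also have "\<dots> \<le> (\<integral>x. e / 4 + C / e * ?B x + norm (cutf E d x) \<partial>leb01)"
    using integrable_norm[OF d(1)] i2 i3 pt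
    by (intro integral_mono Bochner_Integration.integrable_add leb01.integrable_const)
  also have "\<dots> = (\<integral>x. e / 4 \<partial>leb01) + (\<integral>x. C / e * ?B x \<partial>leb01) + (\<integral>x. norm (cutf E d x) \<partial>leb01)"
    using i2 i3 by (simp only: Bochner_Integration.integral_add Bochner_Integration.integrable_add leb01.integrable_const)
  also have "(\<integral>x. C / e * ?B x \<partial>leb01) = C / e * (\<integral>x. ?B x \<partial>leb01)" by (rule integral_mult_right_zero)
  also have "(\<integral>x. norm (cutf E d x) \<partial>leb01) = norm (cut_L1 E (u - a))"
    using d by (simp add: norm_L1.abs_eq cut_L1.abs_eq integrable_cutf)
  also have "(\<integral>x. e / 4 \<partial>leb01) = e / 4" using leb01.prob_space by simp
  finally show ?thesis using that[OF E 1] unfolding IB C_def by simp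
qed

section \<open>Approximation by means of the energy\<close>

lemma equi_integrableD:
  "equi_integrable K \<Longrightarrow> e > 0 \<Longrightarrow> \<exists>d>0. \<forall>f\<in>K. \<forall>A\<in>sets leb01. mu A < d \<longrightarrow> norm (cut_L1 A f) \<le> e"
  unfolding equi_integrable_def by simp

lemma cut_diff: "cut_L1 A (f - g) = cut_L1 A f - cut_L1 A g"
  using cut_add[of A "f - g" g] by simp

text \<open>A convex set that meets, up to \<open>e\<close>, every closed half-space through \<open>z\<close> comes close to \<open>z\<close> in norm;
  this is the Hahn--Banach theorem with an explicit functional.  Let \<open>x\<close> almost minimise the energy of
  \<open>x - z\<close> over \<open>K\<close>.  The derivative at \<open>x - z\<close> is then almost nonnegative towards any other point of \<open>K\<close>,
  in particular towards one that lies on the right side of the half-space given by this derivative.  So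
  the derivative in the direction \<open>x - z\<close> is small, and \<open>norm_le_slope\<close> applies.  Equi-integrability makes
  the second order error uniform in the choice of the other point.\<close>
theorem equi_integrable_separation:
  fixes K :: "'k::{scalar, euclidean_space} L1 set"
  assumes conv: "convex K" and equi: "equi_integrable K" and bd: "\<And>x. x \<in> K \<Longrightarrow> norm x \<le> b"
    and sep: "\<And>h e. e > 0 \<Longrightarrow> \<exists>x\<in>K. re (pairing (x - z) h) \<le> e"
  shows "z \<in> closure K"
proof -
  have dense: "\<exists>x\<in>K. norm (x - z) \<le> e" if e: "e > 0" for e
  proof -
    define k where "k = 1 + 2 / e"
    have pos: "k > 0" using e by (simp add: k_def add_pos_pos)
    \<comment> \<open>The estimates below add up to \<open>7 * \<beta>\<close>, and \<open>k\<close> is the factor in \<open>norm_le_slope\<close> for \<open>e / 2\<close>.\<close>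
    define \<beta> where "\<beta> = e / (14 * k)"
    have \<beta>: "\<beta> > 0" using e pos by (simp add: \<beta>_def)
    have \<beta>7: "k * (7 * \<beta>) = e / 2" using pos by (simp add: \<beta>_def)
    from equi_integrableD[OF equi \<beta>] obtain d where d0: "d > 0"
      "\<forall>f\<in>K. \<forall>A\<in>sets leb01. mu A < d \<longrightarrow> norm (cut_L1 A f) \<le> \<beta>" by (elim exE conjE)
    have d: "norm (cut_L1 A f) \<le> \<beta>" if "f \<in> K" "A \<in> sets leb01" "mu A < d" for f A
      using that d0(2) by blast
    obtain x0 where "x0 \<in> K" using sep[of 1 0] by auto
    then have b: "b \<ge> 0" using bd[of x0] norm_ge_zero[of x0] by linarith
    \<comment> \<open>Differences of points of \<open>K\<close> have norm at most \<open>2 * b\<close>, so they exceed \<open>M\<close> only on a set smaller than \<open>d\<close>.\<close>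
    define M where "M = (2 * b + 1) / d"
    have M: "M > 0" using b d0(1) by (simp add: M_def)
    \<comment> \<open>A step so short that the quadratic error is at most \<open>\<beta>\<close> times its length.\<close>
    define t where "t = min 1 (\<beta> / (2 * b * M + 1))"
    have bM: "2 * b * M + 1 > 0" using b M by (simp add: add_nonneg_pos)
    have t: "0 < t" "t \<le> 1" using \<beta> bM by (simp_all add: t_def)
    have tM: "t * (2 * b * M) \<le> \<beta>"
    proof -
      have "t * (2 * b * M) \<le> t * (2 * b * M + 1)" using t by simp
      also have "\<dots> \<le> \<beta> / (2 * b * M + 1) * (2 * b * M + 1)" using bM by (intro mult_right_mono) (auto simp: t_def)
      also have "\<dots> = \<beta>" using bM by simp
      finally show ?thesis .
    qed
    define m where "m = Inf ((\<lambda>x. energy (x - z)) ` K)"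
    have m_le: "m \<le> energy (x - z)" if "x \<in> K" for x
      unfolding m_def using that by (intro cInf_lower bdd_belowI[of _ 0]) (auto simp: energy_nonneg)
    have "\<exists>y\<in>(\<lambda>x. energy (x - z)) ` K. y < m + t * \<beta>"
      by (rule cInf_lessD) (use \<open>x0 \<in> K\<close> t \<beta> in \<open>auto simp: m_def\<close>)
    then obtain x where x: "x \<in> K" "energy (x - z) < m + t * \<beta>" by auto
    let ?w = "x - z"
    obtain y where y: "y \<in> K" "re (pairing (y - z) (slope ?w)) \<le> \<beta>" using sep[OF \<beta>] by blast
    let ?v = "y - x"
    have nv: "norm ?v \<le> 2 * b" using norm_triangle_ineq4[of y x] bd[OF x(1)] bd[OF y(1)] by simp
    obtain E where E: "E \<in> sets leb01" "M * mu E \<le> norm ?v"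
      "energy (?w + t *\<^sub>R ?v) \<le> energy ?w + t * re (pairing ?v (slope ?w)) + t\<^sup>2 * M * norm ?v + 2 * t * norm (cut_L1 E ?v)"
      by (rule energy_upper[OF less_imp_le[OF t(1)] M])
    have "mu E < d"
    proof (rule ccontr)
      assume "\<not> mu E < d"
      then have "(2 * b + 1) / d * d \<le> M * mu E" unfolding M_def using d0(1) b by (intro mult_left_mono) auto
      then show False using E(2) nv d0(1) by simp
    qed
    then have "norm (cut_L1 E ?v) \<le> 2 * \<beta>"
      using d[OF x(1) E(1)] d[OF y(1) E(1)] norm_triangle_ineq4[of "cut_L1 E y" "cut_L1 E x"] by (simp add: cut_diff)
    then have c1: "2 * t * norm (cut_L1 E ?v) \<le> t * (4 * \<beta>)" using t by simp
    have "t\<^sup>2 * M * norm ?v \<le> t\<^sup>2 * M * (2 * b)" using M nv by (intro mult_left_mono) auto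
    also have "\<dots> = t * (t * (2 * b * M))" by (simp add: power2_eq_square)
    also have "\<dots> \<le> t * \<beta>" using t tM by (intro mult_left_mono) auto
    finally have c2: "t\<^sup>2 * M * norm ?v \<le> t * \<beta>" .
    have "(1 - t) *\<^sub>R x + t *\<^sub>R y \<in> K" using t by (intro convexD[OF conv x(1) y(1)]) auto
    moreover have "(1 - t) *\<^sub>R x + t *\<^sub>R y - z = ?w + t *\<^sub>R ?v" by (simp add: algebra_simps)
    ultimately have "m \<le> energy (?w + t *\<^sub>R ?v)" using m_le by metis
    then have "0 \<le> t * (re (pairing ?v (slope ?w)) + 6 * \<beta>)"
      using E(3) c1 c2 x(2) by (simp add: algebra_simps)
    then have "- 6 * \<beta> \<le> re (pairing ?v (slope ?w))" using t by (simp add: zero_le_mult_iff)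
    moreover have "pairing ?w (slope ?w) = pairing (y - z) (slope ?w) - pairing ?v (slope ?w)"
      by (simp add: pairing.diff_left)
    ultimately have "re (pairing ?w (slope ?w)) \<le> 7 * \<beta>" using y(2) by (simp add: re_diff)
    then have "k * re (pairing ?w (slope ?w)) \<le> k * (7 * \<beta>)"
      using pos by (intro mult_left_mono) auto
    then have "norm ?w \<le> e" using norm_le_slope[of "e / 2" ?w] e \<beta>7 by (simp add: k_def)
    then show ?thesis using x(1) by blast
  qed
  show ?thesis
    unfolding closure_approachable dist_norm
  proof (intro allI impI)
    fix e :: real assume "e > 0"
    then show "\<exists>x\<in>K. norm (x - z) < e" using dense[of "e / 2"] by force
  qed
qed

lemma chi_Un:
  "A \<in> sets leb01 \<Longrightarrow> B \<in> sets leb01 \<Longrightarrow> A \<inter> B = {} \<Longrightarrow> chi_L1 (A \<union> B) = chi_L1 A + chi_L1 B"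
  by (simp add: chi_eq cut_Un)

lemma chi_null: "A \<in> sets leb01 \<Longrightarrow> mu A = 0 \<Longrightarrow> chi_L1 A = 0"
  by (simp add: chi_eq cut_null)

text \<open>Dentability of the set of averages \<open>S (chi_L1 D) / mu D\<close>.  Choose \<open>A\<close> such that the energy of its average
  is within \<open>\<gamma>\<close> of the supremum.  If no subset of \<open>A\<close> had small oscillation, then \<open>A\<close> could be exhausted
  by sets whose averages differ from the one over \<open>A\<close> by more than \<open>e\<close>.  These averages have the average
  over \<open>A\<close> as their mean, so strict convexity (\<open>gain\<close>) makes the energy of some of them larger than the
  supremum.\<close>
lemma small_oscillation:
  fixes S :: "'k::{scalar, euclidean_space} L1 \<Rightarrow>\<^sub>L 'k L1"
  assumes equi: "equi_integrable (S ` cball 0 1)"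
    and A0: "A0 \<in> sets leb01" "mu A0 > 0" and e: "e > 0"
  shows "\<exists>B\<in>sets leb01. B \<subseteq> A0 \<and> mu B > 0 \<and>
    (\<exists>a. \<forall>D\<in>sets leb01. D \<subseteq> B \<longrightarrow> norm (S (chi_L1 D) - mu D *\<^sub>R a) \<le> e * mu D)"
proof -
  define avg where "avg D = S ((1 / mu D) *\<^sub>R chi_L1 D)" for D
  have unit: "norm ((1 / mu D) *\<^sub>R chi_L1 D :: 'k L1) \<le> 1" if "D \<in> sets leb01" for D
    using that by (simp add: norm_chi)
  have avg_in: "avg D \<in> S ` cball 0 1" if "D \<in> sets leb01" for D
    unfolding avg_def using unit[OF that] by (intro imageI) (simp add: mem_cball_0)
  have n_avg: "norm (avg D) \<le> norm S" if "D \<in> sets leb01" for D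
  proof -
    have "norm (avg D) \<le> norm S * norm ((1 / mu D) *\<^sub>R chi_L1 D :: 'k L1)" unfolding avg_def by (rule norm_blinfun)
    also have "\<dots> \<le> norm S * 1" by (intro mult_left_mono unit that) simp
    finally show ?thesis by simp
  qed
  have avg_mult: "mu D *\<^sub>R avg D = S (chi_L1 D)" if "D \<in> sets leb01" for D
  proof (cases "mu D = 0")
    case True
    then show ?thesis using chi_null[OF that True, where ?'a = 'k] by (simp add: blinfun.zero_right)
  qed (simp add: avg_def blinfun.scaleR_right)
  have "e / 8 > 0" using e by simp
  from equi_integrableD[OF equi this] obtain d where d0: "d > 0"
    "\<forall>f\<in>S ` cball 0 1. \<forall>A\<in>sets leb01. mu A < d \<longrightarrow> norm (cut_L1 A f) \<le> e / 8" by (elim exE conjE)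
  have d: "norm (cut_L1 A f) \<le> e / 8" if "f \<in> S ` cball 0 1" "A \<in> sets leb01" "mu A < d" for f A
    using that d0(2) by blast
  define M where "M = (2 * norm S + 1) / d"
  have M: "M > 0" using d0(1) by (simp add: M_def add_nonneg_pos)
  define C where "C = 2 * (1 + M\<^sup>2)\<^sup>2"
  have "1 + M\<^sup>2 > 0" by (simp add: add_pos_nonneg)
  then have C: "C > 0" unfolding C_def by simp
  define \<gamma> where "\<gamma> = e\<^sup>2 / (2 * C)"
  have \<gamma>: "\<gamma> > 0" using e C by (simp add: \<gamma>_def)
  have gain: "energy (avg A) + re (pairing (avg D - avg A) (slope (avg A))) + \<gamma> \<le> energy (avg D)"
    if AD: "A \<in> sets leb01" "D \<in> sets leb01" "norm (avg D - avg A) > e" for A D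
  proof -
    obtain E where E: "E \<in> sets leb01" "M * mu E \<le> norm (avg D) + norm (avg A)"
      "norm (avg D - avg A) \<le> e / 4 + 2 * (1 + M\<^sup>2)\<^sup>2 / e * (energy (avg D) - energy (avg A)
         - re (pairing (avg D - avg A) (slope (avg A)))) + norm (cut_L1 E (avg D - avg A))"
      by (rule energy_lower[OF e M])
    have "mu E < d"
    proof (rule ccontr)
      assume "\<not> mu E < d"
      then have "(2 * norm S + 1) / d * d \<le> M * mu E" unfolding M_def using d0(1) by (intro mult_left_mono) auto
      then show False using E(2) n_avg[OF AD(1)] n_avg[OF AD(2)] d0(1) by simp
    qed
    then have "norm (cut_L1 E (avg D - avg A)) \<le> e / 4"
      using d[OF avg_in[OF AD(1)] E(1)] d[OF avg_in[OF AD(2)] E(1)]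
        norm_triangle_ineq4[of "cut_L1 E (avg D)" "cut_L1 E (avg A)"] by (simp add: cut_diff)
    with E(3) AD(3) have "e / 2 \<le> C / e * (energy (avg D) - energy (avg A) - re (pairing (avg D - avg A) (slope (avg A))))"
      unfolding C_def by linarith
    then have "\<gamma> \<le> energy (avg D) - energy (avg A) - re (pairing (avg D - avg A) (slope (avg A)))"
      using e C by (simp add: \<gamma>_def field_simps power2_eq_square)
    then show ?thesis by simp
  qed
  define s where "s = Sup ((\<lambda>D. energy (avg D)) ` {D\<in>sets leb01. D \<subseteq> A0 \<and> mu D > 0})"
  have s_upper: "energy (avg D) \<le> s" if "D \<in> sets leb01" "D \<subseteq> A0" "mu D > 0" for D
    unfolding s_def
  proof (intro cSup_upper bdd_aboveI[of _ "1 + norm S"])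
    fix x assume "x \<in> (\<lambda>D. energy (avg D)) ` {D\<in>sets leb01. D \<subseteq> A0 \<and> mu D > 0}"
    then obtain D where "D \<in> sets leb01" "x = energy (avg D)" by blast
    then show "x \<le> 1 + norm S" using energy_le[of "avg D"] n_avg[of D] by simp
  qed (use that in auto)
  have "\<exists>y\<in>(\<lambda>D. energy (avg D)) ` {D\<in>sets leb01. D \<subseteq> A0 \<and> mu D > 0}. s - \<gamma> < y"
    by (rule less_cSupD) (use A0 \<gamma> in \<open>auto simp: s_def\<close>)
  then obtain A where A: "A \<in> sets leb01" "A \<subseteq> A0" "mu A > 0" "s - \<gamma> < energy (avg A)" by auto
  define osc where "osc B a \<longleftrightarrow> (\<forall>D\<in>sets leb01. D \<subseteq> B \<longrightarrow> norm (S (chi_L1 D) - mu D *\<^sub>R a) \<le> e * mu D)" for B a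
  have "\<exists>B\<in>sets leb01. B \<subseteq> A0 \<and> mu B > 0 \<and> (\<exists>a. osc B a)"
  proof (rule ccontr)
    assume not: "\<not> ?thesis"
    define P where "P D \<longleftrightarrow> D \<in> sets leb01 \<and> D \<subseteq> A \<and> mu D > 0 \<and> norm (avg D - avg A) > e" for D
    have ex: "\<exists>D. P D \<and> D \<subseteq> B" if B: "B \<in> sets leb01" "B \<subseteq> A" "mu B > 0" for B
    proof -
      have "B \<subseteq> A0" using B A(2) by simp
      then have "\<not> osc B (avg A)" using not B by blast
      then obtain D where D: "D \<in> sets leb01" "D \<subseteq> B"
        "\<not> norm (S (chi_L1 D) - mu D *\<^sub>R avg A) \<le> e * mu D" unfolding osc_def by blast
      have eq: "S (chi_L1 D) - mu D *\<^sub>R avg A = mu D *\<^sub>R (avg D - avg A)"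
        using avg_mult[OF D(1)] by (simp add: scaleR_diff_right)
      have "mu D \<noteq> 0" using D(3) unfolding eq by auto
      then have "mu D > 0" by (simp add: less_le)
      moreover from this have "norm (avg D - avg A) > e" using D(3) unfolding eq by (simp add: mult.commute)
      ultimately show ?thesis using D B unfolding P_def by auto
    qed
    from leb01.exhaustion[of P] obtain D :: "nat \<Rightarrow> real set"
      where D': "(\<forall>n. D n \<in> sets leb01 \<and> (D n = {} \<or> P (D n))) \<and> disjoint_family D \<and>
        (\<forall>E\<in>sets leb01. P E \<longrightarrow> E \<inter> (\<Union>n. D n) = {} \<longrightarrow> mu E = 0)" ..
    then have D: "D n \<in> sets leb01" "D n = {} \<or> P (D n)" for n by simp_all
    have disj: "disjoint_family D" using D' by simp
    have DA: "D n \<subseteq> A" for n using D(2)[of n] by (auto simp: P_def)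
    define U where "U N = (\<Union>n<N. D n)" for N
    have U: "U N \<in> sets leb01" "U N \<subseteq> A" for N unfolding U_def using D(1) DA by auto
    define \<rho> where "\<rho> = energy (avg A) + \<gamma> - s"
    have \<rho>: "\<rho> > 0" using A(4) by (simp add: \<rho>_def)
    \<comment> \<open>The first order term of the energy, as a finitely additive function of the set; it vanishes on \<open>A\<close>.\<close>
    define L where "L E = re (pairing (S (chi_L1 E) - mu E *\<^sub>R avg A) (slope (avg A)))" for E
    have L_Un: "L (E \<union> F) = L E + L F" if "E \<in> sets leb01" "F \<in> sets leb01" "E \<inter> F = {}" for E F
      using that by (simp add: L_def chi_Un blinfun.add_right leb01.finite_measure_Union scaleR_add_left
          pairing.diff_left pairing.add_left re_add re_diff)
    have LD: "mu (D n) * \<rho> \<le> - L (D n)" for n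
      using D(2)[of n]
    proof
      assume "D n = {}"
      then show ?thesis using chi_null[of "{}", where ?'a = 'k] by (simp add: L_def blinfun.zero_right pairing.zero_left re_zero)
    next
      assume P: "P (D n)"
      have "\<rho> \<le> - re (pairing (avg (D n) - avg A) (slope (avg A)))"
      proof -
        have "energy (avg (D n)) \<le> s" using P A(2) by (intro s_upper) (auto simp: P_def)
        then show ?thesis using gain[OF A(1) D(1)[of n]] P by (simp add: P_def \<rho>_def)
      qed
      then have "mu (D n) * \<rho> \<le> mu (D n) * (- re (pairing (avg (D n) - avg A) (slope (avg A))))"
        by (intro mult_left_mono) auto
      also have "\<dots> = - L (D n)"
        by (simp add: L_def avg_mult[OF D(1), symmetric] pairing.scaleR_left re_scaleR flip: scaleR_diff_right)
      finally show ?thesis .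
    qed
    have LU: "mu (U N) * \<rho> \<le> - L (U N)" for N
    proof (induction N)
      case 0
      show ?case using chi_null[of "{}", where ?'a = 'k] by (simp add: U_def L_def blinfun.zero_right pairing.zero_left re_zero)
    next
      case (Suc N)
      have "U N \<inter> D N = {}" unfolding U_def by (rule partial_union_disjoint[OF disj order_refl])
      moreover have "U (Suc N) = U N \<union> D N" unfolding U_def by (simp add: lessThan_Suc Un_commute)
      ultimately show ?case using Suc LD[of N] U D(1) L_Un[of "U N" "D N"]
        by (simp add: leb01.finite_measure_Union algebra_simps)
    qed
    have LA: "L A = 0" using avg_mult[OF A(1)] by (simp add: L_def pairing.zero_left re_zero)
    define k where "k = 2 * norm S * norm (slope (avg A))"
    have Lk: "L E \<le> k * mu E" if E: "E \<in> sets leb01" for E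
    proof -
      have "L E \<le> norm (S (chi_L1 E) - mu E *\<^sub>R avg A) * norm (slope (avg A))"
        unfolding L_def by (meson re_le_norm abs_le_D1 norm_pairing order_trans)
      also have "norm (S (chi_L1 E) - mu E *\<^sub>R avg A) \<le> norm S * mu E + mu E * norm S"
      proof (rule order_trans[OF norm_triangle_ineq4 add_mono])
        show "norm (S (chi_L1 E)) \<le> norm S * mu E" using norm_blinfun[of S "chi_L1 E"] norm_chi[OF E, where 'k = 'k] by simp
        show "norm (mu E *\<^sub>R avg A) \<le> mu E * norm S" using n_avg[OF A(1)] by (simp add: mult_left_mono)
      qed
      finally show ?thesis by (simp add: k_def mult_right_mono algebra_simps)
    qed
    have key: "mu (U N) * \<rho> \<le> k * (mu A - mu (U N))" for N
    proof -
      have "L A = L (U N) + L (A - U N)"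
        using L_Un[of "U N" "A - U N"] U A(1) by (simp add: Un_absorb1)
      then have "mu (U N) * \<rho> \<le> L (A - U N)" using LU[of N] LA by simp
      also have "\<dots> \<le> k * mu (A - U N)" using U A(1) by (intro Lk) auto
      also have "mu (A - U N) = mu A - mu (U N)" using U A(1) by (intro leb01.finite_measure_Diff) auto
      finally show ?thesis .
    qed
    have UD: "(\<Union>n. D n) \<in> sets leb01" using D(1) by auto
    have "mu (A - (\<Union>n. D n)) = 0"
    proof (rule ccontr)
      assume "mu (A - (\<Union>n. D n)) \<noteq> 0"
      then obtain E where E: "P E" "E \<subseteq> A - (\<Union>n. D n)"
        using ex[of "A - (\<Union>n. D n)"] A(1) UD by (auto simp: less_le)
      have "E \<in> sets leb01" "E \<inter> (\<Union>n. D n) = {}" using E by (auto simp: P_def)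
      then have "mu E = 0" using D' E(1) by blast
      then show False using E(1) by (simp add: P_def)
    qed
    then have muUD: "mu (\<Union>n. D n) = mu A"
      using leb01.finite_measure_Diff[OF A(1) UD UN_least[OF DA]] by simp
    have lim: "(\<lambda>N. mu (U N)) \<longlonglongrightarrow> mu A"
      using mu_partial_unions[of D] D(1) muUD unfolding U_def by simp
    have "mu A * \<rho> \<le> k * (mu A - mu A)"
    proof (rule LIMSEQ_le)
      show "(\<lambda>N. mu (U N) * \<rho>) \<longlonglongrightarrow> mu A * \<rho>" by (intro tendsto_intros lim)
      show "(\<lambda>N. k * (mu A - mu (U N))) \<longlonglongrightarrow> k * (mu A - mu A)" by (intro tendsto_intros lim)
    qed (use key in auto)
    then show False using \<rho> A(3) by (simp add: mult_le_0_iff)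
  qed
  then show ?thesis unfolding osc_def .
qed

lemma oscillation_partition:
  fixes S :: "'k::{scalar, euclidean_space} L1 \<Rightarrow>\<^sub>L 'k L1"
  assumes equi: "equi_integrable (S ` cball 0 1)" and e: "e > 0"
  shows "\<exists>(D :: nat \<Rightarrow> real set) a. (\<forall>n. D n \<in> sets leb01) \<and> disjoint_family D \<and> mu (\<Union>n. D n) = 1 \<and>
    (\<forall>n. \<forall>E\<in>sets leb01. E \<subseteq> D n \<longrightarrow> norm (S (chi_L1 E) - mu E *\<^sub>R a n) \<le> e * mu E)"
proof -
  define osc where "osc B a \<longleftrightarrow> (\<forall>E\<in>sets leb01. E \<subseteq> B \<longrightarrow> norm (S (chi_L1 E) - mu E *\<^sub>R a) \<le> e * mu E)" for B a
  define P where "P B \<longleftrightarrow> B \<in> sets leb01 \<and> mu B > 0 \<and> (\<exists>a. osc B a)" for B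
  from leb01.exhaustion[of P] obtain D :: "nat \<Rightarrow> real set"
    where D': "(\<forall>n. D n \<in> sets leb01 \<and> (D n = {} \<or> P (D n))) \<and> disjoint_family D \<and>
      (\<forall>E\<in>sets leb01. P E \<longrightarrow> E \<inter> (\<Union>n. D n) = {} \<longrightarrow> mu E = 0)" ..
  then have D: "D n \<in> sets leb01" "D n = {} \<or> P (D n)" for n by simp_all
  have UD: "(\<Union>n. D n) \<in> sets leb01" using D(1) by auto
  have "mu (compl (\<Union>n. D n)) = 0"
  proof (rule ccontr)
    assume "mu (compl (\<Union>n. D n)) \<noteq> 0"
    then have pos: "mu (compl (\<Union>n. D n)) > 0" by (simp add: less_le)
    obtain B where B: "B \<in> sets leb01" "B \<subseteq> compl (\<Union>n. D n)" "mu B > 0" "\<exists>a. osc B a"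
      using small_oscillation[OF equi sets_compl[OF UD] pos e] unfolding osc_def by blast
    then have "P B" "B \<inter> (\<Union>n. D n) = {}" by (auto simp: P_def)
    then have "mu B = 0" using D' B(1) by blast
    then show False using B(3) by simp
  qed
  then have "mu (\<Union>n. D n) = 1" using leb01.prob_compl[OF UD] by simp
  moreover have "\<exists>a. osc (D n) a" for n
    using D(2)[of n]
  proof
    assume "D n = {}"
    then have "osc (D n) 0"
      using chi_null[of "{}", where ?'a = 'k] by (auto simp: osc_def blinfun.zero_right)
    then show ?thesis ..
  qed (auto simp: P_def)
  then obtain a where "\<And>n. osc (D n) (a n)" by metis
  ultimately show ?thesis using D D' unfolding osc_def by blast
qed

lemma pairing_chi_unit:
  assumes "A \<in> sets leb01"
  shows "pairing (chi_L1 A) one_Linf = (of_real (mu A) :: 'k::scalar)"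
proof -
  have A: "A \<inter> {0<..<1} = A" using sets_leb01D[OF assms] by auto
  have i1: "integrable leb01 (indicator A :: real \<Rightarrow> real)"
    using assms by (intro integrable_real_indicator) (auto simp: leb01.emeasure_eq_measure)
  have "pairing (cut_L1 A (embed one_Linf)) one_Linf = (\<integral>x. cutf A (\<lambda>_. 1) x * 1 \<partial>leb01 :: 'k)"
    by transfer simp
  also have "\<dots> = (\<integral>x. indicator A x *\<^sub>R 1 \<partial>leb01)" using assms by (simp add: cutf_eq)
  also have "\<dots> = (\<integral>x. indicator A x \<partial>leb01) *\<^sub>R 1" using i1 by (intro integral_scaleR_left) auto
  finally show ?thesis using A by (simp add: chi_eq of_real_def)
qed

text \<open>The operator maps \<open>f\<close> to the sum of \<open>(\<integral> f over D n) x n\<close>, which converges absolutely.\<close>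
lemma partition_operator:
  fixes x :: "nat \<Rightarrow> 'k::scalar L1"
  assumes D: "\<And>n. D n \<in> sets leb01" "disjoint_family D" and x: "\<And>n. norm (x n) \<le> c"
  shows "\<exists>B\<in>operators scale_L1. \<forall>n. \<forall>E\<in>sets leb01. E \<subseteq> D n \<longrightarrow> B (chi_L1 E) = mu E *\<^sub>R x n"
proof -
  define p where "p n f = pairing (cut_L1 (D n) f) one_Linf" for n and f :: "'k L1"
  define b where "b f = (\<Sum>n. scale_L1 (p n f) (x n))" for f
  have c: "0 \<le> c" using x[of 0] norm_ge_zero order_trans by blast
  have norm_p: "norm (p n f) \<le> norm (cut_L1 (D n) f)" for n f
  proof -
    have "norm (p n f) \<le> norm (cut_L1 (D n) f) * norm (one_Linf :: 'k Linf)" unfolding p_def by (rule norm_pairing)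
    also have "\<dots> \<le> norm (cut_L1 (D n) f) * 1" by (intro mult_left_mono norm_one_Linf) simp
    finally show ?thesis by simp
  qed
  have term_le: "norm (scale_L1 (p n f) (x n)) \<le> norm (cut_L1 (D n) f) * c" for n f
    unfolding norm_scale_L1 using norm_p x c by (intro mult_mono) auto
  have part: "(\<Sum>n<N. norm (cut_L1 (D n) f)) \<le> norm f" for N f
  proof -
    have "(\<Sum>n<N. norm (cut_L1 (D n) f)) = norm (cut_L1 (\<Union>n<N. D n) f)"
      using D by (intro norm_cut_UN[symmetric]) (auto simp: disjoint_family_on_def)
    then show ?thesis by (simp add: norm_cut_le)
  qed
  have sm: "summable (\<lambda>n. norm (cut_L1 (D n) f))" for f
    by (intro summableI_nonneg_bounded[of _ "norm f"] part) simp
  have sm': "summable (\<lambda>n. norm (scale_L1 (p n f) (x n)))" for f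
    by (rule summable_comparison_test'[OF summable_mult2[OF sm[of f], of c], of 0]) (simp add: term_le)
  note sm'' = summable_norm_cancel[OF sm']
  have bl: "bounded_linear b"
  proof (rule bounded_linear_intro)
    show "b (f + g) = b f + b g" for f g
      unfolding b_def suminf_add[OF sm''[of f] sm''[of g]]
      by (simp add: p_def cut_add pairing_add_left scale_L1_simps)
    show "b (r *\<^sub>R f) = r *\<^sub>R b f" for r f
    proof -
      have "p n (r *\<^sub>R f) = of_real r * p n f" for n
        by (simp add: p_def cut_scaleR pairing_scaleR_left scaleR_conv_of_real)
      then have "scale_L1 (p n (r *\<^sub>R f)) (x n) = r *\<^sub>R scale_L1 (p n f) (x n)" for n
        by (simp only: scale_L1_simps(3)[symmetric] scale_L1_of_real)
      then show ?thesis unfolding b_def by (simp add: suminf_scaleR_right[OF sm''])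
    qed
    show "norm (b f) \<le> norm f * c" for f
    proof -
      have "norm (b f) \<le> (\<Sum>n. norm (scale_L1 (p n f) (x n)))" unfolding b_def by (rule summable_norm[OF sm'])
      also have "\<dots> \<le> (\<Sum>n. norm (cut_L1 (D n) f) * c)"
        by (intro suminf_le term_le sm' summable_mult2 sm)
      also have "\<dots> = (\<Sum>n. norm (cut_L1 (D n) f)) * c" by (rule suminf_mult2[OF sm, symmetric])
      also have "\<dots> \<le> norm f * c" by (intro mult_right_mono suminf_le_const sm part c)
      finally show ?thesis .
    qed
  qed
  then have ap: "blinfun_apply (Blinfun b) = b" by (rule bounded_linear_Blinfun_apply)
  have "b (scale_L1 r f) = scale_L1 r (b f)" for r f
    unfolding b_def bounded_linear.suminf[OF bounded_linear_scale_L1 sm'']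
    by (simp add: p_def cut_scale pairing_scale_left scale_L1_simps)
  then have "Blinfun b \<in> operators scale_L1" by (simp add: operators_def ap)
  moreover have "b (chi_L1 E) = mu E *\<^sub>R x n" if E: "E \<in> sets leb01" "E \<subseteq> D n" for n E
  proof -
    have "scale_L1 (p m (chi_L1 E)) (x m) = (if m = n then mu E *\<^sub>R x n else 0)" for m
    proof (cases "m = n")
      case True
      then have "D m \<inter> E = E" using E by auto
      then show ?thesis using E D True by (simp add: p_def cut_chi pairing_chi_unit scale_L1_of_real)
    next
      case False
      then have "D m \<inter> E = {}" using E disjoint_family_onD[OF D(2), of m n] by auto
      then show ?thesis using E D False chi_null[of "{}", where ?'a = 'k] by (simp add: p_def cut_chi pairing.zero_left)
    qed
    then have "b (chi_L1 E) = (\<Sum>m. if m = n then mu E *\<^sub>R x n else 0)" unfolding b_def by simp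
    also have "\<dots> = mu E *\<^sub>R x n" using sums_single[of n "\<lambda>_. mu E *\<^sub>R x n"] by (rule sums_unique[symmetric])
    finally show ?thesis .
  qed
  ultimately show ?thesis using ap by (intro bexI[of _ "Blinfun b"]) auto
qed

lemma functional_pairing_operator:
  fixes F :: "'k::scalar Linf \<Rightarrow>\<^sub>L 'k Linf"
  shows "F \<in> operators scale_Linf \<Longrightarrow> functional (\<lambda>g. pairing y (F g))"
  by (intro functional_compose[OF functional_pairing] blinfun.bounded_linear_right) (simp add: operatorsD)

text \<open>Restrict the adjoint of \<open>F\<close> to \<open>L\<^sub>1\<close> and project the bidual onto \<open>L\<^sub>1\<close>.\<close>
lemma ac_operator:
  fixes F :: "'k::{scalar, euclidean_space} Linf \<Rightarrow>\<^sub>L 'k Linf"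
  assumes F: "F \<in> operators scale_Linf"
  shows "\<exists>C\<in>operators scale_L1. \<forall>y. ac_part (\<lambda>g. pairing y (F g)) (C y)"
proof -
  have "\<exists>h. ac_part (\<lambda>g. pairing y (F g)) h" for y
    by (intro ac_part_exists functional_pairing_operator F)
  then obtain C where C: "\<And>y. ac_part (\<lambda>g. pairing y (F g)) (C y)" by metis
  have add: "C (y + z) = C y + C z" for y z
  proof (rule ac_part_unique[OF C])
    show "ac_part (\<lambda>g. pairing (y + z) (F g)) (C y + C z)"
      using ac_part_add[OF C[of y] C[of z]] by (simp add: pairing_add_left)
  qed
  have scale: "C (scale_L1 c y) = scale_L1 c (C y)" for c y
  proof (rule ac_part_unique[OF C])
    show "ac_part (\<lambda>g. pairing (scale_L1 c y) (F g)) (scale_L1 c (C y))"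
      using ac_part_scale[OF C[of y], of c] by (simp add: pairing_scale_left)
  qed
  have "bounded_linear C"
  proof (rule bounded_linear_intro[OF add])
    show "C (r *\<^sub>R y) = r *\<^sub>R C y" for r y using scale[of "of_real r" y] by (simp add: scale_L1_of_real)
    show "norm (C y) \<le> norm y * norm F" for y
    proof (rule ac_part_norm[OF C])
      fix g
      have "norm (pairing y (F g)) \<le> norm y * norm (F g)" by (rule norm_pairing)
      also have "\<dots> \<le> norm y * (norm F * norm g)" by (intro mult_left_mono norm_blinfun) simp
      finally show "norm (pairing y (F g)) \<le> norm y * norm F * norm g" by (simp add: mult.assoc)
    qed simp
  qed
  then have ap: "blinfun_apply (Blinfun C) = C" by (rule bounded_linear_Blinfun_apply)
  then show ?thesis using C scale by (intro bexI[of _ "Blinfun C"]) (auto simp: operators_def)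
qed

lemma ac_part_near:
  assumes h: "ac_part \<phi> h" and near: "\<And>g. norm (pairing u g - \<phi> g) \<le> d * norm g" and d: "0 \<le> d"
  shows "norm (u - h) \<le> d"
proof -
  have "ac_part (\<lambda>g. pairing u g + (-1) * \<phi> g) (u + scale_L1 (-1) h)"
    by (intro ac_part_add ac_part_scale ac_part_pairing h)
  then have "norm (u + scale_L1 (-1) h) \<le> d" by (rule ac_part_norm) (use near d in auto)
  then show ?thesis using scale_L1_of_real[of "-1" h] by simp
qed

lemma is_adjointD: "is_adjoint T R \<Longrightarrow> pairing (blinfun_apply T f) g = pairing f (blinfun_apply R g)"
  by (simp add: is_adjoint_def)

text \<open>The functional \<open>\<phi>\<close> is an element of the bidual of \<open>L\<^sub>1\<close> and \<open>g \<mapsto> \<phi> (R g)\<close> is its image under the second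
  adjoint of \<open>T\<close>.  Equi-integrability makes this image absolutely continuous, so it is given by some
  \<open>z \<in> L\<^sub>1\<close>.  No half-space separates \<open>z\<close> from the image of the ball of radius \<open>c\<close>, since
  \<open>|\<phi> (R h)| \<le> c |R h|\<close> and \<open>|R h|\<close> is the supremum of \<open>|pairing (T x) h|\<close> over the unit ball.\<close>
lemma bidual_element_approx:
  fixes T :: "'k::{scalar, euclidean_space} L1 \<Rightarrow>\<^sub>L 'k L1"
  assumes T: "T \<in> operators scale_L1" and equi: "equi_integrable (T ` cball 0 1)"
    and R: "R \<in> operators scale_Linf" "is_adjoint T R"
    and \<phi>: "functional \<phi>" "\<And>g. norm (\<phi> g) \<le> c * norm g" and c: "c > 0" and e: "e > 0"
  shows "\<exists>x. norm x \<le> c \<and> (\<forall>g. norm (\<phi> (R g) - pairing (T x) g) \<le> e * norm g)"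
proof -
  define \<psi> where "\<psi> g = \<phi> (R g)" for g
  have \<psi>: "functional \<psi>"
    unfolding \<psi>_def by (intro functional_compose[OF \<phi>(1)] blinfun.bounded_linear_right) (simp add: operatorsD[OF R(1)])
  have cutbound: "norm (cut_L1 A (T f)) \<le> r * norm f"
    if "\<And>f. norm f \<le> 1 \<Longrightarrow> norm (cut_L1 A (T f)) \<le> r" for A f r
  proof (cases "f = 0")
    case False
    have "norm (cut_L1 A (T ((1 / norm f) *\<^sub>R f))) \<le> r" using False by (intro that) simp
    then show ?thesis using False by (simp add: blinfun.scaleR_right cut_scaleR divide_le_eq)
  qed (simp add: blinfun.zero_right bounded_linear.linear[OF bounded_linear_cut, THEN linear_0])
  have ac: "\<exists>d>0. \<forall>A\<in>sets leb01. mu A < d \<longrightarrow> (\<forall>g. norm (\<psi> (cut_Linf A g)) \<le> s * norm g)" if s: "s > 0" for s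
  proof -
    have "s / c > 0" using s c by simp
    from equi_integrableD[OF equi this] obtain d where d: "d > 0"
      "\<forall>f\<in>T ` cball 0 1. \<forall>A\<in>sets leb01. mu A < d \<longrightarrow> norm (cut_L1 A f) \<le> s / c" by (elim exE conjE)
    have "norm (\<psi> (cut_Linf A g)) \<le> s * norm g" if A: "A \<in> sets leb01" "mu A < d" for A g
    proof -
      have "norm (R (cut_Linf A g)) \<le> s / c * norm g"
      proof (rule norm_Linf_le_pairing)
        fix f
        have "norm (pairing f (R (cut_Linf A g))) = norm (pairing (cut_L1 A (T f)) g)"
          by (simp add: pairing_cut is_adjointD[OF R(2)])
        also have "\<dots> \<le> norm (cut_L1 A (T f)) * norm g" by (rule norm_pairing)
        also have "\<dots> \<le> (s / c * norm f) * norm g"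
          using d(2) A by (intro mult_right_mono cutbound) auto
        finally show "norm (pairing f (R (cut_Linf A g))) \<le> s / c * norm g * norm f" by (simp add: mult_ac)
      qed (use s c in simp)
      then have "c * norm (R (cut_Linf A g)) \<le> c * (s / c * norm g)" using c by (intro mult_left_mono) auto
      then show ?thesis using \<phi>(2)[of "R (cut_Linf A g)"] c by (simp add: \<psi>_def)
    qed
    then show ?thesis using d(1) by blast
  qed
  obtain z where "ac_part \<psi> z" using ac_part_exists[OF \<psi>] by blast
  then have z: "\<psi> g = pairing z g" for g using ac by (rule ac_part_eq_pairing[OF \<psi>])
  define K where "K = T ` cball 0 c"
  have "z \<in> closure K"
  proof (rule equi_integrable_separation)
    show "convex K" unfolding K_def
      by (intro convex_linear_image convex_cball bounded_linear.linear[OF blinfun.bounded_linear_right])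
    show "equi_integrable K"
      unfolding equi_integrable_def
    proof (intro allI impI)
      fix s :: real assume "s > 0"
      then have "s / c > 0" using c by simp
      from equi_integrableD[OF equi this] obtain d where d: "d > 0"
        "\<forall>f\<in>T ` cball 0 1. \<forall>A\<in>sets leb01. mu A < d \<longrightarrow> norm (cut_L1 A f) \<le> s / c" by (elim exE conjE)
      have "norm (cut_L1 A (T x)) \<le> s" if A: "A \<in> sets leb01" "mu A < d" and x: "norm x \<le> c" for A x
      proof -
        have "norm (cut_L1 A (T x)) \<le> s / c * norm x" using d(2) A by (intro cutbound) auto
        also have "\<dots> \<le> s / c * c" using x \<open>s / c > 0\<close> by (intro mult_left_mono) auto
        finally show ?thesis using c by simp
      qed
      then show "\<exists>d>0. \<forall>f\<in>K. \<forall>A\<in>sets leb01. mu A < d \<longrightarrow> norm (cut_L1 A f) \<le> s"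
        using d(1) unfolding K_def by auto
    qed
    show "norm x \<le> norm T * c" if xK: "x \<in> K" for x
    proof -
      obtain y where y: "x = T y" "norm y \<le> c" using xK unfolding K_def by auto
      have "norm x \<le> norm T * norm y" unfolding y(1) by (rule norm_blinfun)
      also have "\<dots> \<le> norm T * c" using y by (intro mult_left_mono) auto
      finally show ?thesis .
    qed
    fix h and s :: real assume s: "s > 0"
    \<comment> \<open>Otherwise \<open>R h\<close> would have a norm too small for the value of \<open>\<phi>\<close> at \<open>R h\<close>.\<close>
    show "\<exists>x\<in>K. re (pairing (x - z) h) \<le> s"
    proof (rule ccontr)
      assume not: "\<not> ?thesis"
      define q where "q = norm (\<psi> h) - s"
      have le: "norm (pairing x (R h)) \<le> q" if x: "norm x \<le> c" for x
      proof -
        obtain u where u: "norm u \<le> 1" "u * pairing x (R h) = of_real (norm (pairing x (R h)))"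
          by (rule rotate)
        have "norm (scale_L1 (- u) x) \<le> c" using mult_mono[OF u(1) x] by (simp add: norm_scale_L1)
        then have "T (scale_L1 (- u) x) \<in> K" unfolding K_def by (intro imageI) simp
        with not have "s < re (pairing (T (scale_L1 (- u) x) - z) h)" by (auto simp: not_le)
        also have "pairing (T (scale_L1 (- u) x) - z) h = - of_real (norm (pairing x (R h))) - \<psi> h"
          using u(2) by (simp add: pairing.diff_left pairing.minus_left z operatorsD[OF T] pairing_scale_left is_adjointD[OF R(2)])
        also have "re \<dots> = - norm (pairing x (R h)) - re (\<psi> h)"
          using re_diff[of 0 "of_real (norm (pairing x (R h)))"] by (simp add: re_diff re_of_real re_zero)
        finally show ?thesis using re_le_norm[of "\<psi> h"] by (simp add: q_def)
      qed
      have q: "0 \<le> q" using le[of 0] c by (simp add: pairing.zero_left)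
      have "norm (R h) \<le> q / c"
      proof (rule norm_Linf_le_pairing)
        fix f :: "'k L1"
        show "norm (pairing f (R h)) \<le> q / c * norm f"
        proof (cases "f = 0")
          case False
          have "norm (pairing ((c / norm f) *\<^sub>R f) (R h)) \<le> q" using False c by (intro le) simp
          then show ?thesis using False c by (simp add: pairing_scaleR_left field_simps)
        qed (simp add: pairing.zero_left)
      qed (use q c in simp)
      then have "c * norm (R h) \<le> q" using c by (simp add: field_simps)
      then show False using \<phi>(2)[of "R h"] s by (simp add: q_def \<psi>_def)
    qed
  qed
  then obtain w where w: "w \<in> K" "norm (w - z) < e"
    using e unfolding closure_approachable dist_norm by blast
  then obtain x where x: "w = T x" "norm x \<le> c" unfolding K_def by auto
  have "norm (\<phi> (R g) - pairing (T x) g) \<le> e * norm g" for g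
  proof -
    have "\<phi> (R g) - pairing (T x) g = pairing (z - w) g"
      using z[of g] by (simp add: \<psi>_def pairing.diff_left x(1))
    also have "norm \<dots> \<le> norm (z - w) * norm g" by (rule norm_pairing)
    also have "\<dots> \<le> e * norm g" using w(2) by (intro mult_right_mono) (auto simp: norm_minus_commute)
    finally show ?thesis .
  qed
  then show ?thesis using x(2) by blast
qed

section \<open>Descending from \<open>L\<^sub>\<infinity>\<close> to \<open>L\<^sub>1\<close>\<close>

text \<open>On a set \<open>A\<close> inside a piece \<open>D n\<close> three errors add up: \<open>S (chi_L1 A)\<close> differs from \<open>mu A\<close> times \<open>a n\<close>
  by \<open>e * mu A\<close>; \<open>a n\<close> differs by \<open>e\<close> from \<open>S f\<close>, where \<open>f\<close> is the normalised indicator of \<open>D n\<close>; and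
  \<open>S f\<close> differs by \<open>2 * e\<close> from \<open>C (T (x n))\<close>, because the functionals given by \<open>S f\<close> and by
  \<open>T (x n)\<close> after \<open>F\<close> differ by \<open>2 * e\<close>, and passing to the absolutely continuous part is a contraction
  that fixes the former.\<close>
theorem predual_factorization:
  fixes S T :: "'k::{scalar, euclidean_space} L1 \<Rightarrow>\<^sub>L 'k L1"
  assumes S: "S \<in> operators scale_L1" "equi_integrable (S ` cball 0 1)" "is_adjoint S Q"
    and T: "T \<in> operators scale_L1" "equi_integrable (T ` cball 0 1)"
    and R: "R \<in> operators scale_Linf" "is_adjoint T R"
    and EF: "E \<in> operators scale_Linf" "F \<in> operators scale_Linf"
    and near: "norm (Q - (E o\<^sub>L R o\<^sub>L F)) \<le> e" and e: "e > 0"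
  shows "\<exists>B\<in>operators scale_L1. \<exists>C\<in>operators scale_L1. norm (S - (C o\<^sub>L T o\<^sub>L B)) \<le> 4 * e"
proof -
  from oscillation_partition[OF S(2) e] obtain D :: "nat \<Rightarrow> real set" and a where
    D: "\<forall>n. D n \<in> sets leb01" "disjoint_family D" "mu (\<Union>n. D n) = 1"
    and osc: "\<forall>n. \<forall>E\<in>sets leb01. E \<subseteq> D n \<longrightarrow> norm (S (chi_L1 E) - mu E *\<^sub>R a n) \<le> e * mu E"
    by (elim exE conjE)
  obtain C where C: "C \<in> operators scale_L1"
    "\<And>y. ac_part (\<lambda>g. pairing y (F g)) (C y)"
    using ac_operator[OF EF(2)] by blast
  \<comment> \<open>A bound for \<open>E\<close> that is positive even if \<open>E = 0\<close>.\<close>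
  define c where "c = norm E + 1"
  have c: "c > 0" unfolding c_def by (simp add: add_nonneg_pos)
  have "\<exists>x. norm x \<le> c \<and> (mu (D n) > 0 \<longrightarrow> norm (a n - C (T x)) \<le> 3 * e)" for n
  proof (cases "mu (D n) > 0")
    case True
    have Dn: "D n \<in> sets leb01" using D(1) by simp
    define f where "f = (1 / mu (D n)) *\<^sub>R (chi_L1 (D n) :: 'k L1)"
    have f: "norm f = 1" using True Dn by (simp add: f_def norm_chi)
    \<comment> \<open>The accuracy that becomes at most \<open>e\<close> after applying \<open>F\<close>.\<close>
    define k where "k = e / (norm F + 1)"
    have k: "k > 0" using e by (simp add: k_def add_nonneg_pos)
    have kF: "k * norm F \<le> e"
    proof -
      have "k * norm F \<le> k * (norm F + 1)" using k by simp
      also have "norm F + 1 \<noteq> 0" using norm_ge_zero[of F] by linarith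
      then have "k * (norm F + 1) = e" by (simp add: k_def)
      finally show ?thesis .
    qed
    have "norm (pairing f (E g)) \<le> c * norm g" for g
    proof -
      have "norm (pairing f (E g)) \<le> 1 * (norm E * norm g)"
        using norm_pairing[of f "E g"] norm_blinfun[of E g] by (simp add: f)
      also have "\<dots> \<le> c * norm g" by (simp add: c_def distrib_right)
      finally show ?thesis .
    qed
    from bidual_element_approx[OF T R functional_pairing_operator[OF EF(1)] this c k]
    obtain x where x: "norm x \<le> c"
      "\<And>g. norm (pairing f (E (R g)) - pairing (T x) g) \<le> k * norm g" by blast
    have "norm (S f - C (T x)) \<le> 2 * e"
    proof (rule ac_part_near[OF C(2)])
      fix g
      have "pairing (S f) g - pairing (T x) (F g)
        = pairing f (blinfun_apply (Q - (E o\<^sub>L R o\<^sub>L F)) g) +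
          (pairing f (E (R (F g))) - pairing (T x) (F g))"
        by (simp add: is_adjointD[OF S(3)] blinfun.diff_left pairing.diff_right)
      also have "norm \<dots> \<le> e * norm g + k * (norm F * norm g)"
      proof (rule order_trans[OF norm_triangle_ineq add_mono])
        have "norm (pairing f (blinfun_apply (Q - (E o\<^sub>L R o\<^sub>L F)) g)) \<le> norm (blinfun_apply (Q - (E o\<^sub>L R o\<^sub>L F)) g)"
          using norm_pairing[of f] by (simp add: f)
        also have "\<dots> \<le> norm (Q - (E o\<^sub>L R o\<^sub>L F)) * norm g" by (rule norm_blinfun)
        also have "\<dots> \<le> e * norm g" by (intro mult_right_mono near) simp
        finally show "norm (pairing f (blinfun_apply (Q - (E o\<^sub>L R o\<^sub>L F)) g)) \<le> e * norm g" .
        show "norm (pairing f (E (R (F g))) - pairing (T x) (F g))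
            \<le> k * (norm F * norm g)"
          using k by (intro order_trans[OF x(2)] mult_left_mono norm_blinfun) auto
      qed
      also have "\<dots> \<le> e * norm g + e * norm g"
        using mult_right_mono[OF kF norm_ge_zero[of g]] by (simp add: mult.assoc)
      finally show "norm (pairing (S f) g - pairing (T x) (F g)) \<le> 2 * e * norm g"
        by simp
    qed (use e in simp)
    moreover have "norm (a n - S f) \<le> e"
    proof -
      have "norm (S (chi_L1 (D n)) - mu (D n) *\<^sub>R a n) \<le> e * mu (D n)" using osc Dn by blast
      also have "S (chi_L1 (D n)) - mu (D n) *\<^sub>R a n = mu (D n) *\<^sub>R (S f - a n)"
        using True by (simp add: f_def blinfun.scaleR_right scaleR_diff_right)
      finally show ?thesis using True by (simp add: norm_minus_commute mult.commute)
    qed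
    ultimately have "norm (a n - C (T x)) \<le> 3 * e"
      using norm_triangle_ineq[of "a n - S f" "S f - C (T x)"] by simp
    then show ?thesis using x(1) by blast
  next
    case False
    then show ?thesis using c by (intro exI[of _ 0]) simp
  qed
  then obtain x where x: "\<And>n. norm (x n) \<le> c"
    "\<And>n. mu (D n) > 0 \<Longrightarrow> norm (a n - C (T (x n))) \<le> 3 * e" by metis
  obtain B where B: "B \<in> operators scale_L1"
    "\<And>n A. A \<in> sets leb01 \<Longrightarrow> A \<subseteq> D n \<Longrightarrow> B (chi_L1 A) = mu A *\<^sub>R x n"
    using partition_operator[of D x c] D x(1) by blast
  define V where "V = S - (C o\<^sub>L T o\<^sub>L B)"
  have small: "norm (V (chi_L1 A)) \<le> 4 * e * mu A" if A: "A \<in> sets leb01" "A \<subseteq> D n" for A n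
  proof (cases "mu A = 0")
    case True
    then show ?thesis using chi_null[OF A(1) True, where ?'a = 'k] by (simp add: blinfun.zero_right)
  next
    case False
    then have pos: "mu A > 0" by (simp add: less_le)
    moreover have "mu A \<le> mu (D n)" using A D(1) by (intro mu_mono) auto
    ultimately have "mu (D n) > 0" by simp
    then have "norm (mu A *\<^sub>R (a n - C (T (x n)))) \<le> 3 * e * mu A"
      using mult_left_mono[OF x(2)[of n], of "mu A"] by (simp add: mult.commute)
    moreover have "norm (S (chi_L1 A) - mu A *\<^sub>R a n) \<le> e * mu A" using osc A by blast
    moreover have "V (chi_L1 A) = (S (chi_L1 A) - mu A *\<^sub>R a n) + mu A *\<^sub>R (a n - C (T (x n)))"
      using A by (simp add: V_def blinfun.diff_left B(2) blinfun.scaleR_right scaleR_diff_right)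
    ultimately show ?thesis
      using norm_triangle_ineq[of "S (chi_L1 A) - mu A *\<^sub>R a n" "mu A *\<^sub>R (a n - C (T (x n)))"] by simp
  qed
  define U where "U N = (\<Union>n<N. D n)" for N
  have U: "U N \<in> sets leb01" for N unfolding U_def using D(1) by auto
  have smallU: "norm (V (chi_L1 (A \<inter> U N))) \<le> 4 * e * mu (A \<inter> U N)" if A: "A \<in> sets leb01" for A N
  proof (induction N)
    case 0
    show ?case using chi_null[of "{}", where ?'a = 'k] by (simp add: U_def blinfun.zero_right)
  next
    case (Suc N)
    have "U N \<inter> D N = {}" unfolding U_def by (rule partial_union_disjoint[OF D(2) order_refl])
    then have disj: "(A \<inter> U N) \<inter> (A \<inter> D N) = {}" by auto
    have "A \<inter> U (Suc N) = (A \<inter> U N) \<union> (A \<inter> D N)" unfolding U_def lessThan_Suc by auto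
    moreover have sets: "A \<inter> U N \<in> sets leb01" "A \<inter> D N \<in> sets leb01" using A U D(1) by auto
    moreover have "norm (V (chi_L1 (A \<inter> D N))) \<le> 4 * e * mu (A \<inter> D N)" using sets by (intro small[of _ N]) auto
    ultimately show ?case
      using Suc disj norm_triangle_ineq[of "V (chi_L1 (A \<inter> U N))" "V (chi_L1 (A \<inter> D N))"]
      by (simp add: chi_Un blinfun.add_right leb01.finite_measure_Union algebra_simps)
  qed
  have lim: "(\<lambda>N. mu (U N)) \<longlonglongrightarrow> 1"
    using mu_partial_unions[of D] D(1,3) unfolding U_def by simp
  have V_chi: "norm (V (chi_L1 A)) \<le> 4 * e * mu A" if A: "A \<in> sets leb01" for A
  proof -
    have "norm (V (chi_L1 A)) \<le> 4 * e * mu A + norm V * (1 - mu (U N))" for N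
    proof -
      have AU: "A \<inter> U N \<in> sets leb01" "A - U N \<in> sets leb01" using A U by auto
      have "chi_L1 A = (chi_L1 (A \<inter> U N) + chi_L1 (A - U N) :: 'k L1)"
        using chi_Un[OF AU] by (simp add: Int_Diff_Un Int_Diff_disjoint)
      then have "norm (V (chi_L1 A)) \<le> norm (V (chi_L1 (A \<inter> U N))) + norm (V (chi_L1 (A - U N)))"
        by (simp add: blinfun.add_right norm_triangle_ineq)
      also have "\<dots> \<le> 4 * e * mu A + norm V * (1 - mu (U N))"
      proof (rule add_mono)
        have "4 * e * mu (A \<inter> U N) \<le> 4 * e * mu A" using e A by (intro mult_left_mono mu_mono) auto
        then show "norm (V (chi_L1 (A \<inter> U N))) \<le> 4 * e * mu A" using smallU[OF A, of N] by simp
        have "norm (V (chi_L1 (A - U N))) \<le> norm V * mu (A - U N)"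
          using norm_blinfun[of V "chi_L1 (A - U N)"] norm_chi[OF AU(2), where 'k = 'k] by simp
        also have "mu (A - U N) \<le> mu (compl (U N))" using sets_leb01D[OF A] U by (intro mu_mono) auto
        also have "mu (compl (U N)) = 1 - mu (U N)" using leb01.prob_compl[OF U[of N]] by simp
        finally show "norm (V (chi_L1 (A - U N))) \<le> norm V * (1 - mu (U N))" by (simp add: mult_left_mono)
      qed
      finally show ?thesis .
    qed
    moreover have "(\<lambda>N. 4 * e * mu A + norm V * (1 - mu (U N))) \<longlonglongrightarrow> 4 * e * mu A + norm V * (1 - 1)"
      by (intro tendsto_intros lim)
    ultimately have "norm (V (chi_L1 A)) \<le> 4 * e * mu A + norm V * (1 - 1)"
      by (intro LIMSEQ_le_const[where X = "\<lambda>N. 4 * e * mu A + norm V * (1 - mu (U N))"]) auto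
    then show ?thesis by simp
  qed
  have "norm V \<le> 4 * e"
  proof (rule norm_blinfun_bound)
    show "norm (V f) \<le> 4 * e * norm f" for f
    proof (rule L1_operator_bound)
      show "V (scale_L1 r f) = scale_L1 r (V f)" for r f
        by (simp add: V_def blinfun.diff_left operatorsD[OF S(1)] operatorsD[OF T(1)] operatorsD[OF B(1)]
            operatorsD[OF C(1)] L1.scale_right_diff_distrib)
    qed (use V_chi e in \<open>auto simp: blinfun.bounded_linear_right\<close>)
  qed (use e in simp)
  then show ?thesis using B(1) C(1) unfolding V_def by blast
qed

lemma dagger_closure_subset:
  fixes I\<^sub>1 I\<^sub>2 :: "('k::{scalar, euclidean_space} L1 \<Rightarrow>\<^sub>L 'k L1) set"
  assumes I1: "small_ideal I\<^sub>1" and I2: "small_ideal I\<^sub>2" and sub: "dagger I\<^sub>1 \<subseteq> closure (dagger I\<^sub>2)"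
  shows "I\<^sub>1 \<subseteq> closure I\<^sub>2"
proof
  have equi: "T \<in> operators scale_L1" "equi_integrable (T ` cball 0 1)"
    if "small_ideal I" "T \<in> I" for I and T :: "'k L1 \<Rightarrow>\<^sub>L 'k L1"
    using that strictly_singular_equi_integrable[of T] unfolding small_ideal_def by auto
  fix S assume "S \<in> I\<^sub>1"
  note S = equi[OF I1 this]
  obtain Q where Q: "Q \<in> operators scale_Linf" "is_adjoint S Q" using adjoint_exists[OF S(1)] by blast
  have "id_blinfun \<in> operators (scale_Linf :: 'k \<Rightarrow> _)" by (simp add: operators_def)
  moreover have "Q = id_blinfun o\<^sub>L Q o\<^sub>L id_blinfun" by (rule blinfun_eqI) simp
  ultimately have "Q \<in> dagger I\<^sub>1"
    unfolding dagger_def sharp_def using Q \<open>S \<in> I\<^sub>1\<close> by blast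
  with sub have Qcl: "Q \<in> closure (dagger I\<^sub>2)" by blast
  show "S \<in> closure I\<^sub>2"
    unfolding closure_approachable
  proof (intro allI impI)
    fix e :: real assume e: "e > 0"
    then have "e / 5 > 0" by simp
    with Qcl obtain X where X: "X \<in> dagger I\<^sub>2" "dist X Q < e / 5" unfolding closure_approachable by blast
    then obtain E R F T where *: "X = E o\<^sub>L R o\<^sub>L F" "E \<in> operators scale_Linf" "F \<in> operators scale_Linf"
      "R \<in> operators scale_Linf" "T \<in> I\<^sub>2" "is_adjoint T R"
      unfolding dagger_def sharp_def by blast
    note T = equi[OF I2 *(5)]
    have "norm (Q - (E o\<^sub>L R o\<^sub>L F)) \<le> e / 5" using X(2) by (simp add: *(1) dist_norm norm_minus_commute)
    from predual_factorization[OF S Q(2) T *(4,6,2,3) this \<open>e / 5 > 0\<close>]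
    obtain B C where BC: "B \<in> operators scale_L1" "C \<in> operators scale_L1" "norm (S - (C o\<^sub>L T o\<^sub>L B)) \<le> 4 * (e / 5)"
      by blast
    interpret ideal I\<^sub>2 "operator_ring scale_L1" using I2 by (simp add: small_ideal_def)
    have "C o\<^sub>L T \<in> I\<^sub>2" using I_l_closed[OF *(5), of C] BC(2) by (simp add: operator_ring_def)
    then have "C o\<^sub>L T o\<^sub>L B \<in> I\<^sub>2" using I_r_closed[of "C o\<^sub>L T" B] BC(1) by (simp add: operator_ring_def)
    moreover have "dist (C o\<^sub>L T o\<^sub>L B) S < e" using BC(3) e by (simp add: dist_norm norm_minus_commute)
    ultimately show "\<exists>y\<in>I\<^sub>2. dist y S < e" by blast
  qed
qed

lemma closure_dagger_inj:
  fixes I\<^sub>1 I\<^sub>2 :: "('k::{scalar, euclidean_space} L1 \<Rightarrow>\<^sub>L 'k L1) set"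
  assumes I: "small_ideal I\<^sub>1" "small_ideal I\<^sub>2" and eq: "closure (dagger I\<^sub>1) = closure (dagger I\<^sub>2)"
  shows "closure I\<^sub>1 = closure I\<^sub>2"
proof -
  have "I\<^sub>1 \<subseteq> closure I\<^sub>2" using closure_subset[of "dagger I\<^sub>1"] eq by (intro dagger_closure_subset I) simp
  moreover have "I\<^sub>2 \<subseteq> closure I\<^sub>1" using closure_subset[of "dagger I\<^sub>2"] eq by (intro dagger_closure_subset I) simp
  ultimately show ?thesis by (intro equalityI closure_minimal closed_closure)
qed

theorem corollary4p4:
  shows "(\<forall>I\<^sub>1 I\<^sub>2 :: (real L1 \<Rightarrow>\<^sub>L real L1) set.
            small_ideal I\<^sub>1 \<longrightarrow> small_ideal I\<^sub>2 \<longrightarrow> closure I\<^sub>1 \<noteq> closure I\<^sub>2 \<longrightarrow>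
            closure (dagger I\<^sub>1) \<noteq> closure (dagger I\<^sub>2)) \<and>
         (\<forall>I\<^sub>1 I\<^sub>2 :: (complex L1 \<Rightarrow>\<^sub>L complex L1) set.
            small_ideal I\<^sub>1 \<longrightarrow> small_ideal I\<^sub>2 \<longrightarrow> closure I\<^sub>1 \<noteq> closure I\<^sub>2 \<longrightarrow>
            closure (dagger I\<^sub>1) \<noteq> closure (dagger I\<^sub>2))"
  by (intro conjI allI impI notI; blast dest: closure_dagger_inj)

end
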